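(* Let $\mathbb F$ be a finitely generated nontrivial free group, $\Phi\colon\mathbb F\to\mathbb F$ an automorphism with outer class $\phi=[\Phi]$, and $\mathbb G=\mathbb F\rtimes_\Phi\mathbb Z$. If $\mathbb F$ is not cyclic, then slender (resp. cyclic) splittings of $\mathbb G$ are naturally in one-to-one correspondence with $\phi$-fixed cyclic (resp. free) splittings of $\mathbb F$.
   Context: $\mathbb F\rtimes_\Phi\mathbb Z=\langle\mathbb F,t\mid txt^{-1}=\Phi(x)\text{ for all }x\in\mathbb F\rangle$. A group is slender if all its subgroups are finitely generated; the trivial group counts as cyclic. A slender (resp. cyclic, resp. free) splitting of a group is a simplicial tree with a minimal nontrivial simplicial action of the group, possibly with inversions of edges, whose edge (setwise) stabilisers are slender (resp. cyclic, resp. trivial). A cyclic splitting $T$ of $\mathbb F$ is $\phi$-fixed if it admits a simplicial automorphism $g\colon T\to T$ that is $\Phi$-equivariant, i.e. $g(x\cdot p)=\Phi(x)\cdot g(p)$ for all $x\in\mathbb F$, $p\in T$. *)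

theory Defs
  imports "HOL-Algebra.Group_Action" "HOL-Algebra.Elementary_Groups"
begin

section \<open>Free groups, finite generation, slenderness\<close>

text \<open>
  A letter \<open>(s, True)\<close> stands for \<open>s\<close> and \<open>(s, False)\<close> for its inverse.
\<close>

definition word_value :: "('a, 'b) monoid_scheme \<Rightarrow> ('a \<times> bool) list \<Rightarrow> 'a" where
  "word_value G w =
     foldr (\<lambda>(s, b) g. (if b then s else inv\<^bsub>G\<^esub> s) \<otimes>\<^bsub>G\<^esub> g) w \<one>\<^bsub>G\<^esub>"

definition reduced_word :: "('a \<times> bool) list \<Rightarrow> bool" where
  "reduced_word w \<longleftrightarrow> successively (\<lambda>(s, b) (s', b'). \<not> (s = s' \<and> b \<noteq> b')) w"

definition free_basis :: "('a, 'b) monoid_scheme \<Rightarrow> 'a set \<Rightarrow> bool" where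
  "free_basis G S \<longleftrightarrow>
     S \<subseteq> carrier G \<and> generate G S = carrier G \<and>
     (\<forall>w. set w \<subseteq> S \<times> UNIV \<and> reduced_word w \<and> w \<noteq> [] \<longrightarrow> word_value G w \<noteq> \<one>\<^bsub>G\<^esub>)"

definition free_group :: "('a, 'b) monoid_scheme \<Rightarrow> bool" where
  "free_group G \<longleftrightarrow> group G \<and> (\<exists>S. free_basis G S)"

definition finitely_generated_group :: "('a, 'b) monoid_scheme \<Rightarrow> bool" where
  "finitely_generated_group G \<longleftrightarrow>
     group G \<and> (\<exists>S. finite S \<and> S \<subseteq> carrier G \<and> generate G S = carrier G)"

definition slender_group :: "('a, 'b) monoid_scheme \<Rightarrow> bool" where
  "slender_group G \<longleftrightarrow>
     group G \<and> (\<forall>H. subgroup H G \<longrightarrow> finitely_generated_group (G\<lparr>carrier := H\<rparr>))"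


section \<open>The mapping torus of an automorphism\<close>

text \<open>
  The pair \<open>(x, n)\<close> stands for \<open>x t\<^sup>n\<close>; so \<open>x \<mapsto> (x, 0)\<close> is the inclusion of \<open>F\<close> and
  \<open>(\<one>, 1)\<close> is the stable letter \<open>t\<close>. The lemmas below show that this group has the
  presentation \<open>\<langle>F, t | t x t\<^sup>-\<^sup>1 = \<Phi>(x) for all x in F\<rangle>\<close>.
\<close>

definition mapping_torus :: "('a, 'b) monoid_scheme \<Rightarrow> ('a \<Rightarrow> 'a) \<Rightarrow> ('a \<times> int) monoid" where
  "mapping_torus F \<Phi> =
     \<lparr>carrier = carrier F \<times> UNIV,
      monoid.mult = (\<lambda>(x, m) (y, n). (x \<otimes>\<^bsub>F\<^esub> (\<Phi> [^]\<^bsub>AutoGroup F\<^esub> m) y, m + n)),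
      one = (\<one>\<^bsub>F\<^esub>, 0)\<rparr>"

context group
begin

lemma auto_pow_closed:
  assumes "\<Phi> \<in> auto G"
  shows "\<Phi> [^]\<^bsub>AutoGroup G\<^esub> (n::int) \<in> auto G"
proof -
  interpret A: group "AutoGroup G" by (rule AutoGroup)
  show ?thesis
    using A.int_pow_closed[of \<Phi> n] assms by (simp add: AutoGroup_def)
qed

lemma auto_mem:
  assumes "\<Phi> \<in> auto G" "x \<in> carrier G"
  shows "\<Phi> x \<in> carrier G"
  using assms by (auto simp: auto_def hom_def)

lemma auto_mult:
  assumes "\<Phi> \<in> auto G" "x \<in> carrier G" "y \<in> carrier G"
  shows "\<Phi> (x \<otimes> y) = \<Phi> x \<otimes> \<Phi> y"
  using assms by (auto simp: auto_def hom_def)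

lemma auto_one:
  assumes "\<Phi> \<in> auto G"
  shows "\<Phi> \<one> = \<one>"
  using assms by (auto simp: auto_def intro: hom_one[OF _ is_group is_group])

lemma auto_pow_add:
  assumes "\<Phi> \<in> auto G" "x \<in> carrier G"
  shows "(\<Phi> [^]\<^bsub>AutoGroup G\<^esub> (m + n :: int)) x =
         (\<Phi> [^]\<^bsub>AutoGroup G\<^esub> m) ((\<Phi> [^]\<^bsub>AutoGroup G\<^esub> n) x)"
proof -
  interpret A: group "AutoGroup G" by (rule AutoGroup)
  have mult: "f \<otimes>\<^bsub>AutoGroup G\<^esub> g = compose (carrier G) f g"
    if "f \<in> Bij (carrier G)" "g \<in> Bij (carrier G)" for f g
    using that by (simp add: AutoGroup_def BijGroup_def)
  have c: "\<Phi> \<in> carrier (AutoGroup G)" using assms by (simp add: AutoGroup_def)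
  have m: "\<Phi> [^]\<^bsub>AutoGroup G\<^esub> m \<in> Bij (carrier G)" "\<Phi> [^]\<^bsub>AutoGroup G\<^esub> n \<in> Bij (carrier G)"
    using auto_pow_closed[OF assms(1)] by (auto simp: auto_def)
  have "\<Phi> [^]\<^bsub>AutoGroup G\<^esub> (m + n) =
        \<Phi> [^]\<^bsub>AutoGroup G\<^esub> m \<otimes>\<^bsub>AutoGroup G\<^esub> \<Phi> [^]\<^bsub>AutoGroup G\<^esub> n"
    by (rule A.int_pow_mult[OF c])
  also have "\<dots> = compose (carrier G) (\<Phi> [^]\<^bsub>AutoGroup G\<^esub> m) (\<Phi> [^]\<^bsub>AutoGroup G\<^esub> n)"
    by (rule mult[OF m])
  finally show ?thesis using assms(2) by (simp only: compose_def restrict_apply if_True)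
qed

lemma one_AutoGroup_apply:
  assumes "x \<in> carrier G"
  shows "\<one>\<^bsub>AutoGroup G\<^esub> x = x"
  using assms by (simp add: AutoGroup_def BijGroup_def)

lemma auto_pow_1:
  assumes "\<Phi> \<in> auto G"
  shows "\<Phi> [^]\<^bsub>AutoGroup G\<^esub> (1::int) = \<Phi>"
proof -
  interpret A: group "AutoGroup G" by (rule AutoGroup)
  show ?thesis using assms A.int_pow_1[of \<Phi>] by (simp add: AutoGroup_def)
qed

lemma group_mapping_torus:
  assumes "\<Phi> \<in> auto G"
  shows "group (mapping_torus G \<Phi>)"
proof (rule groupI)
  note P = auto_pow_closed[OF assms]
  fix x assume "x \<in> carrier (mapping_torus G \<Phi>)"
  then obtain a m where x: "x = (a, m)" "a \<in> carrier G" by (auto simp: mapping_torus_def)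
  let ?y = "((\<Phi> [^]\<^bsub>AutoGroup G\<^esub> (- m)) (inv a), - m)"
  have "(\<Phi> [^]\<^bsub>AutoGroup G\<^esub> (- m)) (inv a) \<otimes> (\<Phi> [^]\<^bsub>AutoGroup G\<^esub> (- m)) a = \<one>"
    using x by (simp add: auto_mult[OF P, symmetric] auto_one[OF P])
  then have "?y \<otimes>\<^bsub>mapping_torus G \<Phi>\<^esub> x = \<one>\<^bsub>mapping_torus G \<Phi>\<^esub>"
    using x by (simp add: mapping_torus_def)
  moreover have "?y \<in> carrier (mapping_torus G \<Phi>)"
    using x by (simp add: mapping_torus_def auto_mem[OF P])
  ultimately show "\<exists>y\<in>carrier (mapping_torus G \<Phi>). y \<otimes>\<^bsub>mapping_torus G \<Phi>\<^esub> x = \<one>\<^bsub>mapping_torus G \<Phi>\<^esub>"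
    by blast
next
  note P = auto_pow_closed[OF assms]
  fix x y z
  assume "x \<in> carrier (mapping_torus G \<Phi>)" "y \<in> carrier (mapping_torus G \<Phi>)"
    "z \<in> carrier (mapping_torus G \<Phi>)"
  then show "x \<otimes>\<^bsub>mapping_torus G \<Phi>\<^esub> y \<otimes>\<^bsub>mapping_torus G \<Phi>\<^esub> z =
             x \<otimes>\<^bsub>mapping_torus G \<Phi>\<^esub> (y \<otimes>\<^bsub>mapping_torus G \<Phi>\<^esub> z)"
    by (auto simp: mapping_torus_def auto_pow_add[OF assms] auto_mult[OF P] auto_mem[OF P] m_assoc)
qed (auto simp: mapping_torus_def one_AutoGroup_apply auto_mem[OF auto_pow_closed[OF assms]])

lemma mapping_torus_relation:
  assumes "\<Phi> \<in> auto G" "x \<in> carrier G"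
  shows "(\<one>, 1) \<otimes>\<^bsub>mapping_torus G \<Phi>\<^esub> (x, 0) \<otimes>\<^bsub>mapping_torus G \<Phi>\<^esub> inv\<^bsub>mapping_torus G \<Phi>\<^esub> (\<one>, 1)
         = (\<Phi> x, 0)"
proof -
  interpret M: group "mapping_torus G \<Phi>" by (rule group_mapping_torus[OF assms(1)])
  have c: "(\<one>, 1) \<in> carrier (mapping_torus G \<Phi>)" "(x, 0) \<in> carrier (mapping_torus G \<Phi>)"
    "(\<Phi> x, 0) \<in> carrier (mapping_torus G \<Phi>)"
    using assms by (auto simp: mapping_torus_def auto_mem)
  have "(\<one>, 1) \<otimes>\<^bsub>mapping_torus G \<Phi>\<^esub> (x, 0) = (\<Phi> x, 0) \<otimes>\<^bsub>mapping_torus G \<Phi>\<^esub> (\<one>, 1)"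
    using assms by (simp add: mapping_torus_def auto_pow_1 one_AutoGroup_apply auto_mem)
  then show ?thesis
    using c by (metis M.inv_solve_right M.m_closed)
qed

lemma mapping_torus_inclusion:
  assumes "\<Phi> \<in> auto G"
  shows "(\<lambda>x. (x, 0)) \<in> hom G (mapping_torus G \<Phi>)"
  by (auto simp: hom_def mapping_torus_def one_AutoGroup_apply)

lemma mapping_torus_universal:
  fixes H :: "('c, 'd) monoid_scheme"
  assumes \<Phi>: "\<Phi> \<in> auto G" and H: "group H" and f: "f \<in> hom G H" and s: "s \<in> carrier H"
    and rel: "\<And>x. x \<in> carrier G \<Longrightarrow> s \<otimes>\<^bsub>H\<^esub> f x \<otimes>\<^bsub>H\<^esub> inv\<^bsub>H\<^esub> s = f (\<Phi> x)"
  shows "\<exists>!k. k \<in> hom (mapping_torus G \<Phi>) H \<inter> extensional (carrier (mapping_torus G \<Phi>)) \<and>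
              (\<forall>x\<in>carrier G. k (x, 0) = f x) \<and> k (\<one>\<^bsub>G\<^esub>, 1) = s"
proof -
  interpret H: group H by (rule H)
  interpret M: group "mapping_torus G \<Phi>" by (rule group_mapping_torus[OF \<Phi>])
  let ?M = "mapping_torus G \<Phi>"
  let ?P = "\<lambda>n::int. \<Phi> [^]\<^bsub>AutoGroup G\<^esub> n"
  let ?t = "(\<one>\<^bsub>G\<^esub>, 1::int)"
  note P = auto_pow_closed[OF \<Phi>]
  have fc: "f x \<in> carrier H" if "x \<in> carrier G" for x
    using f that by (auto simp: hom_def)
  have fm: "f (x \<otimes>\<^bsub>G\<^esub> y) = f x \<otimes>\<^bsub>H\<^esub> f y" if "x \<in> carrier G" "y \<in> carrier G" for x y
    using f that by (auto simp: hom_def)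
  have f1: "f \<one>\<^bsub>G\<^esub> = \<one>\<^bsub>H\<^esub>"
    using f H by (meson hom_one is_group)
  have sr: "s \<otimes>\<^bsub>H\<^esub> f x = f (\<Phi> x) \<otimes>\<^bsub>H\<^esub> s" if x: "x \<in> carrier G" for x
  proof -
    have "f (\<Phi> x) \<otimes>\<^bsub>H\<^esub> s = s \<otimes>\<^bsub>H\<^esub> f x \<otimes>\<^bsub>H\<^esub> inv\<^bsub>H\<^esub> s \<otimes>\<^bsub>H\<^esub> s"
      using rel[OF x] by simp
    also have "\<dots> = s \<otimes>\<^bsub>H\<^esub> f x"
      using s fc[OF x] by (simp add: H.m_assoc)
    finally show ?thesis by simp
  qed
  have pow: "\<forall>x\<in>carrier G. s [^]\<^bsub>H\<^esub> n \<otimes>\<^bsub>H\<^esub> f x = f (?P n x) \<otimes>\<^bsub>H\<^esub> s [^]\<^bsub>H\<^esub> n" for n :: int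
  proof (induction n rule: int_induct[where k = 0])
    case base
    then show ?case using fc by (auto simp: one_AutoGroup_apply)
  next
    case (step1 i)
    show ?case
    proof
      fix x assume x: "x \<in> carrier G"
      have i: "s [^]\<^bsub>H\<^esub> (i + 1) = s \<otimes>\<^bsub>H\<^esub> s [^]\<^bsub>H\<^esub> i"
        using H.int_pow_mult[OF s, of 1 i] s by (simp add: add.commute)
      have y: "?P (i + 1) x = \<Phi> (?P i x)" "?P i x \<in> carrier G" "\<Phi> (?P i x) \<in> carrier G"
        using auto_pow_add[OF \<Phi> x, of 1 i] x
        by (simp_all add: auto_pow_1 \<Phi> add.commute auto_mem[OF P] auto_mem[OF \<Phi>])
      have "s [^]\<^bsub>H\<^esub> (i + 1) \<otimes>\<^bsub>H\<^esub> f x = s \<otimes>\<^bsub>H\<^esub> (f (?P i x) \<otimes>\<^bsub>H\<^esub> s [^]\<^bsub>H\<^esub> i)"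
        using step1(2) x s fc[OF x] by (simp add: i H.m_assoc)
      also have "\<dots> = (f (\<Phi> (?P i x)) \<otimes>\<^bsub>H\<^esub> s) \<otimes>\<^bsub>H\<^esub> s [^]\<^bsub>H\<^esub> i"
        using s fc[OF y(2)] by (simp only: sr[OF y(2), symmetric] H.m_assoc H.int_pow_closed)
      finally show "s [^]\<^bsub>H\<^esub> (i + 1) \<otimes>\<^bsub>H\<^esub> f x = f (?P (i + 1) x) \<otimes>\<^bsub>H\<^esub> s [^]\<^bsub>H\<^esub> (i + 1)"
        using s fc[OF y(3)] by (simp add: i y(1) H.m_assoc)
    qed
  next
    case (step2 i)
    show ?case
    proof
      fix x assume x: "x \<in> carrier G"
      let ?y = "?P (i - 1) x"
      have i: "s [^]\<^bsub>H\<^esub> i = s \<otimes>\<^bsub>H\<^esub> s [^]\<^bsub>H\<^esub> (i - 1)"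
        using H.int_pow_mult[OF s, of 1 "i - 1"] s by simp
      have y: "?P i x = \<Phi> ?y" "?y \<in> carrier G" "\<Phi> ?y \<in> carrier G"
        using auto_pow_add[OF \<Phi> x, of 1 "i - 1"] x
        by (simp_all add: auto_pow_1 \<Phi> auto_mem[OF P] auto_mem[OF \<Phi>])
      have "s \<otimes>\<^bsub>H\<^esub> (s [^]\<^bsub>H\<^esub> (i - 1) \<otimes>\<^bsub>H\<^esub> f x) = s [^]\<^bsub>H\<^esub> i \<otimes>\<^bsub>H\<^esub> f x"
        using s fc[OF x] by (simp add: i H.m_assoc)
      also have "\<dots> = f (\<Phi> ?y) \<otimes>\<^bsub>H\<^esub> s \<otimes>\<^bsub>H\<^esub> s [^]\<^bsub>H\<^esub> (i - 1)"
        using step2(2) x s fc[OF y(3)] by (simp add: y(1) H.m_assoc flip: i)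
      also have "\<dots> = s \<otimes>\<^bsub>H\<^esub> (f ?y \<otimes>\<^bsub>H\<^esub> s [^]\<^bsub>H\<^esub> (i - 1))"
        using s fc[OF y(2)] by (simp only: sr[OF y(2), symmetric] H.m_assoc H.int_pow_closed)
      finally show "s [^]\<^bsub>H\<^esub> (i - 1) \<otimes>\<^bsub>H\<^esub> f x = f ?y \<otimes>\<^bsub>H\<^esub> s [^]\<^bsub>H\<^esub> (i - 1)"
        using s fc[OF x] fc[OF y(2)] by (metis H.Units_eq H.Units_l_cancel H.int_pow_closed H.m_closed)
    qed
  qed
  define k where "k = (\<lambda>(x, n)\<in>carrier ?M. f x \<otimes>\<^bsub>H\<^esub> s [^]\<^bsub>H\<^esub> (n::int))"
  have k: "k (x, n) = f x \<otimes>\<^bsub>H\<^esub> s [^]\<^bsub>H\<^esub> n" if "x \<in> carrier G" for x n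
    using that by (simp add: k_def mapping_torus_def)
  have kh: "k \<in> hom ?M H"
  proof (rule homI)
    fix u assume "u \<in> carrier ?M"
    then show "k u \<in> carrier H"
      using s fc by (auto simp: mapping_torus_def k)
  next
    fix u v assume "u \<in> carrier ?M" "v \<in> carrier ?M"
    then obtain x m y n where uv: "u = (x, m)" "v = (y, n)" "x \<in> carrier G" "y \<in> carrier G"
      by (auto simp: mapping_torus_def)
    have z: "?P m y \<in> carrier G" using uv(4) by (rule auto_mem[OF P])
    have "k u \<otimes>\<^bsub>H\<^esub> k v = f x \<otimes>\<^bsub>H\<^esub> ((s [^]\<^bsub>H\<^esub> m \<otimes>\<^bsub>H\<^esub> f y) \<otimes>\<^bsub>H\<^esub> s [^]\<^bsub>H\<^esub> n)"
      using s fc uv by (simp add: k H.m_assoc)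
    also have "\<dots> = f x \<otimes>\<^bsub>H\<^esub> ((f (?P m y) \<otimes>\<^bsub>H\<^esub> s [^]\<^bsub>H\<^esub> m) \<otimes>\<^bsub>H\<^esub> s [^]\<^bsub>H\<^esub> n)"
      by (simp only: bspec[OF pow uv(4)])
    also have "\<dots> = f (x \<otimes>\<^bsub>G\<^esub> ?P m y) \<otimes>\<^bsub>H\<^esub> s [^]\<^bsub>H\<^esub> (m + n)"
      using s fc uv(3) z by (simp add: fm H.m_assoc H.int_pow_mult)
    also have "\<dots> = k (u \<otimes>\<^bsub>?M\<^esub> v)"
      using uv z k[of "x \<otimes>\<^bsub>G\<^esub> ?P m y" "m + n"] by (simp add: mapping_torus_def)
    finally show "k (u \<otimes>\<^bsub>?M\<^esub> v) = k u \<otimes>\<^bsub>H\<^esub> k v" by simp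
  qed
  have tc: "?t \<in> carrier ?M" by (simp add: mapping_torus_def)
  have tpow: "?t [^]\<^bsub>?M\<^esub> n = (\<one>\<^bsub>G\<^esub>, n)" for n :: int
  proof (induction n rule: int_induct[where k = 0])
    case base
    then show ?case by (simp add: mapping_torus_def)
  next
    case (step1 i)
    have "?t [^]\<^bsub>?M\<^esub> (i + 1) = ?t [^]\<^bsub>?M\<^esub> i \<otimes>\<^bsub>?M\<^esub> ?t"
      using M.int_pow_mult[OF tc, of i 1] M.int_pow_1[OF tc] by simp
    also have "\<dots> = (\<one>\<^bsub>G\<^esub>, i) \<otimes>\<^bsub>?M\<^esub> ?t" using step1(2) by simp
    also have "\<dots> = (\<one>\<^bsub>G\<^esub>, i + 1)" by (simp add: mapping_torus_def auto_one[OF P])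
    finally show ?case .
  next
    case (step2 i)
    have "?t [^]\<^bsub>?M\<^esub> (i - 1) \<otimes>\<^bsub>?M\<^esub> ?t = ?t [^]\<^bsub>?M\<^esub> i"
      using M.int_pow_mult[OF tc, of "i - 1" 1] M.int_pow_1[OF tc] by simp
    also have "\<dots> = (\<one>\<^bsub>G\<^esub>, i)" using step2(2) by simp
    also have "\<dots> = (\<one>\<^bsub>G\<^esub>, i - 1) \<otimes>\<^bsub>?M\<^esub> ?t" by (simp add: mapping_torus_def auto_one[OF P])
    finally have "?t [^]\<^bsub>?M\<^esub> (i - 1) \<otimes>\<^bsub>?M\<^esub> ?t = (\<one>\<^bsub>G\<^esub>, i - 1) \<otimes>\<^bsub>?M\<^esub> ?t" .
    moreover have "(\<one>\<^bsub>G\<^esub>, i - 1) \<in> carrier ?M" by (simp add: mapping_torus_def)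
    ultimately show ?case using tc M.int_pow_closed[OF tc] by (metis M.right_cancel)
  qed
  show ?thesis
  proof (rule ex1I[of _ k], intro conjI ballI)
    show "k \<in> hom ?M H \<inter> extensional (carrier ?M)"
      using kh by (simp add: k_def)
  next
    fix x assume "x \<in> carrier G"
    then show "k (x, 0) = f x" using k[of x 0] fc by simp
  next
    show "k ?t = s" using k[of "\<one>\<^bsub>G\<^esub>" 1] f1 s by simp
  next
    fix l
    assume l: "l \<in> hom ?M H \<inter> extensional (carrier ?M) \<and> (\<forall>x\<in>carrier G. l (x, 0) = f x) \<and> l ?t = s"
    interpret l: group_hom ?M H l
      using l by (intro group_hom.intro group_hom_axioms.intro M.is_group H) auto
    show "l = k"
    proof (rule extensionalityI[of _ "carrier ?M"])
      show "l \<in> extensional (carrier ?M)" using l by simp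
      show "k \<in> extensional (carrier ?M)" by (simp add: k_def)
      fix u assume "u \<in> carrier ?M"
      then obtain x n where u: "u = (x, n)" "x \<in> carrier G" by (auto simp: mapping_torus_def)
      have x0: "(x, 0) \<in> carrier ?M" using u by (simp add: mapping_torus_def)
      have "u = (x, 0) \<otimes>\<^bsub>?M\<^esub> ?t [^]\<^bsub>?M\<^esub> n"
        unfolding tpow using u by (simp add: mapping_torus_def one_AutoGroup_apply)
      then have "l u = l (x, 0) \<otimes>\<^bsub>H\<^esub> l ?t [^]\<^bsub>H\<^esub> n"
        using x0 tc by (simp add: l.hom_int_pow M.int_pow_closed)
      then show "l u = k u" using l u by (simp add: k)
    qed
  qed
qed

end


section \<open>Simplicial trees and splittings\<close>

definition simplicial_graph :: "'v set \<Rightarrow> 'v set set \<Rightarrow> bool" where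
  "simplicial_graph V E \<longleftrightarrow> (\<forall>e\<in>E. \<exists>u\<in>V. \<exists>v\<in>V. u \<noteq> v \<and> e = {u, v})"

definition edge_path :: "'v set set \<Rightarrow> 'v list \<Rightarrow> bool" where
  "edge_path E p \<longleftrightarrow> successively (\<lambda>u v. {u, v} \<in> E) p"

definition simplicial_tree :: "'v set \<Rightarrow> 'v set set \<Rightarrow> bool" where
  "simplicial_tree V E \<longleftrightarrow>
     simplicial_graph V E \<and> V \<noteq> {} \<and>
     (\<forall>u\<in>V. \<forall>v\<in>V. \<exists>p. p \<noteq> [] \<and> hd p = u \<and> last p = v \<and> edge_path E p) \<and>
     \<not> (\<exists>p. 3 \<le> length p \<and> distinct p \<and> edge_path E p \<and> {last p, hd p} \<in> E)"

record ('g, 'v) gtree =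
  tverts :: "'v set"
  tedges :: "'v set set"
  tact :: "'g \<Rightarrow> 'v \<Rightarrow> 'v"

text \<open>A simplicial isomorphism is recorded by its map on vertices.\<close>

definition simplicial_iso :: "('v \<Rightarrow> 'w) \<Rightarrow> ('g, 'v) gtree \<Rightarrow> ('h, 'w) gtree \<Rightarrow> bool" where
  "simplicial_iso h T T' \<longleftrightarrow>
     bij_betw h (tverts T) (tverts T') \<and> (\<lambda>e. h ` e) ` tedges T = tedges T'"

text \<open>
  Extensionality in the group argument only discards the junk values of the action outside
  \<open>carrier G\<close>, so that equality of \<open>G\<close>-trees means what it should.
\<close>

definition is_gtree :: "('g, 'b) monoid_scheme \<Rightarrow> ('g, 'v) gtree \<Rightarrow> bool" where
  "is_gtree G T \<longleftrightarrow>
     simplicial_tree (tverts T) (tedges T) \<and>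
     group_action G (tverts T) (tact T) \<and> tact T \<in> extensional (carrier G) \<and>
     (\<forall>g\<in>carrier G. simplicial_iso (tact T g) T T)"

text \<open>Elements that invert the edge are included.\<close>

definition edge_stabiliser :: "('g, 'b) monoid_scheme \<Rightarrow> ('g, 'v) gtree \<Rightarrow> 'v set \<Rightarrow> 'g set" where
  "edge_stabiliser G T e = stabilizer G (\<lambda>g e. tact T g ` e) e"

definition minimal_gtree :: "('g, 'b) monoid_scheme \<Rightarrow> ('g, 'v) gtree \<Rightarrow> bool" where
  "minimal_gtree G T \<longleftrightarrow>
     (\<forall>V E. V \<subseteq> tverts T \<and> E \<subseteq> tedges T \<and> simplicial_tree V E \<and>
        (\<forall>g\<in>carrier G. tact T g ` V = V \<and> (\<lambda>e. tact T g ` e) ` E = E)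
        \<longrightarrow> V = tverts T \<and> E = tedges T)"

text \<open>
  An action is trivial if it fixes a point of the geometric realisation. As inversions are
  allowed, this point is either a vertex or the midpoint of an invariant edge.
\<close>

definition nontrivial_gtree :: "('g, 'b) monoid_scheme \<Rightarrow> ('g, 'v) gtree \<Rightarrow> bool" where
  "nontrivial_gtree G T \<longleftrightarrow>
     (\<forall>v\<in>tverts T. stabilizer G (tact T) v \<noteq> carrier G) \<and>
     (\<forall>e\<in>tedges T. edge_stabiliser G T e \<noteq> carrier G)"

definition splitting ::
  "('g monoid \<Rightarrow> bool) \<Rightarrow> 'g monoid \<Rightarrow> ('g, 'v) gtree \<Rightarrow> bool" where
  "splitting P G T \<longleftrightarrow>
     is_gtree G T \<and> minimal_gtree G T \<and> nontrivial_gtree G T \<and>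
     (\<forall>e\<in>tedges T. P (G\<lparr>carrier := edge_stabiliser G T e\<rparr>))"

definition slender_splittings :: "'g monoid \<Rightarrow> ('g, 'v) gtree set" where
  "slender_splittings G = {T. splitting slender_group G T}"

definition cyclic_splittings :: "'g monoid \<Rightarrow> ('g, 'v) gtree set" where
  "cyclic_splittings G = {T. splitting cyclic_group G T}"

definition free_splittings :: "'g monoid \<Rightarrow> ('g, 'v) gtree set" where
  "free_splittings G = {T. splitting trivial_group G T}"

definition fixed_gtrees :: "'g monoid \<Rightarrow> ('g \<Rightarrow> 'g) \<Rightarrow> ('g, 'v) gtree set" where
  "fixed_gtrees F \<Phi> =
     {T. \<exists>g. simplicial_iso g T T \<and>
             (\<forall>x\<in>carrier F. \<forall>p\<in>tverts T. g (tact T x p) = tact T (\<Phi> x) (g p))}"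


section \<open>Equivariant isomorphism and restriction to the fibre\<close>

definition gtree_iso ::
  "'g monoid \<Rightarrow> ('v \<Rightarrow> 'w) \<Rightarrow> ('g, 'v) gtree \<Rightarrow> ('g, 'w) gtree \<Rightarrow> bool" where
  "gtree_iso G h T T' \<longleftrightarrow>
     simplicial_iso h T T' \<and>
     (\<forall>x\<in>carrier G. \<forall>p\<in>tverts T. h (tact T x p) = tact T' x (h p))"

definition gtree_iso_rel ::
  "'g monoid \<Rightarrow> ('g, 'v) gtree set \<Rightarrow> (('g, 'v) gtree \<times> ('g, 'v) gtree) set" where
  "gtree_iso_rel G A = {(T, T'). T \<in> A \<and> T' \<in> A \<and> (\<exists>h. gtree_iso G h T T')}"

definition restrict_to_fibre :: "'a monoid \<Rightarrow> ('a \<times> int, 'v) gtree \<Rightarrow> ('a, 'v) gtree" where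
  "restrict_to_fibre F T =
     \<lparr>tverts = tverts T, tedges = tedges T, tact = (\<lambda>x\<in>carrier F. tact T (x, 0))\<rparr>"

text \<open>
  The natural correspondence restricts the action on a tree from the mapping torus to \<open>F\<close>.
  It is bijective for actions on a given tree (first clause), induces a bijection on
  equivariant isomorphism classes (second clause), and is compatible with isomorphisms:
  each \<open>F\<close>-equivariant isomorphism between restrictions is equivariant for the mapping torus,
  and conversely (third clause).
\<close>

definition natural_correspondence ::
  "'a monoid \<Rightarrow> ('a \<Rightarrow> 'a) \<Rightarrow> ('a \<times> int, 'v) gtree set \<Rightarrow> ('a, 'v) gtree set \<Rightarrow> bool" where
  "natural_correspondence F \<Phi> A B \<longleftrightarrow>
     bij_betw (restrict_to_fibre F) A B \<and>
     bij_betw (\<lambda>C. restrict_to_fibre F ` C)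
       (A // gtree_iso_rel (mapping_torus F \<Phi>) A) (B // gtree_iso_rel F B) \<and>
     (\<forall>T\<in>A. \<forall>T'\<in>A. \<forall>h.
        gtree_iso (mapping_torus F \<Phi>) h T T' \<longleftrightarrow>
        gtree_iso F h (restrict_to_fibre F T) (restrict_to_fibre F T'))"

end

theory Submission
  imports Defs
begin

text \<open>
  Write \<open>G\<close> for the mapping torus. If \<open>T\<close> is a slender splitting of \<open>G\<close>, then \<open>F\<close> fixes no vertex of
  \<open>T\<close>: the fixed vertices would form a \<open>G\<close>-invariant subtree, hence all of \<open>T\<close>, and \<open>F\<close> would be
  slender, hence cyclic. A finitely generated group without fixed vertex has a least invariant
  subtree, as two disjoint invariant subtrees would be joined by an arc that the group fixes; for the
  normal subgroup \<open>F\<close> it is \<open>G\<close>-invariant, so \<open>F\<close> acts minimally on \<open>T\<close> and with finitely many orbits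
  of edges. The latter makes every edge stabiliser of \<open>G\<close> project nontrivially to \<open>\<int>\<close>, so a cyclic one
  meets \<open>F\<close> trivially.

  Two extensions of the \<open>F\<close>-action differ by an automorphism of \<open>T\<close> commuting with \<open>F\<close>. Such an
  automorphism is the identity: otherwise it has no fixed vertex, all vertices lie on its axis, and \<open>F\<close>
  acts on this line through translations with cyclic kernel, which is impossible for a free group of
  rank at least two. Conversely, a \<open>\<Phi>\<close>-equivariant automorphism of \<open>T\<close> is the action of the stable
  letter.

  The facts needed about a free group come from its Cayley tree. Counting the crossings of an edge
  orbit gives every nontrivial subgroup \<open>H\<close> a nonzero homomorphism to \<open>\<int>\<close>; the least invariant subtree
  shows that a nontrivial finitely generated normal subgroup of \<open>H\<close> contains a power of each element of
  \<open>H\<close>. If \<open>H\<close> is slender, the kernel of the homomorphism must therefore be trivial.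
\<close>


section \<open>Geodesics and convex sets in trees\<close>

text \<open>Inversions are the obstacle behind several statements. An edge invariant under
  \<open>F\<close> need not contain a fixed vertex; by minimality it would be the whole tree, which
  nontriviality of the action of the torus forbids. Likewise an automorphism commuting with
  \<open>F\<close> and fixing no vertex could invert an edge instead of having an axis; that edge
  would be the only one inverted, hence invariant under \<open>F\<close>. Rank at least two excludes
  a line as follows. Commutators act trivially on it, so the kernel is a nontrivial cyclic normal
  subgroup. Each element has a power in it, and commuting is transitive among nontrivial elements of
  a free group, so everything would commute. A stabiliser in the torus is an extension of its part
  in \<open>F\<close> by a subgroup of the integers. This settles the way back from
  \<open>F\<close>: a cyclic part makes the stabiliser slender, a trivial part makes it cyclic.
  Geometry is phrased through the first vertex \<open>step v u\<close> on the way from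
  \<open>v\<close> to \<open>u\<close>: a subtree is a set closed under \<open>step\<close>, and the
  branches at \<open>v\<close> are the level sets of \<open>step v\<close>.\<close>

definition nonbacktracking :: "'v list \<Rightarrow> bool" where
  "nonbacktracking p \<longleftrightarrow> \<not> (\<exists>a x y b. p = a @ [x, y, x] @ b)"

lemma nonbacktracking_Cons_Cons:
  "nonbacktracking (w # v # p) \<longleftrightarrow> nonbacktracking (v # p) \<and> (p = [] \<or> hd p \<noteq> w)"
proof -
  have "(\<exists>a x y b. w # v # p = a @ [x, y, x] @ b) \<longleftrightarrow>
        (\<exists>a x y b. v # p = a @ [x, y, x] @ b) \<or> (p \<noteq> [] \<and> hd p = w)" (is "?L \<longleftrightarrow> ?R")
  proof
    assume ?L
    then obtain a x y b where "w # v # p = a @ [x, y, x] @ b" by blast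
    then show ?R by (cases a) auto
  next
    assume ?R
    then show ?L
    proof
      assume "\<exists>a x y b. v # p = a @ [x, y, x] @ b"
      then obtain a x y b where "v # p = a @ [x, y, x] @ b" by blast
      then have "w # v # p = (w # a) @ [x, y, x] @ b" by simp
      then show ?L by blast
    next
      assume "p \<noteq> [] \<and> hd p = w"
      then have "w # v # p = [] @ [w, v, w] @ tl p" by (cases p) auto
      then show ?L by blast
    qed
  qed
  then show ?thesis by (auto simp: nonbacktracking_def)
qed

lemma nonbacktracking_Nil [simp]: "nonbacktracking []"
  by (simp add: nonbacktracking_def)

lemma nonbacktracking_singleton [simp]: "nonbacktracking [x]"
  by (auto simp: nonbacktracking_def Cons_eq_append_conv)

lemma nonbacktracking_ConsD: "nonbacktracking (x # p) \<Longrightarrow> nonbacktracking p"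
  unfolding nonbacktracking_def by (metis append_Cons)

lemma nonbacktracking_rev [simp]: "nonbacktracking (rev p) \<longleftrightarrow> nonbacktracking p"
proof -
  have "\<exists>a x y b. rev q = a @ [x, y, x] @ b" if "\<exists>a x y b. q = a @ [x, y, x] @ b" for q :: "'a list"
  proof -
    from that obtain a x y b where "q = a @ [x, y, x] @ b" by blast
    then have "rev q = rev b @ [x, y, x] @ rev a" by simp
    then show ?thesis by blast
  qed
  from this[of p] this[of "rev p"] show ?thesis unfolding nonbacktracking_def rev_rev_ident by blast
qed

lemma edge_path_Cons_Cons: "edge_path E (x # y # p) \<longleftrightarrow> {x, y} \<in> E \<and> edge_path E (y # p)"
  by (simp add: edge_path_def)

lemma edge_path_rev [simp]: "edge_path E (rev p) \<longleftrightarrow> edge_path E p"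
  by (simp add: edge_path_def insert_commute)

locale stree =
  fixes V :: "'v set" and E :: "'v set set"
  assumes tree: "simplicial_tree V E"
begin

abbreviation adj :: "'v \<Rightarrow> 'v \<Rightarrow> bool" where "adj u v \<equiv> {u, v} \<in> E"

lemma adj_sym: "adj u v \<Longrightarrow> adj v u"
  by (simp add: insert_commute)

lemma adjD:
  assumes "adj u v" shows "u \<in> V" "v \<in> V" "u \<noteq> v"
proof -
  obtain x y where "x \<in> V" "y \<in> V" "x \<noteq> y" "{u, v} = {x, y}"
    using assms tree unfolding simplicial_tree_def simplicial_graph_def by blast
  then show "u \<in> V" "v \<in> V" "u \<noteq> v" by (auto simp: doubleton_eq_iff)
qed

lemma edgeE:
  assumes "e \<in> E" obtains u v where "e = {u, v}" "adj u v"
proof -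
  from assms tree obtain u v where "e = {u, v}"
    unfolding simplicial_tree_def simplicial_graph_def by blast
  with assms show ?thesis by (intro that) auto
qed

lemma V_nonempty: "V \<noteq> {}"
  using tree by (simp add: simplicial_tree_def)

text \<open>The path is listed from \<open>v\<close> to \<open>u\<close>, so that moving \<open>v\<close> changes the head of the list.\<close>

definition geodesic :: "'v \<Rightarrow> 'v \<Rightarrow> 'v list \<Rightarrow> bool" where
  "geodesic u v p \<longleftrightarrow> p \<noteq> [] \<and> hd p = v \<and> last p = u \<and> edge_path E p \<and> nonbacktracking p"

text \<open>The tail is distinct by induction, so a recurrence of the head closes up a cycle. Its
  length is at least three, as shorter ones are a loop or a path x, y, x; the tree has no such
  cycle.\<close>

lemma distinct_if_nonbacktracking:
  "edge_path E p \<Longrightarrow> nonbacktracking p \<Longrightarrow> distinct p"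
proof (induction p)
  case (Cons x q)
  then have q: "edge_path E q" "nonbacktracking q"
    using nonbacktracking_ConsD by (auto simp: edge_path_def successively_Cons)
  then have dq: "distinct q" using Cons.IH by blast
  have "x \<notin> set q"
  proof
    assume "x \<in> set q"
    then obtain q1 q2 where s: "q = q1 @ x # q2" by (auto simp: in_set_conv_decomp)
    from Cons.prems(1) have path: "edge_path E (x # q1)" "{last (x # q1), x} \<in> E"
      unfolding s edge_path_def
      by (cases "q1 = []"; auto simp: successively_Cons successively_append_iff)+
    have ne: "q1 \<noteq> []" using path(2) adjD(3)[of x x] by auto
    have "length q1 \<noteq> 1"
    proof
      assume "length q1 = 1"
      then obtain y where "q1 = [y]" by (auto simp: length_Suc_conv)
      then have "x # q = [] @ [x, y, x] @ q2" using s by simp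
      then show False using Cons.prems(2) unfolding nonbacktracking_def by blast
    qed
    then have "3 \<le> length (x # q1)" using ne by (cases q1; cases "tl q1") auto
    moreover have "distinct (x # q1)" using dq s by auto
    moreover have "{last (x # q1), hd (x # q1)} \<in> E" using path(2) by simp
    ultimately show False using tree path(1) unfolding simplicial_tree_def by blast
  qed
  with dq show ?case by simp
qed simp

lemma geodesic_refl: "u \<in> V \<Longrightarrow> geodesic u u [u]"
  by (simp add: geodesic_def edge_path_def)

lemma geodesic_self: "geodesic u u p \<Longrightarrow> p = [u]"
  using distinct_if_nonbacktracking[of p] unfolding geodesic_def
  by (cases p) (auto split: if_splits)

text \<open>If the two paths leave \<open>v\<close> by different neighbours \<open>y\<close> and
  \<open>z\<close>, then \<open>y # q\<close> is reduced too. By induction it equals the tail of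
  \<open>p\<close>, so \<open>p\<close> starts with \<open>v\<close>, \<open>y\<close>,
  \<open>v\<close> and backtracks.\<close>

lemma geodesic_unique: "geodesic u v p \<Longrightarrow> geodesic u v q \<Longrightarrow> p = q"
proof (induction "length p" arbitrary: p q v rule: less_induct)
  case less
  show ?case
  proof (cases "u = v")
    case True
    then show ?thesis using less.prems geodesic_self by metis
  next
    case False
    obtain y p' where p: "p = v # y # p'"
      using less.prems(1) False by (cases p; cases "tl p") (auto simp: geodesic_def)
    obtain z q' where q: "q = v # z # q'"
      using less.prems(2) False by (cases q; cases "tl q") (auto simp: geodesic_def)
    have gy: "geodesic u y (y # p')"
      using less.prems(1) unfolding p geodesic_def
      by (auto simp: edge_path_Cons_Cons nonbacktracking_Cons_Cons)
    have gz: "geodesic u z (z # q')"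
      using less.prems(2) unfolding q geodesic_def
      by (auto simp: edge_path_Cons_Cons nonbacktracking_Cons_Cons)
    show ?thesis
    proof (cases "y = z")
      case True
      then show ?thesis using less.hyps[OF _ gy, of "z # q'"] gz by (simp add: p q)
    next
      case False
      have "geodesic u y (y # v # z # q')"
        using less.prems False unfolding p q geodesic_def
        by (auto simp: edge_path_Cons_Cons nonbacktracking_Cons_Cons insert_commute)
      then have "y # p' = y # v # z # q'" using less.hyps[OF _ gy] p by simp
      then have "\<not> nonbacktracking p" unfolding p by (auto simp: nonbacktracking_Cons_Cons)
      then show ?thesis using less.prems(1) by (simp add: geodesic_def)
    qed
  qed
qed

text \<open>The recursion behind existence and distances: when the end point moves along an edge,
  the geodesic either loses its head or gains a new one.\<close>

lemma geodesic_adj: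
  assumes "geodesic u v p" "adj w v"
  shows "(\<exists>p'. p = v # w # p' \<and> geodesic u w (w # p')) \<or> geodesic u w (w # p)"
proof (cases "\<exists>p'. p = v # w # p'")
  case True
  then obtain p' where p: "p = v # w # p'" by blast
  have "geodesic u w (w # p')" using assms(1) unfolding p geodesic_def
    by (simp add: edge_path_Cons_Cons nonbacktracking_Cons_Cons)
  then show ?thesis using p by blast
next
  case False
  obtain p1 where p: "p = v # p1" using assms(1) by (cases p) (auto simp: geodesic_def)
  have "p1 = [] \<or> hd p1 \<noteq> w" using False p by (cases p1) auto
  then have "geodesic u w (w # p)" using assms unfolding p geodesic_def
    by (simp add: edge_path_Cons_Cons nonbacktracking_Cons_Cons)
  then show ?thesis by blast
qed

lemma geodesic_exists:
  assumes "u \<in> V" "v \<in> V" shows "\<exists>p. geodesic u v p"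
proof -
  obtain q where q: "q \<noteq> []" "hd q = v" "last q = u" "edge_path E q"
    using tree assms unfolding simplicial_tree_def by blast
  then show ?thesis
  proof (induction q arbitrary: v)
    case (Cons x q)
    show ?case
    proof (cases "q = []")
      case True
      then show ?thesis using Cons.prems geodesic_refl assms by auto
    next
      case False
      then have "edge_path E q" "last q = u" "adj v (hd q)"
        using Cons.prems by (auto simp: edge_path_def successively_Cons)
      then show ?thesis using Cons.IH[of "hd q"] False geodesic_adj by blast
    qed
  qed simp
qed

section \<open>Distances and first steps\<close>

definition tdist :: "'v \<Rightarrow> 'v \<Rightarrow> nat" where
  "tdist u v = length (THE p. geodesic u v p) - 1"

lemma tdist_eq: "geodesic u v p \<Longrightarrow> tdist u v = length p - 1"
  using geodesic_unique unfolding tdist_def by (metis the_equality)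

lemma tdist_self: "u \<in> V \<Longrightarrow> tdist u u = 0"
  using tdist_eq[OF geodesic_refl] by simp

lemma geodesic_rev: "geodesic u v p \<Longrightarrow> geodesic v u (rev p)"
  by (simp add: geodesic_def hd_rev last_rev)

lemma tdist_sym:
  assumes "u \<in> V" "v \<in> V" shows "tdist u v = tdist v u"
proof -
  obtain p where "geodesic u v p" using geodesic_exists assms by blast
  then show ?thesis using tdist_eq geodesic_rev by fastforce
qed

text \<open>Trees are bipartite. This exact alternative replaces estimates by the triangle
  inequality in later case distinctions.\<close>

lemma tdist_adj:
  assumes "u \<in> V" "adj v w"
  shows "tdist u w = Suc (tdist u v) \<or> tdist u v = Suc (tdist u w)"
proof -
  obtain p where p: "geodesic u v p" using geodesic_exists assms adjD by blast
  then have "p \<noteq> []" by (auto simp: geodesic_def)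
  from geodesic_adj[OF p adj_sym[OF assms(2)]] show ?thesis
    using tdist_eq[OF p] tdist_eq[of u w] \<open>p \<noteq> []\<close> by (cases p) fastforce+
qed

lemma closer_neighbour:
  assumes "u \<in> V" "v \<in> V" "v \<noteq> u"
  shows "\<exists>!w. adj v w \<and> tdist u v = Suc (tdist u w)"
proof -
  obtain p where p: "geodesic u v p" using geodesic_exists assms by blast
  then obtain w p' where pw: "p = v # w # p'"
    using assms(3) by (cases p; cases "tl p") (auto simp: geodesic_def)
  have g: "geodesic u w (w # p')" "adj v w"
    using p unfolding pw geodesic_def by (auto simp: edge_path_Cons_Cons nonbacktracking_Cons_Cons)
  show ?thesis
  proof (rule ex1I)
    show "adj v w \<and> tdist u v = Suc (tdist u w)"
      using g tdist_eq[OF p] tdist_eq[OF g(1)] pw by simp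
  next
    fix x assume x: "adj v x \<and> tdist u v = Suc (tdist u x)"
    from geodesic_adj[OF p, of x] x consider
      (1) p'' where "p = v # x # p''" | (2) "geodesic u x (x # p)" by (auto simp: insert_commute)
    then show "x = w"
    proof cases
      case 2
      then show ?thesis using x tdist_eq[OF 2] tdist_eq[OF p] pw by simp
    qed (simp add: pw)
  qed
qed

text \<open>The branch at \<open>v\<close> that contains \<open>u\<close>. For \<open>u = v\<close>
  no neighbour qualifies and the value is arbitrary, whence the side conditions
  \<open>v \<noteq> u\<close> below.\<close>

definition step :: "'v \<Rightarrow> 'v \<Rightarrow> 'v" where
  "step v u = (THE w. adj v w \<and> tdist u v = Suc (tdist u w))"

lemma step_props:
  assumes "u \<in> V" "v \<in> V" "v \<noteq> u"
  shows "adj v (step v u)" "tdist u v = Suc (tdist u (step v u))"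
  using theI'[OF closer_neighbour[OF assms], folded step_def] by blast+

lemma step_eqI:
  assumes "u \<in> V" "adj v w" "tdist u v = Suc (tdist u w)" shows "step v u = w"
proof -
  have vu: "v \<noteq> u"
  proof
    assume "v = u"
    then show False using assms(3) tdist_self[OF assms(1)] by simp
  qed
  note v = adjD(1)[OF assms(2)]
  show ?thesis
    using ex1E[OF closer_neighbour[OF assms(1) v vu]] step_props[OF assms(1) v vu] assms(2,3)
    by (metis (no_types))
qed

lemma step_in_V: "u \<in> V \<Longrightarrow> v \<in> V \<Longrightarrow> v \<noteq> u \<Longrightarrow> step v u \<in> V"
  using step_props(1) adjD by blast

lemma step_adj: "adj v w \<Longrightarrow> step v w = w"
  using step_eqI[of w v w] adjD(2)[of v w] tdist_self[of w] tdist_adj[of w v w]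
  by (metis nat.distinct(1))

lemma tdist_triangle_adj:
  assumes "u \<in> V" "adj v w" shows "tdist u w \<le> Suc (tdist u v)" "tdist w u \<le> Suc (tdist v u)"
proof -
  show *: "tdist u w \<le> Suc (tdist u v)" using tdist_adj[OF assms] by linarith
  then show "tdist w u \<le> Suc (tdist v u)"
    using tdist_sym[OF assms(1)] adjD(1,2)[OF assms(2)] by metis
qed

text \<open>Removing \<open>v\<close> leaves a forest whose components are told apart by \<open>step v\<close>.\<close>

lemma step_branch:
  assumes v: "v \<in> V" and xy: "adj x y" "x \<noteq> v" "y \<noteq> v"
  shows "step v x = step v y"
proof -
  \<comment> \<open>By symmetry \<open>y\<close> may be taken as the end farther from
    \<open>v\<close>. The neighbour of \<open>v\<close> towards \<open>x\<close> is then closer to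
    \<open>y\<close> than \<open>v\<close> is, going through \<open>x\<close>.\<close>
  have *: "step v x = step v y" if a: "adj x y" "x \<noteq> v" "tdist v y = Suc (tdist v x)" for x y
  proof -
    note V = adjD[OF a(1)]
    let ?w = "step v x"
    have w: "adj v ?w" "tdist x v = Suc (tdist x ?w)" "?w \<in> V"
      using step_props[of x v] step_in_V[of x v] v V(1) a(2) by auto
    have "tdist y ?w \<le> Suc (tdist x ?w)" using tdist_triangle_adj(2)[OF w(3) a(1)] .
    also have "\<dots> = tdist v x" using w(2) tdist_sym[of v x] v V by simp
    finally have "tdist y ?w < tdist y v" using a(3) tdist_sym[of v y] v V by simp
    then have "tdist y v = Suc (tdist y ?w)" using tdist_adj[OF V(2) w(1)] by auto
    then show ?thesis using step_eqI[OF V(2) w(1)] by simp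
  qed
  show ?thesis
    using tdist_adj[OF v xy(1)] *[OF xy(1,2)] *[OF adj_sym[OF xy(1)] xy(3)] by metis
qed

text \<open>Until it first arrives at \<open>a\<close> the walk stays in the branch of
  \<open>b\<close> at \<open>a\<close>, so it arrives through \<open>step a b\<close>. This turns
  connectedness of a subgraph into membership of geodesics and edges.\<close>

lemma walk_enters_by_step:
  assumes "(b, a) \<in> r\<^sup>*" "a \<noteq> b" "\<And>x y. (x, y) \<in> r \<Longrightarrow> adj x y"
  shows "(step a b, a) \<in> r"
proof -
  have "x \<noteq> a \<Longrightarrow> (step a x, a) \<in> r" if "(x, a) \<in> r\<^sup>*" for x
    using that
  proof (induction rule: converse_rtrancl_induct)
    case (step x y)
    have xy: "adj x y" using assms(3) step.hyps(1) .
    show ?case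
    proof (cases "y = a")
      case True
      then show ?thesis using step.hyps(1) step_adj[OF adj_sym[OF xy]] by simp
    next
      case False
      have "a \<in> V" using step.hyps(2) False adjD assms(3) by (metis rtranclE)
      then show ?thesis using step_branch[OF _ xy] step.IH step.prems False by simp
    qed
  qed simp
  then show ?thesis using assms by blast
qed

lemma geodesic_induct [consumes 2, case_names refl step]:
  assumes "u \<in> V" "v \<in> V" and "P u"
    and "\<And>v. v \<in> V \<Longrightarrow> v \<noteq> u \<Longrightarrow> P (step v u) \<Longrightarrow> P v"
  shows "P v"
  using assms(2)
proof (induction "tdist u v" arbitrary: v rule: less_induct)
  case less
  show ?case
  proof (cases "v = u")
    case False
    then show ?thesis
      using less step_props[OF assms(1) less.prems False] step_in_V[OF assms(1) less.prems False]
        assms(4) by auto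
  qed (use assms in simp)
qed

lemma adj_rtrancl:
  assumes "u \<in> V"
  shows "v \<in> V \<Longrightarrow> (v, u) \<in> {(x, y). adj x y}\<^sup>*"
  using assms
proof (induction rule: geodesic_induct)
  case (step v)
  then show ?case
    using assms step_props(1)[of u v] by (intro converse_rtrancl_into_rtrancl[of v "step v u"]) auto
qed simp

section \<open>Convex sets, gates and subtrees\<close>

definition convex :: "'v set \<Rightarrow> bool" where
  "convex S \<longleftrightarrow> S \<subseteq> V \<and> (\<forall>u\<in>S. \<forall>v\<in>S. v \<noteq> u \<longrightarrow> step v u \<in> S)"

lemma convexD: "convex S \<Longrightarrow> u \<in> S \<Longrightarrow> v \<in> S \<Longrightarrow> v \<noteq> u \<Longrightarrow> step v u \<in> S"
  by (auto simp: convex_def)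

lemma convex_Int: "convex S \<Longrightarrow> convex S' \<Longrightarrow> convex (S \<inter> S')"
  by (auto simp: convex_def)

lemma convexI:
  assumes "S \<subseteq> V" "\<And>u v. u \<in> S \<Longrightarrow> v \<in> S \<Longrightarrow> (u, v) \<in> r\<^sup>*"
    and "\<And>x y. (x, y) \<in> r \<Longrightarrow> adj x y \<and> x \<in> S"
  shows "convex S"
  unfolding convex_def
proof (intro conjI ballI impI)
  fix u v assume "u \<in> S" "v \<in> S" "v \<noteq> u"
  then have "(step v u, v) \<in> r"
    using assms(3) by (intro walk_enters_by_step[OF assms(2)]) auto
  then show "step v u \<in> S" using assms(3) by blast
qed (rule assms(1))

lemma convex_connected:
  assumes "convex S" "u \<in> S" "v \<in> S"
  shows "(v, u) \<in> {(x, y). adj x y \<and> x \<in> S \<and> y \<in> S}\<^sup>*"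
proof -
  have S: "S \<subseteq> V" using assms by (simp add: convex_def)
  have "v \<in> S \<longrightarrow> (v, u) \<in> {(x, y). adj x y \<and> x \<in> S \<and> y \<in> S}\<^sup>*"
    using subsetD[OF S assms(2)] subsetD[OF S assms(3)]
  proof (induction rule: geodesic_induct)
    case (step v)
    show ?case
    proof
      assume v: "v \<in> S"
      then have s: "step v u \<in> S" using convexD[OF assms(1,2)] step by blast
      then have "(v, step v u) \<in> {(x, y). adj x y \<and> x \<in> S \<and> y \<in> S}"
        using v step_props(1)[of u v] step S assms(2) by auto
      then show "(v, u) \<in> {(x, y). adj x y \<and> x \<in> S \<and> y \<in> S}\<^sup>*"
        using step.IH s by (meson converse_rtrancl_into_rtrancl)
    qed
  qed simp
  then show ?thesis using assms(3) by blast
qed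

text \<open>\<open>S\<close> is connected and avoids \<open>u\<close>, so it lies in a single branch
  at \<open>u\<close>.\<close>

lemma step_const_on_convex:
  assumes "convex S" "u \<in> V" "u \<notin> S" "w \<in> S" "w' \<in> S"
  shows "step u w = step u w'"
  using convex_connected[OF assms(1,5,4)]
proof (induction rule: converse_rtrancl_induct)
  case (step y z)
  then have "adj y z" "y \<noteq> u" "z \<noteq> u" using assms by auto
  then show ?case using step_branch[OF assms(2), of y z] step.IH by simp
qed simp

text \<open>The geodesic from \<open>u'\<close> to \<open>w\<close> runs through \<open>u\<close>,
  which separates the two. The disjunction proved below is stable when \<open>w\<close> moves along
  an edge, as no direction changes unless \<open>u\<close> or \<open>u'\<close> is hit.\<close>

lemma step_through:
  assumes V: "u \<in> V" "u' \<in> V" "w \<in> V" and "u' \<noteq> u" "w \<noteq> u" "step u w \<noteq> step u u'"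
  shows "step u' w = step u' u"
proof -
  have "w = u \<or> step u w = step u u' \<or> step u' w = step u' u"
    using V(1,3)
  proof (induction rule: geodesic_induct)
    case (step w)
    let ?x = "step w u"
    have x: "adj w ?x" "?x \<in> V" using step_props(1)[of u w] step_in_V[of u w] V step by auto
    show ?case
    proof (cases "w = u'")
      case False
      show ?thesis
      proof (cases "?x = u")
        case True
        then show ?thesis using step_branch[OF V(2) x(1)] False assms by auto
      next
        case xu: False
        have "step u w = step u ?x" using step_branch[OF V(1) x(1)] xu step by auto
        moreover have "step u' w = step u' ?x" if "?x \<noteq> u'"
          using step_branch[OF V(2) x(1)] that False by auto
        ultimately show ?thesis using step.IH xu by metis
      qed
    qed simp
  qed simp
  then show ?thesis using assms by simp
qed

text \<open>A point of \<open>S\<close> whose first step towards \<open>w\<close> leaves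
  \<open>S\<close> is the projection of \<open>w\<close>. From one such point \<open>u\<close> the
  other is seen inside \<open>S\<close>, hence in another branch than \<open>w\<close>; so
  \<open>u'\<close> sees \<open>w\<close> through \<open>u\<close>, with a first step inside
  \<open>S\<close>.\<close>

lemma gate_unique:
  assumes "convex S" "u \<in> S" "u' \<in> S" "w \<in> V" "w \<notin> S" "step u w \<notin> S" "step u' w \<notin> S"
  shows "u = u'"
proof (rule ccontr)
  assume ne: "u \<noteq> u'"
  have S: "u \<in> V" "u' \<in> V" using assms by (auto simp: convex_def)
  have "step u u' \<in> S" "step u' u \<in> S" using convexD assms ne by auto
  then show False using step_through[of u u' w] S assms ne by metis
qed

text \<open>Take a point of \<open>S\<close> nearest to \<open>w\<close>; a first step inside
  \<open>S\<close> would be nearer.\<close>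

lemma gate_exists:
  assumes "S \<subseteq> V" "S \<noteq> {}" "w \<in> V" "w \<notin> S"
  shows "\<exists>u\<in>S. step u w \<notin> S"
proof -
  obtain u where u: "u \<in> S" "\<forall>x. x \<in> S \<longrightarrow> tdist w u \<le> tdist w x"
    using ex_has_least_nat[of "\<lambda>x. x \<in> S" _ "tdist w"] assms(2) by blast
  have "u \<noteq> w" "u \<in> V" using u assms by blast+
  from step_props(2)[OF assms(3) this(2,1)] have "step u w \<notin> S" using u(2) by (metis Suc_n_not_le_n)
  with u(1) show ?thesis by blast
qed

text \<open>Both parts rest on \<open>walk_enters_by_step\<close>, applied to walks with edges in
  \<open>E'\<close>. Together with \<open>convex_subtree\<close> this identifies subtrees with
  nonempty convex sets, their edges being induced.\<close>

lemma subtree_convex: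
  assumes "V' \<subseteq> V" "E' \<subseteq> E" "simplicial_tree V' E'"
  shows "convex V'" "E' = {e \<in> E. e \<subseteq> V'}"
proof -
  interpret s: stree V' E' by unfold_locales (rule assms(3))
  have conn: "(v, u) \<in> {(x, y). {x, y} \<in> E'}\<^sup>*" if "u \<in> V'" "v \<in> V'" for u v
    using s.adj_rtrancl that by blast
  have r: "adj x y \<and> x \<in> V'" if "(x, y) \<in> {(x, y). {x, y} \<in> E'}" for x y
    using that assms(2) s.adjD(1)[of x y] by blast
  show "convex V'" by (rule convexI[OF assms(1) conn r]) auto
  show "E' = {e \<in> E. e \<subseteq> V'}"
  proof (intro equalityI subsetI)
    fix e assume e: "e \<in> E'"
    then obtain u v where "e = {u, v}" "{u, v} \<in> E'" by (rule s.edgeE)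
    then show "e \<in> {e \<in> E. e \<subseteq> V'}" using e s.adjD(1,2)[of u v] assms(2) by blast
  next
    fix e assume *: "e \<in> {e \<in> E. e \<subseteq> V'}"
    then obtain u v where e: "e = {u, v}" "adj u v" using edgeE by blast
    then have "u \<in> V'" "v \<in> V'" using * by blast+
    then have "(step u v, u) \<in> {(x, y). {x, y} \<in> E'}"
      using walk_enters_by_step[OF conn[of u v] adjD(3)[OF e(2)]] r by blast
    then show "e \<in> E'" using step_adj[OF e(2)] e(1) by (simp add: insert_commute)
  qed
qed

lemma convex_subtree:
  assumes "convex S" "S \<noteq> {}"
  shows "simplicial_tree S {e \<in> E. e \<subseteq> S}"
  unfolding simplicial_tree_def
proof (intro conjI ballI)
  show "simplicial_graph S {e \<in> E. e \<subseteq> S}"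
    unfolding simplicial_graph_def
  proof
    fix e assume e: "e \<in> {e \<in> E. e \<subseteq> S}"
    then obtain u v where uv: "e = {u, v}" "adj u v" using edgeE by blast
    then have "u \<in> S" "v \<in> S" using e by blast+
    then show "\<exists>u\<in>S. \<exists>v\<in>S. u \<noteq> v \<and> e = {u, v}" using uv adjD(3)[OF uv(2)] by blast
  qed
  show "\<not> (\<exists>p. 3 \<le> length p \<and> distinct p \<and> edge_path {e \<in> E. e \<subseteq> S} p \<and>
            {last p, hd p} \<in> {e \<in> E. e \<subseteq> S})"
  proof
    assume "\<exists>p. 3 \<le> length p \<and> distinct p \<and> edge_path {e \<in> E. e \<subseteq> S} p \<and>
            {last p, hd p} \<in> {e \<in> E. e \<subseteq> S}"
    then obtain p where p: "3 \<le> length p" "distinct p" "{last p, hd p} \<in> E"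
      and "edge_path {e \<in> E. e \<subseteq> S} p"
      by blast
    from this(4) have "edge_path E p"
      unfolding edge_path_def by (rule successively_mono) auto
    with p show False using tree unfolding simplicial_tree_def by blast
  qed
  fix u v assume uv: "u \<in> S" "v \<in> S"
  have "(u, v) \<in> {(x, y). adj x y \<and> x \<in> S \<and> y \<in> S}\<^sup>*" using convex_connected assms uv by blast
  then show "\<exists>p. p \<noteq> [] \<and> hd p = u \<and> last p = v \<and> edge_path {e \<in> E. e \<subseteq> S} p"
  proof (induction rule: converse_rtrancl_induct)
    case base
    show ?case by (rule exI[of _ "[v]"]) (simp add: edge_path_def)
  next
    case (step y z)
    then obtain p where "p \<noteq> []" "hd p = z" "last p = v" "edge_path {e \<in> E. e \<subseteq> S} p" by blast
    then show ?case using step.hyps(1)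
      by (intro exI[of _ "y # p"]) (auto simp: edge_path_def successively_Cons)
  qed
qed (rule assms(2))

text \<open>Injectivity keeps the images of reduced paths reduced, so such a map preserves
  geodesics, distances and \<open>step\<close>.\<close>

definition tree_aut :: "('v \<Rightarrow> 'v) \<Rightarrow> bool" where
  "tree_aut f \<longleftrightarrow> f ` V \<subseteq> V \<and> inj_on f V \<and> (\<forall>u v. adj u v \<longrightarrow> adj (f u) (f v))"

lemma geodesic_map:
  assumes f: "tree_aut f" and p: "geodesic u v p"
  shows "geodesic (f u) (f v) (map f p)"
  using p
proof (induction p arbitrary: v)
  case (Cons x p)
  show ?case
  proof (cases p)
    case Nil
    then show ?thesis using Cons.prems by (auto simp: geodesic_def edge_path_def)
  next
    case (Cons y p')
    have g: "geodesic u y (y # p')" and xy: "adj x y" and xv: "x = v"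
      using Cons.prems unfolding Cons geodesic_def
      by (auto simp: edge_path_Cons_Cons nonbacktracking_Cons_Cons)
    have IH: "geodesic (f u) (f y) (map f (y # p'))"
      using Cons.IH[of y] g Cons by simp
    have "p' = [] \<or> hd (map f p') \<noteq> f x"
    proof (cases p')
      case (Cons z p'')
      then have "z \<noteq> x" "z \<in> V" "x \<in> V" using Cons.prems g xy adjD
        unfolding \<open>p = y # p'\<close> geodesic_def
        by (auto simp: edge_path_Cons_Cons nonbacktracking_Cons_Cons)
      then show ?thesis using f Cons by (auto simp: tree_aut_def inj_on_def)
    qed simp
    then show ?thesis using IH xy f xv Cons.prems unfolding Cons geodesic_def tree_aut_def
      by (auto simp: edge_path_Cons_Cons nonbacktracking_Cons_Cons)
  qed
qed (simp add: geodesic_def)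

lemma tdist_map:
  assumes "tree_aut f" "u \<in> V" "v \<in> V" shows "tdist (f u) (f v) = tdist u v"
proof -
  obtain p where "geodesic u v p" using geodesic_exists assms by blast
  then show ?thesis using geodesic_map[OF assms(1)] tdist_eq by fastforce
qed

lemma step_map:
  assumes f: "tree_aut f" and V: "u \<in> V" "v \<in> V" "v \<noteq> u"
  shows "step (f v) (f u) = f (step v u)"
proof (rule step_eqI)
  show "f u \<in> V" "adj (f v) (f (step v u))"
    using f V step_props(1)[OF V] by (auto simp: tree_aut_def)
  show "tdist (f u) (f v) = Suc (tdist (f u) (f (step v u)))"
    using tdist_map[OF f] V step_props(2)[OF V] step_in_V[OF V] by simp
qed

end


section \<open>Groups acting on trees\<close>

locale tree_action = stree V E + group G
  for V :: "'v set" and E and G (structure) +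
  fixes act :: "'g \<Rightarrow> 'v \<Rightarrow> 'v"
  assumes act_closed: "g \<in> carrier G \<Longrightarrow> v \<in> V \<Longrightarrow> act g v \<in> V"
    and act_mult: "g \<in> carrier G \<Longrightarrow> h \<in> carrier G \<Longrightarrow> v \<in> V \<Longrightarrow> act (g \<otimes> h) v = act g (act h v)"
    and act_one: "v \<in> V \<Longrightarrow> act \<one> v = v"
    and act_adj: "g \<in> carrier G \<Longrightarrow> adj u v \<Longrightarrow> adj (act g u) (act g v)"
begin

lemma act_inv:
  assumes "g \<in> carrier G" "v \<in> V"
  shows "act (inv g) (act g v) = v" "act g (act (inv g) v) = v"
  using assms act_mult[of "inv g" g v] act_mult[of g "inv g" v] act_one by auto

lemma act_inj: "g \<in> carrier G \<Longrightarrow> u \<in> V \<Longrightarrow> v \<in> V \<Longrightarrow> act g u = act g v \<longleftrightarrow> u = v"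
  using act_inv(1) by metis

lemma act_tree_aut: "g \<in> carrier G \<Longrightarrow> tree_aut (act g)"
  unfolding tree_aut_def using act_closed act_adj act_inj by (auto simp: inj_on_def)

lemma act_step:
  "g \<in> carrier G \<Longrightarrow> u \<in> V \<Longrightarrow> v \<in> V \<Longrightarrow> v \<noteq> u \<Longrightarrow> step (act g v) (act g u) = act g (step v u)"
  using step_map act_tree_aut by blast

definition inv_subtree :: "'g set \<Rightarrow> 'v set \<Rightarrow> bool" where
  "inv_subtree H S \<longleftrightarrow> S \<noteq> {} \<and> convex S \<and> (\<forall>h\<in>H. \<forall>v\<in>S. act h v \<in> S)"

text \<open>Only vertices count, although actions may invert edges. A group that fixes just the
  midpoint of an edge still has a least invariant subtree, namely that edge.\<close>

definition fixes_vertex :: "'g set \<Rightarrow> bool" where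
  "fixes_vertex H \<longleftrightarrow> (\<exists>v\<in>V. \<forall>h\<in>H. act h v = v)"

lemma convex_image:
  assumes "g \<in> carrier G" "convex S" shows "convex (act g ` S)"
  unfolding convex_def
proof (intro conjI ballI impI)
  have S: "S \<subseteq> V" using assms by (simp add: convex_def)
  then show "act g ` S \<subseteq> V" using act_closed assms(1) by blast
  fix u v assume "u \<in> act g ` S" "v \<in> act g ` S" "v \<noteq> u"
  then obtain a b where ab: "u = act g a" "v = act g b" "a \<in> S" "b \<in> S" "b \<noteq> a" by blast
  then have "step v u = act g (step b a)" using act_step assms(1) S by blast
  then show "step v u \<in> act g ` S" using convexD[OF assms(2) ab(3-5)] by blast
qed

lemma inv_subtree_image:
  assumes g: "g \<in> carrier G" and H: "H \<subseteq> carrier G"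
    and norm: "\<And>h. h \<in> H \<Longrightarrow> inv g \<otimes> h \<otimes> g \<in> H" and S: "inv_subtree H S"
  shows "inv_subtree H (act g ` S)"
  unfolding inv_subtree_def
proof (intro conjI ballI)
  show "act g ` S \<noteq> {}" "convex (act g ` S)" using S convex_image[OF g] by (auto simp: inv_subtree_def)
  fix h v assume h: "h \<in> H" and "v \<in> act g ` S"
  then obtain a where a: "v = act g a" "a \<in> S" by blast
  have aV: "a \<in> V" using a S by (auto simp: inv_subtree_def convex_def)
  have hc: "h \<in> carrier G" using h H by blast
  have "act h v = act g (act (inv g \<otimes> h \<otimes> g) a)"
    using g hc aV a(1) by (simp add: act_mult act_inv act_closed)
  then show "act h v \<in> act g ` S" using norm[OF h] S a(2) by (auto simp: inv_subtree_def)
qed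

text \<open>Let \<open>u\<close> in \<open>S\<close> be the projection of some \<open>w\<close> in
  \<open>S'\<close>. For \<open>h\<close> in \<open>H\<close> the point \<open>act h u\<close> is
  the projection of \<open>act h w\<close>, and also of \<open>w\<close>, because \<open>S'\<close>
  lies in one branch at \<open>act h u\<close>. Projections are unique, so
  \<open>act h u = u\<close>.\<close>

lemma disjoint_inv_subtrees:
  assumes H: "subgroup H G" and S: "inv_subtree H S" "inv_subtree H S'" and disj: "S \<inter> S' = {}"
  shows "fixes_vertex H"
proof -
  have SV: "S \<subseteq> V" "S' \<subseteq> V" "convex S" "convex S'" using S by (auto simp: inv_subtree_def convex_def)
  obtain w where w: "w \<in> S'" using S by (auto simp: inv_subtree_def)
  have wS: "w \<in> V" "w \<notin> S" using w SV disj by auto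
  obtain u where u: "u \<in> S" "step u w \<notin> S"
    using gate_exists[OF SV(1) _ wS] S by (auto simp: inv_subtree_def)
  have uV: "u \<in> V" "u \<noteq> w" using u SV wS by auto
  have "act h u = u" if h: "h \<in> H" for h
  proof -
    have hc: "h \<in> carrier G" "inv h \<in> H" using h H subgroup.mem_carrier subgroup.m_inv_closed by metis+
    have hu: "act h u \<in> S" "act h w \<in> S'" "act h u \<in> V"
      using S h u w uV act_closed hc by (auto simp: inv_subtree_def)
    have "step (act h u) w = step (act h u) (act h w)"
      using step_const_on_convex[OF SV(4) hu(3) _ w hu(2)] hu(1) disj by blast
    also have "\<dots> = act h (step u w)" using act_step hc uV wS by blast
    finally have *: "step (act h u) w = act h (step u w)" .
    have "step (act h u) w \<notin> S"
    proof
      assume "step (act h u) w \<in> S"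
      then have "act (inv h) (act h (step u w)) \<in> S"
        using S hc(2) unfolding * by (auto simp: inv_subtree_def)
      then show False using u(2) act_inv(1)[OF hc(1)] step_in_V[of w u] uV wS by simp
    qed
    then show ?thesis using gate_unique[OF SV(3) hu(1) u(1) wS] u(2) by blast
  qed
  then show ?thesis using uV by (auto simp: fixes_vertex_def)
qed

lemma inv_subtree_Int:
  assumes "subgroup H G" "inv_subtree H S" "inv_subtree H S'" "\<not> fixes_vertex H"
  shows "inv_subtree H (S \<inter> S')"
  using disjoint_inv_subtrees[OF assms(1-3)] assms(2-4) convex_Int unfolding inv_subtree_def by blast

text \<open>The translates of a finite subtree joining a vertex to its images under the generators
  form an invariant subtree.\<close>

lemma cocompact_inv_subtree:
  assumes H: "H = generate G S" and S: "finite S" "S \<subseteq> carrier G"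
  shows "\<exists>K. finite K \<and> K \<subseteq> V \<and> inv_subtree H (\<Union>h\<in>H. act h ` K) \<and>
    (\<forall>a\<in>\<Union>h\<in>H. act h ` K. \<forall>b. adj a b \<and> b \<in> (\<Union>h\<in>H. act h ` K) \<longrightarrow>
       (\<exists>h\<in>H. \<exists>k\<in>K. \<exists>l\<in>K. a = act h k \<and> b = act h l))"
proof -
  have sub: "subgroup H G" using generate_is_subgroup[OF S(2)] H by simp
  interpret H: subgroup H G by (rule sub)
  obtain v where v: "v \<in> V" using V_nonempty by blast
  have "\<exists>p. geodesic v (act s v) p" if "s \<in> S" for s
    using geodesic_exists v act_closed S that by blast
  then obtain p where p: "\<And>s. s \<in> S \<Longrightarrow> geodesic v (act s v) (p s)" by metis
  define K where "K = insert v (\<Union>s\<in>S. set (p s))"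
  have pV: "set q \<subseteq> V" if "geodesic a b q" "a \<in> V" for a b q
  proof -
    have "set q \<subseteq> V" if "edge_path E q" "q \<noteq> []" "last q \<in> V" for q
      using that
    proof (induction q)
      case (Cons x q)
      then show ?case using adjD(1)
        by (cases q) (auto simp: edge_path_Cons_Cons edge_path_def)
    qed simp
    then show ?thesis using that by (auto simp: geodesic_def)
  qed
  have K: "finite K" "K \<subseteq> V" using S pV[OF p v] v by (auto simp: K_def)
  \<comment> \<open>Only translates of edges within \<open>K\<close> count as steps, so that
    connectedness by \<open>r\<close> will also show every edge of the union to be such a
    translate.\<close>
  define r where "r = {(a, b). \<exists>h\<in>H. \<exists>k\<in>K. \<exists>l\<in>K. adj k l \<and> a = act h k \<and> b = act h l}"
  let ?Y = "\<Union>h\<in>H. act h ` K"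
  have r_adj: "adj a b \<and> a \<in> ?Y" if "(a, b) \<in> r" for a b
    using that act_adj H.mem_carrier unfolding r_def by blast
  have r_sym: "(b, a) \<in> r" if "(a, b) \<in> r" for a b
    using that adj_sym unfolding r_def by blast
  have r_act: "(act h a, act h b) \<in> r" if "(a, b) \<in> r" "h \<in> H" for a b h
  proof -
    from that(1) obtain g k l where *: "g \<in> H" "k \<in> K" "l \<in> K" "adj k l" "a = act g k" "b = act g l"
      unfolding r_def by blast
    then have "act h a = act (h \<otimes> g) k" "act h b = act (h \<otimes> g) l" "h \<otimes> g \<in> H"
      using that(2) K(2) by (auto simp: act_mult)
    then show ?thesis using * unfolding r_def by blast
  qed
  have rs_act: "(act h a, act h b) \<in> r\<^sup>*" if "(a, b) \<in> r\<^sup>*" "h \<in> H" for a b h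
    using that(1) by (induction) (auto intro: rtrancl_into_rtrancl r_act[OF _ that(2)])
  have rs_sym: "(b, a) \<in> r\<^sup>*" if "(a, b) \<in> r\<^sup>*" for a b
    using that by (induction) (auto intro: converse_rtrancl_into_rtrancl r_sym)
  have path: "(x, v) \<in> r\<^sup>*" if "edge_path E q" "set q \<subseteq> K" "x \<in> set q" "last q = v" for q x
    using that
  proof (induction q arbitrary: x)
    case (Cons y q)
    show ?case
    proof (cases q)
      case Nil
      then show ?thesis using Cons.prems by simp
    next
      case (Cons z q')
      have z: "(z, v) \<in> r\<^sup>*" using Cons.IH[of z] Cons.prems Cons by (simp add: edge_path_Cons_Cons)
      have "adj y z" "y \<in> K" "z \<in> K" using Cons.prems Cons by (auto simp: edge_path_Cons_Cons)
      moreover from this have "y = act \<one> y" "z = act \<one> z" using act_one K(2) by auto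
      ultimately have "(y, z) \<in> r" using H.one_closed unfolding r_def by blast
      then have "(y, v) \<in> r\<^sup>*" using z by (meson converse_rtrancl_into_rtrancl)
      moreover have "x \<in> set q \<Longrightarrow> (x, v) \<in> r\<^sup>*"
        using Cons.IH[of x] Cons.prems Cons by (simp add: edge_path_Cons_Cons)
      ultimately show ?thesis using Cons.prems(3) by auto
    qed
  qed simp
  have Kv: "(k, v) \<in> r\<^sup>*" if k: "k \<in> K" for k
  proof (cases "k = v")
    case False
    then obtain s where s: "s \<in> S" "k \<in> set (p s)" using k by (auto simp: K_def)
    then show ?thesis using path[of "p s" k] p[OF s(1)] by (auto simp: K_def geodesic_def)
  qed simp
  have sv: "act s v \<in> K" if "s \<in> S" for s
    using p[OF that] that unfolding K_def geodesic_def by (metis UN_I hd_in_set insertI2)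
  \<comment> \<open>If \<open>v\<close> is joined to its images under \<open>h1\<close> and
    \<open>h2\<close>, translating the second walk by \<open>h1\<close> extends the first one to the
    image under \<open>h1 \<otimes> h2\<close>.\<close>
  have vh: "(v, act h v) \<in> r\<^sup>*" if "h \<in> generate G S" for h
    using that
  proof (induction)
    case one
    then show ?case using act_one v by simp
  next
    case (incl h)
    then show ?case using rs_sym Kv sv by blast
  next
    case (inv h)
    then have "h \<in> H" "h \<in> carrier G" unfolding H using S(2) by (auto intro: generate.incl)
    then have "(act (inv h) v, act (inv h) (act h v)) \<in> r\<^sup>*"
      by (intro rs_act[OF rs_sym[OF Kv[OF sv[OF inv]]]] H.m_inv_closed)
    then show ?case using rs_sym act_inv(1)[OF \<open>h \<in> carrier G\<close> v] by metis
  next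
    case (eng h1 h2)
    then have *: "h1 \<in> H" "h2 \<in> H" by (simp_all add: H)
    have "(act h1 v, act (h1 \<otimes> h2) v) \<in> r\<^sup>*" using rs_act[OF eng.IH(2) *(1)] v * by (simp add: act_mult)
    then show ?case using eng.IH(1) by (meson rtrancl_trans)
  qed
  have Yv: "(v, y) \<in> r\<^sup>*" if "y \<in> ?Y" for y
  proof -
    obtain h k where "h \<in> H" "k \<in> K" "y = act h k" using \<open>y \<in> ?Y\<close> by blast
    then have "(act h v, y) \<in> r\<^sup>*" using rs_act rs_sym Kv by blast
    then show ?thesis using vh[of h] H \<open>h \<in> H\<close> by (meson rtrancl_trans)
  qed
  have conn: "(x, y) \<in> r\<^sup>*" if "x \<in> ?Y" "y \<in> ?Y" for x y
    using Yv[OF that(2)] rs_sym[OF Yv[OF that(1)]] by (meson rtrancl_trans)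
  have YV: "?Y \<subseteq> V" using K(2) act_closed H.mem_carrier by blast
  have "convex ?Y" by (rule convexI[OF YV conn r_adj])
  moreover have Yact: "act h y \<in> ?Y" if h: "h \<in> H" and y: "y \<in> ?Y" for h y
  proof -
    obtain g k where "g \<in> H" "k \<in> K" "y = act g k" using y by blast
    then have "act h y = act (h \<otimes> g) k" "h \<otimes> g \<in> H" using h K(2) by (auto simp: act_mult)
    then show ?thesis using \<open>k \<in> K\<close> by blast
  qed
  moreover have "?Y \<noteq> {}" using H.one_closed unfolding K_def by blast
  ultimately have Y: "inv_subtree H ?Y" unfolding inv_subtree_def by (intro conjI ballI Yact)
  have edges: "\<exists>h\<in>H. \<exists>k\<in>K. \<exists>l\<in>K. a = act h k \<and> b = act h l"
    if ab: "a \<in> ?Y" "adj a b" "b \<in> ?Y" for a b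
  proof -
    \<comment> \<open>A walk in \<open>r\<close> from \<open>b\<close> to its neighbour
      \<open>a\<close> enters \<open>a\<close> from \<open>b\<close>, so this very edge belongs to
      \<open>r\<close>.\<close>
    have "(step a b, a) \<in> r"
      by (rule walk_enters_by_step[OF conn[OF ab(3,1)] adjD(3)[OF ab(2)] conjunct1[OF r_adj]])
    then have "(b, a) \<in> r" using step_adj[OF ab(2)] by simp
    then show ?thesis unfolding r_def by blast
  qed
  show ?thesis
    by (intro exI[of _ K] conjI K Y ballI allI impI edges) auto
qed

text \<open>Minimising the number of \<open>H\<close>-orbits singles out an invariant subtree that is contained
  in every other one, since invariant subtrees intersect.\<close>

lemma least_inv_subtree:
  assumes H: "H = generate G S" "finite S" "S \<subseteq> carrier G" and nofix: "\<not> fixes_vertex H"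
  obtains M R where "inv_subtree H M" "\<And>S'. inv_subtree H S' \<Longrightarrow> M \<subseteq> S'" "finite R"
    "\<And>a. a \<in> M \<Longrightarrow> \<exists>h\<in>H. \<exists>k\<in>R. a = act h k"
    "\<And>a b. a \<in> M \<Longrightarrow> b \<in> M \<Longrightarrow> adj a b \<Longrightarrow> \<exists>h\<in>H. \<exists>k\<in>R. \<exists>l\<in>R. a = act h k \<and> b = act h l"
    "R \<subseteq> V"
proof -
  have sub: "subgroup H G" using generate_is_subgroup[OF H(3)] H(1) by simp
  interpret H: subgroup H G by (rule sub)
  obtain K where K: "finite K" "K \<subseteq> V" "inv_subtree H (\<Union>h\<in>H. act h ` K)"
    "\<And>a b. a \<in> (\<Union>h\<in>H. act h ` K) \<Longrightarrow> adj a b \<Longrightarrow> b \<in> (\<Union>h\<in>H. act h ` K) \<Longrightarrow>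
       \<exists>h\<in>H. \<exists>k\<in>K. \<exists>l\<in>K. a = act h k \<and> b = act h l"
    using cocompact_inv_subtree[OF H] by metis
  let ?Y = "\<Union>h\<in>H. act h ` K"
  let ?P = "\<lambda>M. inv_subtree H M \<and> M \<subseteq> ?Y"
  \<comment> \<open>An \<open>H\<close>-invariant subset of \<open>?Y\<close> is determined by its
    trace on \<open>K\<close>, so the size of this finite trace can serve as the quantity to
    minimise.\<close>
  obtain M where M: "inv_subtree H M" "M \<subseteq> ?Y"
    and min: "\<And>M'. inv_subtree H M' \<Longrightarrow> M' \<subseteq> ?Y \<Longrightarrow> card (M \<inter> K) \<le> card (M' \<inter> K)"
    using ex_has_least_nat[of ?P ?Y "\<lambda>M. card (M \<inter> K)"] K(3) by auto
  have unmove: "k \<in> M" if "h \<in> H" "k \<in> K" "act h k \<in> M" for h k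
  proof -
    have "act (inv h) (act h k) \<in> M" using that M(1) by (auto simp: inv_subtree_def)
    then show ?thesis using act_inv(1)[of h k] that K(2) by auto
  qed
  have least: "M \<subseteq> S'" if S': "inv_subtree H S'" for S'
  proof
    fix a assume a: "a \<in> M"
    have I: "inv_subtree H (M \<inter> S')" by (rule inv_subtree_Int[OF sub M(1) S' nofix])
    have "card (M \<inter> K) \<le> card (M \<inter> S' \<inter> K)" using min[OF I] M(2) by blast
    then have "M \<inter> S' \<inter> K = M \<inter> K" using K(1) by (intro card_seteq) auto
    moreover obtain h k where hk: "h \<in> H" "k \<in> K" "a = act h k" using a M(2) by blast
    ultimately have "k \<in> S'" using unmove[of h k] a by blast
    then show "a \<in> S'" using S' hk by (auto simp: inv_subtree_def)
  qed
  have orbits: "\<exists>h\<in>H. \<exists>k\<in>K. a = act h k" if "a \<in> M" for a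
    using subsetD[OF M(2) that] by blast
  have edges: "\<exists>h\<in>H. \<exists>k\<in>K. \<exists>l\<in>K. a = act h k \<and> b = act h l"
    if "a \<in> M" "b \<in> M" "adj a b" for a b
    using K(4) subsetD[OF M(2)] that by metis
  show ?thesis by (rule that[OF M(1) least K(1) orbits edges K(2)])
qed

end


section \<open>Additive functions, cyclic and slender subgroups\<close>

definition additive_on :: "('a, 'b) monoid_scheme \<Rightarrow> 'a set \<Rightarrow> ('a \<Rightarrow> int) \<Rightarrow> bool" where
  "additive_on G H c \<longleftrightarrow> (\<forall>h\<in>H. \<forall>k\<in>H. c (h \<otimes>\<^bsub>G\<^esub> k) = c h + c k)"

context group
begin

section \<open>Homomorphisms to the integers\<close>

lemma additive_on_props:
  assumes H: "subgroup H G" and c: "additive_on G H c"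
  shows "c \<one> = 0" and "h \<in> H \<Longrightarrow> c (inv h) = - c h"
    and "h \<in> H \<Longrightarrow> c (h [^] (n::nat)) = int n * c h"
    and "h \<in> H \<Longrightarrow> c (h [^] (i::int)) = i * c h"
proof -
  interpret H: subgroup H G by (rule H)
  have add: "c (h \<otimes> k) = c h + c k" if "h \<in> H" "k \<in> H" for h k
    using c that by (auto simp: additive_on_def)
  show 1: "c \<one> = 0" using add[OF H.one_closed H.one_closed] by simp
  have I: "c (inv h) = - c h" if "h \<in> H" for h
  proof -
    have "c (h \<otimes> inv h) = c h + c (inv h)" using that by (intro add) auto
    then show ?thesis using 1 that by simp
  qed
  then show "h \<in> H \<Longrightarrow> c (inv h) = - c h" .
  have N: "h [^] n \<in> H \<and> c (h [^] n) = int n * c h" if "h \<in> H" for h and n :: nat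
    by (induction n) (use that 1 add in \<open>auto simp: algebra_simps\<close>)
  then show "h \<in> H \<Longrightarrow> c (h [^] n) = int n * c h" by blast
  show "c (h [^] i) = i * c h" if h: "h \<in> H"
  proof (cases i rule: int_cases2)
    case (nonneg n)
    then show ?thesis using N[OF h, of n] by (simp add: int_pow_int)
  next
    case (nonpos n)
    then have "h [^] i = inv (h [^] n)" using h by (simp add: int_pow_neg int_pow_int)
    then show ?thesis using N[OF h, of n] I nonpos by simp
  qed
qed

text \<open>The image of \<open>c\<close> is a subgroup of the integers and \<open>y\<close> lifts a
  generator of it: an element of least positive value, or the identity if \<open>c\<close> vanishes.
  Modulo the kernel of \<open>c\<close> every element is thus a power of \<open>y\<close>.\<close>

lemma additive_generator:
  assumes H: "subgroup H G" and c: "additive_on G H c"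
  shows "\<exists>y\<in>H. \<forall>h\<in>H. \<exists>q::int. c (h \<otimes> inv (y [^] q)) = 0"
proof -
  interpret H: subgroup H G by (rule H)
  have add: "c (h \<otimes> k) = c h + c k" if "h \<in> H" "k \<in> H" for h k
    using c that by (auto simp: additive_on_def)
  note props = additive_on_props[OF H c]
  note pow = subgroup_int_pow_closed[OF H]
  show ?thesis
  proof (cases "\<exists>h\<in>H. c h > 0")
    case True
    then obtain y where y: "y \<in> H" "c y > 0"
      and min: "\<And>h. h \<in> H \<Longrightarrow> c h > 0 \<Longrightarrow> c y \<le> c h"
      using ex_has_least_nat[of "\<lambda>h. h \<in> H \<and> c h > 0" _ "\<lambda>h. nat (c h)"] by fastforce
    have "c (h \<otimes> inv (y [^] (c h div c y))) = 0" if h: "h \<in> H" for h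
    proof -
      let ?k = "h \<otimes> inv (y [^] (c h div c y))"
      have k: "?k \<in> H" using h pow[OF y(1)] by auto
      have "c ?k = c h - (c h div c y) * c y"
        using add[of h] h pow[OF y(1)] props(2,4) y(1) by simp
      then have "c ?k = c h mod c y" by (simp add: minus_div_mult_eq_mod)
      then show ?thesis using min[OF k] y(2) pos_mod_bound[of "c y" "c h"] pos_mod_sign[of "c y" "c h"]
        by linarith
    qed
    then show ?thesis using y(1) by blast
  next
    case False
    have "c h = 0" if "h \<in> H" for h
      using False that props(2)[OF that] H.m_inv_closed[OF that] by (metis neg_0_less_iff_less not_less_iff_gr_or_eq)
    then have "c (h \<otimes> inv (\<one> [^] (0::int))) = 0" if "h \<in> H" for h
      using that by simp
    then show ?thesis using H.one_closed by blast
  qed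
qed

section \<open>Cyclic and slender subgroups\<close>

lemma subgroup_of_cyclic:
  assumes H: "subgroup H G" and x: "x \<in> carrier G" "H \<subseteq> generate G {x}"
  shows "\<exists>y\<in>H. H = generate G {y}"
proof -
  interpret H: subgroup H G by (rule H)
  note pow = subgroup_int_pow_closed[OF H]
  have gen: "generate G {y} = range (\<lambda>i::int. y [^] i)" if "y \<in> carrier G" for y
    using generate_pow[OF that] by auto
  have incl: "generate G {y} \<subseteq> H" if "y \<in> H" for y
    using generate_subgroup_incl[of "{y}" H] that H by simp
  show ?thesis
  proof (cases "\<exists>n::nat. n > 0 \<and> x [^] n \<in> H")
    case True
    then obtain n :: nat where n: "n > 0" "x [^] n \<in> H"
      and min: "\<And>m::nat. m > 0 \<Longrightarrow> x [^] m \<in> H \<Longrightarrow> n \<le> m"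
      using exists_least_iff[of "\<lambda>n::nat. n > 0 \<and> x [^] n \<in> H"] by (metis not_le)
    have "h \<in> generate G {x [^] n}" if h: "h \<in> H" for h
    proof -
      obtain i :: int where i: "h = x [^] i" using h x gen by blast
      let ?m = "nat (i mod int n)"
      have *: "x [^] i = (x [^] n) [^] (i div int n) \<otimes> x [^] ?m"
      proof -
        have "(x [^] n) [^] (i div int n) \<otimes> x [^] ?m = x [^] (int n * (i div int n)) \<otimes> x [^] int ?m"
          using x by (simp add: int_pow_pow flip: int_pow_int)
        also have "\<dots> = x [^] (int n * (i div int n) + i mod int n)"
          using n(1) int_pow_mult[OF x(1), of "int n * (i div int n)" "i mod int n"] by simp
        finally show ?thesis by simp
      qed
      have "x [^] ?m = inv ((x [^] n) [^] (i div int n)) \<otimes> h"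
        using x unfolding i * by (simp add: inv_solve_left)
      then have "x [^] ?m \<in> H" using h pow[OF n(2)] by simp
      moreover have "?m < n" using n(1) by (simp add: nat_less_iff)
      ultimately have "?m = 0" using min[of ?m] by (cases "?m = 0") auto
      then have "h = (x [^] n) [^] (i div int n)" using i * x by simp
      then show ?thesis using gen[of "x [^] n"] x by auto
    qed
    then show ?thesis using n(2) incl by blast
  next
    case False
    have "h = \<one>" if h: "h \<in> H" for h
    proof (rule ccontr)
      assume ne: "h \<noteq> \<one>"
      obtain i :: int where i: "h = x [^] i" using h x gen by blast
      have "i \<noteq> 0" using ne i by (cases "i = 0") auto
      then obtain n :: nat where n: "n > 0" "i = int n \<or> i = - int n"
        by (cases i rule: int_cases2) auto
      then have "h = x [^] n \<or> h = inv (x [^] n)"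
        using i x by (auto simp: int_pow_neg int_pow_int)
      then have "x [^] n = h \<or> x [^] n = inv h" using x(1) by auto
      then have "x [^] n \<in> H" using h H.m_inv_closed[OF h] by auto
      then show False using False n(1) by blast
    qed
    then have "H = {\<one>}" using H.one_closed by blast
    then show ?thesis using incl[of \<one>] generate.one by blast
  qed
qed

lemma generate_in_subgroup:
  assumes "subgroup H G" "T \<subseteq> H"
  shows "generate (G\<lparr>carrier := H\<rparr>) T = generate G T"
  using generate_consistent[OF assms(2,1)] by simp

lemma cyclic_subgroup_iff:
  assumes "subgroup H G"
  shows "cyclic_group (G\<lparr>carrier := H\<rparr>) \<longleftrightarrow> (\<exists>y\<in>H. H = generate G {y})"
proof -
  interpret H: group "G\<lparr>carrier := H\<rparr>" using subgroup.subgroup_is_group[OF assms] is_group by blast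
  have "range (\<lambda>n::int. y [^]\<^bsub>G\<lparr>carrier := H\<rparr>\<^esub> n) = generate G {y}" if y: "y \<in> H" for y
    using H.generate_pow[of y] generate_in_subgroup[OF assms, of "{y}"] y by auto
  then show ?thesis unfolding H.cyclic_group by auto
qed

lemma slender_subgroup_iff:
  assumes "subgroup H G"
  shows "slender_group (G\<lparr>carrier := H\<rparr>) \<longleftrightarrow>
    (\<forall>K. subgroup K G \<and> K \<subseteq> H \<longrightarrow> (\<exists>T. finite T \<and> T \<subseteq> K \<and> generate G T = K))"
proof -
  have H: "group (G\<lparr>carrier := H\<rparr>)" using subgroup.subgroup_is_group[OF assms] is_group by blast
  have eq: "subgroup K (G\<lparr>carrier := H\<rparr>) \<longleftrightarrow> subgroup K G \<and> K \<subseteq> H" for K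
    using group.subgroup_incl[OF is_group, of K H] group.incl_subgroup[OF is_group assms, of K]
      subgroup.subset[of K "G\<lparr>carrier := H\<rparr>"] assms by auto
  have fg: "finitely_generated_group (G\<lparr>carrier := K\<rparr>) \<longleftrightarrow>
      (\<exists>T. finite T \<and> T \<subseteq> K \<and> generate G T = K)" if K: "subgroup K G" for K
  proof -
    have "group (G\<lparr>carrier := K\<rparr>)" using subgroup.subgroup_is_group[OF K] is_group by blast
    then show ?thesis unfolding finitely_generated_group_def
      using generate_in_subgroup[OF K] by auto
  qed
  show ?thesis unfolding slender_group_def using H eq fg by auto
qed

lemma cyclic_imp_slender:
  assumes H: "subgroup H G" and "cyclic_group (G\<lparr>carrier := H\<rparr>)"
  shows "slender_group (G\<lparr>carrier := H\<rparr>)"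
proof -
  obtain x where x: "x \<in> H" "H = generate G {x}" using assms cyclic_subgroup_iff by blast
  have "\<exists>T. finite T \<and> T \<subseteq> K \<and> generate G T = K" if K: "subgroup K G" "K \<subseteq> H" for K
  proof -
    obtain y where "y \<in> K" "K = generate G {y}"
      using subgroup_of_cyclic[OF K(1), of x] K x subgroup.mem_carrier[OF H] by blast
    then show ?thesis by (intro exI[of _ "{y}"]) auto
  qed
  then show ?thesis using slender_subgroup_iff[OF H] by blast
qed

lemma subgroup_centraliser:
  assumes "x \<in> carrier G" shows "subgroup {y \<in> carrier G. x \<otimes> y = y \<otimes> x} G"
proof (rule subgroupI)
  fix a assume "a \<in> {y \<in> carrier G. x \<otimes> y = y \<otimes> x}"
  then have a: "a \<in> carrier G" "x \<otimes> a = a \<otimes> x" by auto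
  then have "inv a \<otimes> (x \<otimes> a) \<otimes> inv a = inv a \<otimes> (a \<otimes> x) \<otimes> inv a" by simp
  moreover have "inv a \<otimes> (x \<otimes> a) \<otimes> inv a = inv a \<otimes> x" using a(1) assms by (simp add: m_assoc)
  moreover have "inv a \<otimes> (a \<otimes> x) \<otimes> inv a = x \<otimes> inv a"
    using a(1) assms by (simp add: m_assoc[symmetric])
  ultimately show "inv a \<in> {y \<in> carrier G. x \<otimes> y = y \<otimes> x}" using a(1) by simp
next
  fix a b assume "a \<in> {y \<in> carrier G. x \<otimes> y = y \<otimes> x}" "b \<in> {y \<in> carrier G. x \<otimes> y = y \<otimes> x}"
  then show "a \<otimes> b \<in> {y \<in> carrier G. x \<otimes> y = y \<otimes> x}"
    using assms by (auto simp: m_assoc) (metis m_assoc)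
qed (use assms in auto)

end


section \<open>Crossing numbers in free groups\<close>

locale based_free_group = group F for F (structure) +
  fixes S
  assumes basis: "free_basis F S"
begin

abbreviation "val \<equiv> word_value F"

definition lit :: "'a \<times> bool \<Rightarrow> 'a" where
  "lit l = (if snd l then fst l else inv (fst l))"

lemma S_carrier: "S \<subseteq> carrier F"
  using basis by (simp add: free_basis_def)

lemma lit_closed: "l \<in> S \<times> UNIV \<Longrightarrow> lit l \<in> carrier F"
  using S_carrier by (auto simp: lit_def)

lemma val_Nil: "val [] = \<one>"
  by (simp add: word_value_def)

lemma val_Cons: "val (l # w) = lit l \<otimes> val w"
  by (simp add: word_value_def lit_def split: prod.splits)

lemma val_closed: "set w \<subseteq> S \<times> UNIV \<Longrightarrow> val w \<in> carrier F"
  by (induction w) (auto simp del: mem_Sigma_iff simp: val_Nil val_Cons intro!: m_closed lit_closed)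

lemma val_append:
  "set v \<subseteq> S \<times> UNIV \<Longrightarrow> set w \<subseteq> S \<times> UNIV \<Longrightarrow> val (v @ w) = val v \<otimes> val w"
proof (induction v)
  case (Cons l v)
  then have "lit l \<in> carrier F" "val v \<in> carrier F" "val w \<in> carrier F"
    using lit_closed[of l] val_closed by auto
  then show ?case using Cons by (simp add: val_Cons m_assoc)
qed (simp add: val_Nil val_closed)

lemma val_single: "l \<in> S \<times> UNIV \<Longrightarrow> val [l] = lit l"
  using lit_closed by (simp add: val_Cons val_Nil)

lemma word_exists: "x \<in> carrier F \<Longrightarrow> \<exists>w. set w \<subseteq> S \<times> UNIV \<and> val w = x"
proof -
  assume "x \<in> carrier F"
  then have "x \<in> generate F S" using basis by (simp add: free_basis_def)
  then show ?thesis
  proof (induction)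
    case one
    show ?case by (rule exI[of _ "[]"]) (simp add: val_Nil)
  next
    case (incl h)
    then show ?case by (intro exI[of _ "[(h, True)]"]) (simp add: val_single lit_def)
  next
    case (inv h)
    then show ?case by (intro exI[of _ "[(h, False)]"]) (simp add: val_single lit_def)
  next
    case (eng h1 h2)
    then obtain v w where "set v \<subseteq> S \<times> UNIV" "val v = h1" "set w \<subseteq> S \<times> UNIV" "val w = h2" by blast
    then show ?case by (intro exI[of _ "v @ w"]) (simp add: val_append)
  qed
qed

text \<open>Any word for \<open>x\<close> will do, reduced or not: \<open>crossings_eq\<close> makes
  the count depend on its value only.\<close>

definition word_of :: "'a \<Rightarrow> ('a \<times> bool) list" where
  "word_of x = (SOME w. set w \<subseteq> S \<times> UNIV \<and> val w = x)"

lemma word_of: "x \<in> carrier F \<Longrightarrow> set (word_of x) \<subseteq> S \<times> UNIV" "x \<in> carrier F \<Longrightarrow> val (word_of x) = x"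
  using someI_ex[OF word_exists] unfolding word_of_def by blast+

definition cancels :: "'a \<times> bool \<Rightarrow> 'a \<times> bool \<Rightarrow> bool" where
  "cancels l l' \<longleftrightarrow> fst l = fst l' \<and> snd l \<noteq> snd l'"

lemma reduced_word_Cons: "reduced_word (l # w) \<longleftrightarrow> reduced_word w \<and> (w \<noteq> [] \<longrightarrow> \<not> cancels l (hd w))"
  unfolding reduced_word_def cancels_def by (cases w) (auto simp: case_prod_beta)

lemma lit_cancels:
  assumes "cancels l l'" "l \<in> S \<times> UNIV" shows "lit l \<otimes> lit l' = \<one>" "lit l' = inv lit l"
  using assms S_carrier unfolding cancels_def lit_def by auto

lemma not_reducedE:
  assumes "\<not> reduced_word w"
  obtains a l l' b where "w = a @ [l, l'] @ b" "cancels l l'"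
proof -
  have "\<exists>a l l' b. w = a @ [l, l'] @ b \<and> cancels l l'"
    using assms
  proof (induction w)
    case (Cons x w)
    show ?case
    proof (cases "reduced_word w")
      case True
      then have "w \<noteq> []" "cancels x (hd w)" using Cons.prems by (auto simp: reduced_word_Cons)
      then show ?thesis by (intro exI[of _ "[]"] exI[of _ x] exI[of _ "hd w"] exI[of _ "tl w"]) simp
    next
      case False
      then obtain a l l' b where "w = a @ [l, l'] @ b" "cancels l l'" using Cons.IH by blast
      then show ?thesis by (intro exI[of _ "x # a"] exI[of _ l] exI[of _ l'] exI[of _ b]) simp
    qed
  qed (simp add: reduced_word_def)
  then show ?thesis using that by blast
qed

lemma reduced_nontrivial:
  "set w \<subseteq> S \<times> UNIV \<Longrightarrow> reduced_word w \<Longrightarrow> w \<noteq> [] \<Longrightarrow> val w \<noteq> \<one>"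
  using basis by (auto simp: free_basis_def)

lemma basis_not_one: "s \<in> S \<Longrightarrow> s \<noteq> \<one>"
  using reduced_nontrivial[of "[(s, True)]"] S_carrier
  by (auto simp: val_single lit_def reduced_word_def)

text \<open>\<open>\<omega> g s\<close> is the weight of the edge from \<open>g\<close> to \<open>g \<otimes> s\<close> of the Cayley graph; \<open>crossings \<omega> w g\<close>
  adds up the signed weights along the path from \<open>g\<close> spelled by \<open>w\<close>.\<close>

definition weight :: "('a \<Rightarrow> 'a \<Rightarrow> int) \<Rightarrow> 'a \<Rightarrow> 'a \<times> bool \<Rightarrow> int" where
  "weight \<omega> g l = (if snd l then \<omega> g (fst l) else - \<omega> (g \<otimes> inv (fst l)) (fst l))"

primrec crossings :: "('a \<Rightarrow> 'a \<Rightarrow> int) \<Rightarrow> ('a \<times> bool) list \<Rightarrow> 'a \<Rightarrow> int" where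
  "crossings \<omega> [] g = 0"
| "crossings \<omega> (l # w) g = weight \<omega> g l + crossings \<omega> w (g \<otimes> lit l)"

lemma crossings_append:
  "g \<in> carrier F \<Longrightarrow> set v \<subseteq> S \<times> UNIV \<Longrightarrow>
   crossings \<omega> (v @ w) g = crossings \<omega> v g + crossings \<omega> w (g \<otimes> val v)"
proof (induction v arbitrary: g)
  case (Cons l v)
  then have "lit l \<in> carrier F" "val v \<in> carrier F"
    using lit_closed[of l] val_closed by auto
  then show ?case using Cons by (simp add: val_Cons m_assoc)
qed (simp add: val_Nil)

text \<open>A nonempty word of value one is not reduced, by freeness. Deleting a cancelling pair
  changes neither the value nor the count, as one edge is crossed forth and back.\<close>

lemma crossings_trivial:
  assumes "set w \<subseteq> S \<times> UNIV" "val w = \<one>" "g \<in> carrier F"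
  shows "crossings \<omega> w g = 0"
  using assms(1,2)
proof (induction "length w" arbitrary: w rule: less_induct)
  case less
  show ?case
  proof (cases "w = []")
    case False
    then have "\<not> reduced_word w" using reduced_nontrivial less.prems by blast
    then obtain a l l' b where w: "w = a @ [l, l'] @ b" and c: "cancels l l'" by (rule not_reducedE)
    have sets: "set a \<subseteq> S \<times> UNIV" "set b \<subseteq> S \<times> UNIV" "l \<in> S \<times> UNIV" "l' \<in> S \<times> UNIV"
      using less.prems(1) unfolding w by auto
    have vals: "val a \<in> carrier F" "val b \<in> carrier F" "lit l \<in> carrier F" "lit l' \<in> carrier F"
      using sets val_closed lit_closed by auto
    have ll: "lit l' = inv (lit l)" using lit_cancels(2)[OF c sets(3)] .
    have "val w = val (a @ b)"
      using sets vals unfolding w ll by (simp add: val_append val_Cons ll m_assoc[symmetric])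
    then have 0: "crossings \<omega> (a @ b) g = 0"
      using less.prems(2) sets by (intro less.hyps) (auto simp: w)
    let ?y = "g \<otimes> val a"
    have y: "?y \<in> carrier F" using vals assms(3) by simp
    have fl: "fst l \<in> carrier F" using sets(3) S_carrier by auto
    have "weight \<omega> ?y l + weight \<omega> (?y \<otimes> lit l) l' = 0"
      using c y fl unfolding weight_def cancels_def lit_def by (auto simp: m_assoc)
    moreover have "?y \<otimes> lit l \<otimes> lit l' = ?y" using y vals unfolding ll by (simp add: m_assoc)
    ultimately have "crossings \<omega> w g = crossings \<omega> (a @ b) g"
      using sets assms(3) unfolding w by (simp add: crossings_append)
    then show ?thesis using 0 by simp
  qed simp
qed

text \<open>Append a word for the inverse of the common value to both words.\<close>

lemma crossings_eq:
  assumes "set v \<subseteq> S \<times> UNIV" "set w \<subseteq> S \<times> UNIV" "val v = val w" "g \<in> carrier F"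
  shows "crossings \<omega> v g = crossings \<omega> w g"
proof -
  let ?u = "word_of (inv (val w))"
  have w: "val w \<in> carrier F" using val_closed assms by blast
  have u: "set ?u \<subseteq> S \<times> UNIV" "val ?u = inv (val w)" using word_of w by auto
  have "crossings \<omega> (v @ ?u) g = 0" "crossings \<omega> (w @ ?u) g = 0"
    using assms u w by (intro crossings_trivial; simp add: val_append)+
  then show ?thesis using assms by (simp add: crossings_append)
qed

lemma crossings_eq_0:
  assumes "\<And>a l b. w = a @ l # b \<Longrightarrow> weight \<omega> (g \<otimes> val a) l = 0"
    and "set w \<subseteq> S \<times> UNIV" "g \<in> carrier F"
  shows "crossings \<omega> w g = 0"
  using assms
proof (induction w arbitrary: g)
  case (Cons x w)
  have x: "lit x \<in> carrier F" using Cons.prems(2) lit_closed by simp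
  have 1: "weight \<omega> g x = 0" using Cons.prems(1)[of "[]"] Cons.prems(3) by (simp add: val_Nil)
  have "crossings \<omega> w (g \<otimes> lit x) = 0"
  proof (rule Cons.IH)
    fix a l b assume w: "w = a @ l # b"
    then have "val a \<in> carrier F" using Cons.prems(2) by (intro val_closed) auto
    then show "weight \<omega> (g \<otimes> lit x \<otimes> val a) l = 0"
      using Cons.prems(1)[of "x # a" l b] w x Cons.prems(3) by (simp add: val_Cons m_assoc)
  qed (use Cons.prems x in auto)
  then show ?case using 1 by simp
qed simp

text \<open>A shortest loop in the quotient of the Cayley graph by \<open>H\<close> is embedded, so it crosses its
  first edge only once; counting crossings of this edge gives the homomorphism.\<close>

lemma nonzero_additive:
  assumes H: "subgroup H F" and nontriv: "H \<noteq> {\<one>}"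
  obtains c h where "additive_on F H c" "h \<in> H" "c h \<noteq> 0"
proof -
  interpret H: subgroup H F by (rule H)
  \<comment> \<open>The path spelled by \<open>w\<close> from \<open>g\<close> ends at an
    \<open>H\<close>-translate of \<open>g\<close>, so it is closed in the quotient; the condition
    on \<open>val w\<close> says that it is not contractible there.\<close>
  define loop where "loop g w \<longleftrightarrow> g \<in> carrier F \<and> set w \<subseteq> S \<times> UNIV \<and> val w \<noteq> \<one> \<and>
    g \<otimes> val w \<otimes> inv g \<in> H" for g w
  obtain h0 where h0: "h0 \<in> H" "h0 \<noteq> \<one>" using nontriv H.one_closed by blast
  then have "loop \<one> (word_of h0)" using word_of[of h0] by (auto simp: loop_def)
  then obtain g w where gw: "loop g w" and min: "\<And>g' w'. loop g' w' \<Longrightarrow> length w \<le> length w'"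
    using ex_has_least_nat[of "\<lambda>(g, w). loop g w" "(\<one>, word_of h0)" "\<lambda>(g, w). length w"] by auto
  have g: "g \<in> carrier F" and w: "set w \<subseteq> S \<times> UNIV" "val w \<noteq> \<one>" "g \<otimes> val w \<otimes> inv g \<in> H"
    using gw by (auto simp: loop_def)
  \<comment> \<open>No proper subpath of a shortest loop closes up: one of value one could be
    deleted, any other would be a shorter loop.\<close>
  have embedded: "g \<otimes> val a \<otimes> val m \<noteq> k \<otimes> (g \<otimes> val a)"
    if s: "w = a @ m @ b" "m \<noteq> []" "a \<noteq> [] \<or> b \<noteq> []" and k: "k \<in> H" for a m b k
  proof
    assume eq: "g \<otimes> val a \<otimes> val m = k \<otimes> (g \<otimes> val a)"
    have sets: "set a \<subseteq> S \<times> UNIV" "set m \<subseteq> S \<times> UNIV" "set b \<subseteq> S \<times> UNIV"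
      using w(1) unfolding s(1) by auto
    note vals = sets[THEN val_closed]
    show False
    proof (cases "val m = \<one>")
      case True
      then have "val w = val (a @ b)" unfolding s(1) using sets vals by (simp add: val_append)
      then have "loop g (a @ b)" using gw sets by (simp add: loop_def)
      from min[OF this] show False using s by simp
    next
      case False
      have ga: "g \<otimes> val a \<in> carrier F" using g vals by simp
      have "g \<otimes> val a \<otimes> val m \<otimes> inv (g \<otimes> val a) = k"
        unfolding eq using ga k by (simp add: m_assoc)
      then have "loop (g \<otimes> val a) m" using False ga sets k by (simp add: loop_def)
      from min[OF this] show False using s by simp
    qed
  qed
  have "w \<noteq> []" using w(2) val_Nil by auto
  then obtain l w' where lw: "w = l # w'" by (cases w) auto
  have l: "l \<in> S \<times> UNIV" and w': "set w' \<subseteq> S \<times> UNIV" using w(1) lw by auto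
  \<comment> \<open>The first edge, written as leaving \<open>e\<close> by the basis element
    \<open>s\<close>; for a negative first letter the path runs against it, from \<open>g\<close> to
    \<open>e\<close>.\<close>
  define s e where "s = fst l" and "e = (if snd l then g else g \<otimes> inv s)"
  have s: "s \<in> carrier F" using l S_carrier by (auto simp: s_def)
  have e: "e \<in> carrier F" using g s by (simp add: e_def)
  define \<omega> :: "'a \<Rightarrow> 'a \<Rightarrow> int" where
    "\<omega> y x = (if x = s \<and> (\<exists>k\<in>H. y = k \<otimes> e) then 1 else 0)" for y x
  have \<omega>_inv: "\<omega> (h \<otimes> y) x = \<omega> y x" if "h \<in> H" "y \<in> carrier F" for h y x
  proof -
    have "(\<exists>k\<in>H. h \<otimes> y = k \<otimes> e) \<longleftrightarrow> (\<exists>k\<in>H. y = k \<otimes> e)"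
    proof
      assume "\<exists>k\<in>H. h \<otimes> y = k \<otimes> e"
      then obtain k where k: "k \<in> H" "h \<otimes> y = k \<otimes> e" by blast
      have "y = inv h \<otimes> (h \<otimes> y)" using that by (simp add: m_assoc[symmetric])
      also have "\<dots> = (inv h \<otimes> k) \<otimes> e" using k that e by (simp add: m_assoc)
      finally show "\<exists>k\<in>H. y = k \<otimes> e" using that k by blast
    next
      assume "\<exists>k\<in>H. y = k \<otimes> e"
      then obtain k where k: "k \<in> H" "y = k \<otimes> e" by blast
      then have "h \<otimes> y = (h \<otimes> k) \<otimes> e" using that e by (simp add: m_assoc)
      then show "\<exists>k\<in>H. h \<otimes> y = k \<otimes> e" using that k by blast
    qed
    then show ?thesis by (simp add: \<omega>_def)
  qed
  have cr_inv: "crossings \<omega> v (h \<otimes> y) = crossings \<omega> v y"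
    if "h \<in> H" "y \<in> carrier F" "set v \<subseteq> S \<times> UNIV" for h y v
    using that(2,3)
  proof (induction v arbitrary: y)
    case (Cons x v)
    have x: "fst x \<in> carrier F" "lit x \<in> carrier F"
      using Cons.prems(2) S_carrier lit_closed[of x] by auto
    have "weight \<omega> (h \<otimes> y) x = weight \<omega> y x"
      using that(1) Cons.prems(1) x \<omega>_inv by (simp add: weight_def m_assoc)
    moreover have "crossings \<omega> v (h \<otimes> y \<otimes> lit x) = crossings \<omega> v (y \<otimes> lit x)"
      using Cons.IH[of "y \<otimes> lit x"] Cons.prems x that(1) by (simp add: m_assoc)
    ultimately show ?case by simp
  qed simp
  have "\<one> \<otimes> e = e" using e by simp
  then have "\<omega> e s = 1" using H.one_closed unfolding \<omega>_def by metis
  then have first: "weight \<omega> g l = (if snd l then 1 else - 1)"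
    by (simp add: weight_def s_def e_def split: if_splits)
  \<comment> \<open>A second crossing of the orbit of the first edge in the same direction would
    close up the path before it; in the opposite direction it would close up the path including
    it.\<close>
  have "crossings \<omega> w' (g \<otimes> lit l) = 0"
  proof (rule crossings_eq_0)
    fix a x b assume ab: "w' = a @ x # b"
    have sets: "set a \<subseteq> S \<times> UNIV" "x \<in> S \<times> UNIV" "set b \<subseteq> S \<times> UNIV" using w' ab by auto
    have va: "val a \<in> carrier F" "lit l \<in> carrier F" "lit x \<in> carrier F"
      using sets val_closed lit_closed l by auto
    let ?y = "g \<otimes> lit l \<otimes> val a"
    have y: "?y \<in> carrier F" using va g by simp
    show "weight \<omega> ?y x = 0"
    proof (rule ccontr)
      assume ne: "weight \<omega> ?y x \<noteq> 0"
      then have xs: "fst x = s" by (auto simp: weight_def \<omega>_def split: if_splits)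
      show False
      proof (cases "snd x = snd l")
        case True
        have "\<exists>k\<in>H. ?y = k \<otimes> g"
        proof (cases "snd l")
          case True
          then show ?thesis using ne \<open>snd x = snd l\<close> by (auto simp: weight_def \<omega>_def e_def split: if_splits)
        next
          case False
          then obtain k where k: "k \<in> H" "?y \<otimes> inv s = k \<otimes> (g \<otimes> inv s)"
            using ne \<open>snd x = snd l\<close> xs by (auto simp: weight_def \<omega>_def e_def split: if_splits)
          then have "?y \<otimes> inv s = (k \<otimes> g) \<otimes> inv s" using g s by (simp add: m_assoc)
          then have "?y = k \<otimes> g" using y g s k(1) by (simp add: right_cancel)
          then show ?thesis using k(1) by blast
        qed
        then obtain k where "k \<in> H" "?y = k \<otimes> g" by blast
        then show False using embedded[of "[]" "l # a" "x # b" k] g va lw ab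
          by (simp add: val_Nil val_Cons m_assoc)
      next
        case False
        have "\<exists>k\<in>H. ?y \<otimes> lit x = k \<otimes> g"
        proof (cases "snd l")
          case True
          then show ?thesis using ne False xs
            by (auto simp: weight_def \<omega>_def e_def lit_def split: if_splits)
        next
          case nl: False
          then obtain k where k: "k \<in> H" "?y = k \<otimes> (g \<otimes> inv s)"
            using ne False xs by (auto simp: weight_def \<omega>_def e_def split: if_splits)
          have "?y \<otimes> s = k \<otimes> g" unfolding k(2) using g s k(1) by (simp add: m_assoc)
          then show ?thesis using k(1) nl False xs by (auto simp: lit_def)
        qed
        then obtain k where k: "k \<in> H" "?y \<otimes> lit x = k \<otimes> g" by blast
        have va2: "val (l # a @ [x]) = lit l \<otimes> val a \<otimes> lit x"
          using sets va by (simp add: val_Cons val_append val_Nil m_assoc)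
        show False
        proof (cases "b = []")
          case b: False
          have "g \<otimes> \<one> \<otimes> val (l # a @ [x]) = k \<otimes> (g \<otimes> \<one>)"
            unfolding va2 using k(2) g va by (simp add: m_assoc)
          then show False using embedded[of "[]" "l # a @ [x]" b k] b k(1) lw ab by (simp add: val_Nil)
        next
          \<comment> \<open>The loop begins and ends with inverse letters; conjugating by the first
            one leaves the shorter loop \<open>a\<close>.\<close>
          case True
          have "cancels l x" using False xs by (auto simp: cancels_def s_def)
          then have lx: "lit x = inv (lit l)" using lit_cancels(2) l by blast
          have vw: "val w = lit l \<otimes> val a \<otimes> inv (lit l)" using va2 True lw ab lx by simp
          have "val a \<noteq> \<one>" using vw w(2) va by auto
          moreover have "(g \<otimes> lit l) \<otimes> val a \<otimes> inv (g \<otimes> lit l) = g \<otimes> val w \<otimes> inv g"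
            unfolding vw using va g by (simp add: m_assoc inv_mult_group)
          ultimately have "loop (g \<otimes> lit l) a" using w(3) g va sets by (simp add: loop_def)
          from min[OF this] show False using lw ab by simp
        qed
      qed
    qed
  qed (use w' g lit_closed l in auto)
  then have nz: "crossings \<omega> w g \<noteq> 0" using first lw by simp
  define c where "c h = crossings \<omega> (word_of h) \<one>" for h
  have add: "c (h \<otimes> k) = c h + c k" if "h \<in> H" "k \<in> H" for h k
  proof -
    have "c (h \<otimes> k) = crossings \<omega> (word_of h @ word_of k) \<one>"
      unfolding c_def using that word_of[of h] word_of[of k] word_of[of "h \<otimes> k"]
      by (intro crossings_eq) (auto simp: val_append)
    also have "\<dots> = c h + crossings \<omega> (word_of k) (h \<otimes> \<one>)"
      using that word_of[of h] by (simp add: crossings_append c_def)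
    finally show ?thesis using cr_inv[of h \<one> "word_of k"] that word_of[of k] by (simp add: c_def)
  qed
  let ?h = "g \<otimes> val w \<otimes> inv g"
  have vw: "val w \<in> carrier F" using w(1) val_closed by blast
  let ?u = "word_of g" and ?u' = "word_of (inv g)"
  have u: "set ?u \<subseteq> S \<times> UNIV" "val ?u = g" "set ?u' \<subseteq> S \<times> UNIV" "val ?u' = inv g"
    using word_of g by auto
  \<comment> \<open>The outer pieces cancel: the count is invariant under \<open>H\<close>, and the
    end point of the middle piece is an \<open>H\<close>-translate of \<open>g\<close>.\<close>
  have "c ?h = crossings \<omega> (?u @ w @ ?u') \<one>"
    unfolding c_def using u w(1,3) vw g word_of[of ?h]
    by (intro crossings_eq) (auto simp: val_append m_assoc)
  also have "\<dots> = crossings \<omega> ?u \<one> + crossings \<omega> w g + crossings \<omega> ?u' (g \<otimes> val w)"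
    using u w(1) g by (simp add: crossings_append)
  also have "crossings \<omega> ?u' (g \<otimes> val w) = crossings \<omega> ?u' g"
  proof -
    have "g \<otimes> val w = ?h \<otimes> g" using g vw by (simp add: m_assoc)
    then show ?thesis using cr_inv[OF w(3) g u(3)] by simp
  qed
  also have "crossings \<omega> ?u \<one> + crossings \<omega> w g + crossings \<omega> ?u' g = crossings \<omega> w g"
  proof -
    have "crossings \<omega> (?u @ ?u') \<one> = 0" using u g by (intro crossings_trivial) (auto simp: val_append)
    then show ?thesis using u g by (simp add: crossings_append)
  qed
  finally have "c ?h \<noteq> 0" using nz by simp
  then show ?thesis using that[of c ?h] add w(3) by (simp add: additive_on_def)
qed

end


section \<open>Subgroups of free groups\<close>

context based_free_group
begin

section \<open>The Cayley tree of a free basis\<close>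

definition cayley_edges :: "'a set set" where
  "cayley_edges = {{g, g \<otimes> s} | g s. g \<in> carrier F \<and> s \<in> S}"

lemma cayley_adj:
  "{u, v} \<in> cayley_edges \<longleftrightarrow> u \<in> carrier F \<and> (\<exists>l\<in>S \<times> UNIV. v = u \<otimes> lit l)" (is "?L \<longleftrightarrow> ?R")
proof
  assume ?L
  then obtain g s where gs: "g \<in> carrier F" "s \<in> S" "{u, v} = {g, g \<otimes> s}"
    by (auto simp: cayley_edges_def)
  have s: "s \<in> carrier F" using gs S_carrier by blast
  from gs(3) consider "u = g" "v = g \<otimes> s" | "u = g \<otimes> s" "v = g" by (auto simp: doubleton_eq_iff)
  then show ?R
  proof cases
    case 1
    then show ?thesis using gs by (auto simp: lit_def intro!: bexI[of _ "(s, True)"])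
  next
    case 2
    then have "v = u \<otimes> lit (s, False)" using gs s by (simp add: lit_def m_assoc)
    then show ?thesis using 2 gs s by auto
  qed
next
  assume ?R
  then obtain s b where l: "u \<in> carrier F" "s \<in> S" "v = u \<otimes> lit (s, b)" by auto
  have s: "s \<in> carrier F" using l S_carrier by blast
  show ?L
  proof (cases b)
    case True
    then show ?thesis using l by (auto simp: cayley_edges_def lit_def)
  next
    case False
    then have "u = v \<otimes> s" "v \<in> carrier F" using l s by (auto simp: lit_def m_assoc)
    then show ?thesis using l(2) by (auto simp: cayley_edges_def insert_commute)
  qed
qed

text \<open>A cancelling pair of letters would lead the path straight back, so a path without
  backtracking spells a reduced word. The clause on the second vertex carries this through the
  induction.\<close>

lemma path_word:
  assumes "edge_path cayley_edges p" "nonbacktracking p" "p \<noteq> []" "set p \<subseteq> carrier F"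
  shows "\<exists>w. set w \<subseteq> S \<times> UNIV \<and> reduced_word w \<and> length p = Suc (length w) \<and>
    last p = hd p \<otimes> val w \<and> (w \<noteq> [] \<longrightarrow> p ! 1 = hd p \<otimes> lit (hd w))"
  using assms
proof (induction p)
  case (Cons x p)
  show ?case
  proof (cases p)
    case Nil
    then show ?thesis using Cons.prems
      by (intro exI[of _ "[]"]) (simp add: reduced_word_def val_Nil)
  next
    case (Cons y p')
    have p': "edge_path cayley_edges p" "nonbacktracking p" "p \<noteq> []" "set p \<subseteq> carrier F" "{x, y} \<in> cayley_edges"
      using Cons.prems nonbacktracking_ConsD by (auto simp: Cons edge_path_Cons_Cons)
    obtain w where w: "set w \<subseteq> S \<times> UNIV" "reduced_word w" "length p = Suc (length w)"
      "last p = y \<otimes> val w" "w \<noteq> [] \<Longrightarrow> p ! 1 = y \<otimes> lit (hd w)"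
      using Cons.IH[OF p'(1-4)] Cons by auto
    obtain l where l: "l \<in> S \<times> UNIV" "y = x \<otimes> lit l" using p'(5) cayley_adj by blast
    have x: "x \<in> carrier F" "lit l \<in> carrier F" "val w \<in> carrier F"
      using Cons.prems(4) l lit_closed val_closed w by auto
    have "\<not> cancels l (hd w)" if "w \<noteq> []"
    proof
      assume c: "cancels l (hd w)"
      have "p ! 1 = x" using w(5)[OF that] lit_cancels(2)[OF c l(1)] l(2) x by (simp add: m_assoc)
      moreover have "p' \<noteq> []" using w(3) that Cons by auto
      ultimately have "hd p' = x" using Cons by (cases p') auto
      then show False using Cons.prems(2) \<open>p' \<noteq> []\<close> Cons by (simp add: nonbacktracking_Cons_Cons)
    qed
    then have "reduced_word (l # w)" using w(2) by (simp add: reduced_word_Cons)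
    then show ?thesis using w l x Cons
      by (intro exI[of _ "l # w"]) (simp add: val_Cons m_assoc)
  qed
qed simp

lemma cayley_tree: "simplicial_tree (carrier F) cayley_edges"
  unfolding simplicial_tree_def
proof (intro conjI ballI)
  show "simplicial_graph (carrier F) cayley_edges"
    unfolding simplicial_graph_def
  proof
    fix e assume "e \<in> cayley_edges"
    then obtain g s where gs: "g \<in> carrier F" "s \<in> S" "e = {g, g \<otimes> s}" by (auto simp: cayley_edges_def)
    moreover have s: "s \<in> carrier F" using gs S_carrier by blast
    moreover have "g \<otimes> s \<noteq> g" using gs(1) s basis_not_one[OF gs(2)] by simp
    ultimately show "\<exists>u\<in>carrier F. \<exists>v\<in>carrier F. u \<noteq> v \<and> e = {u, v}" by blast
  qed
  fix u v assume uv: "u \<in> carrier F" "v \<in> carrier F"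
  have "\<exists>p. p \<noteq> [] \<and> hd p = u \<and> last p = u \<otimes> val w \<and> edge_path cayley_edges p"
    if "set w \<subseteq> S \<times> UNIV" for w
    using that uv(1)
  proof (induction w arbitrary: u)
    case Nil
    then show ?case by (intro exI[of _ "[u]"]) (simp add: edge_path_def val_Nil)
  next
    case (Cons l w)
    have l: "lit l \<in> carrier F" "l \<in> S \<times> UNIV" "val w \<in> carrier F"
      using Cons.prems lit_closed val_closed by auto
    obtain p where p: "p \<noteq> []" "hd p = u \<otimes> lit l" "last p = u \<otimes> lit l \<otimes> val w" "edge_path cayley_edges p"
      using Cons.IH[of "u \<otimes> lit l"] Cons.prems l by auto
    have "{u, u \<otimes> lit l} \<in> cayley_edges" using cayley_adj Cons.prems(2) l(2) by blast
    then show ?case using p l Cons.prems(2)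
      by (intro exI[of _ "u # p"]) (simp add: edge_path_def successively_Cons val_Cons m_assoc)
  qed
  moreover obtain w where "set w \<subseteq> S \<times> UNIV" "val w = inv u \<otimes> v" using word_exists uv by blast
  moreover have "u \<otimes> (inv u \<otimes> v) = v" using uv by (simp add: m_assoc[symmetric])
  ultimately show "\<exists>p. p \<noteq> [] \<and> hd p = u \<and> last p = v \<and> edge_path cayley_edges p" by metis
next
  show "\<not> (\<exists>p. 3 \<le> length p \<and> distinct p \<and> edge_path cayley_edges p \<and> {last p, hd p} \<in> cayley_edges)"
  proof
    assume "\<exists>p. 3 \<le> length p \<and> distinct p \<and> edge_path cayley_edges p \<and> {last p, hd p} \<in> cayley_edges"
    then obtain p where p: "3 \<le> length p" "distinct p" "edge_path cayley_edges p"
      "{last p, hd p} \<in> cayley_edges" by blast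
    have ne: "p \<noteq> []" using p(1) by auto
    \<comment> \<open>Repeating the first vertex makes the cycle a closed path. It still does not
      backtrack because the cycle has at least three vertices, so it spells a reduced word of value
      one, against freeness.\<close>
    let ?q = "p @ [hd p]"
    have path: "edge_path cayley_edges ?q"
      using p(3,4) ne unfolding edge_path_def by (simp add: successively_append_iff)
    have "nonbacktracking ?q"
      unfolding nonbacktracking_def
    proof
      assume "\<exists>a x y b. ?q = a @ [x, y, x] @ b"
      then obtain a x y b where q: "?q = a @ [x, y, x] @ b" by blast
      show False
      proof (cases b rule: rev_cases)
        case Nil
        then have "p = a @ [x, y]" "hd p = x" using q by auto
        then show False using p(1,2) by (cases a) auto
      next
        case (snoc b' z)
        then have "p = a @ [x, y, x] @ b'" using q by auto
        then show False using p(2) by simp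
      qed
    qed
    moreover have "set p \<subseteq> carrier F"
    proof -
      have "set q \<subseteq> carrier F" if "edge_path cayley_edges q" "last q \<in> carrier F" for q
        using that
      proof (induction q)
        case (Cons a q)
        then show ?case
          by (cases q) (auto simp: edge_path_Cons_Cons cayley_adj edge_path_def)
      qed simp
      then show ?thesis using p(3,4) cayley_adj by blast
    qed
    moreover from this have hp: "hd p \<in> carrier F" using ne by auto
    ultimately obtain w where w: "set w \<subseteq> S \<times> UNIV" "reduced_word w" "length ?q = Suc (length w)"
      "last ?q = hd ?q \<otimes> val w"
      using path_word[OF path] ne by auto
    have "w \<noteq> []" using w(3) p(1) by auto
    moreover have "val w = \<one>"
      using w(4) ne hp val_closed[OF w(1)] by simp
    ultimately show False using reduced_nontrivial[OF w(1,2)] by blast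
  qed
qed (use one_closed in blast)

sublocale cayley: tree_action "carrier F" cayley_edges F "(\<otimes>)"
proof (unfold_locales)
  show "simplicial_tree (carrier F) cayley_edges" by (rule cayley_tree)
  fix g u v assume g: "g \<in> carrier F" and uv: "{u, v} \<in> cayley_edges"
  then obtain l where l: "u \<in> carrier F" "l \<in> S \<times> UNIV" "v = u \<otimes> lit l" using cayley_adj by blast
  then have "g \<otimes> v = g \<otimes> u \<otimes> lit l" using lit_closed g by (simp add: m_assoc)
  then show "{g \<otimes> u, g \<otimes> v} \<in> cayley_edges" using cayley_adj l g by blast
qed (auto simp: m_assoc)

text \<open>The quotient of the least \<open>N\<close>-invariant subtree by \<open>N\<close> has finitely many vertices, and powers
  of \<open>h\<close> permute them.\<close>

lemma power_in_normal:
  assumes N: "N = generate F T" "finite T" "T \<subseteq> carrier F" and nontriv: "N \<noteq> {\<one>}"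
    and h: "h \<in> carrier F" and norm: "\<And>n. n \<in> N \<Longrightarrow> h \<otimes> n \<otimes> inv h \<in> N"
  obtains k :: nat where "k > 0" "h [^] k \<in> N"
proof -
  have subN: "subgroup N F" using generate_is_subgroup[OF N(3)] N(1) by simp
  interpret N: subgroup N F by (rule subN)
  obtain n where n: "n \<in> N" "n \<noteq> \<one>" using nontriv N.one_closed by blast
  have "\<not> cayley.fixes_vertex N"
  proof
    assume "cayley.fixes_vertex N"
    then obtain v where "v \<in> carrier F" "n \<otimes> v = v" using n by (auto simp: cayley.fixes_vertex_def)
    then show False using n by simp
  qed
  from cayley.least_inv_subtree[OF N this]
  obtain M R where M: "cayley.inv_subtree N M" "\<And>S'. cayley.inv_subtree N S' \<Longrightarrow> M \<subseteq> S'"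
    and R: "finite R" "\<And>a. a \<in> M \<Longrightarrow> \<exists>h\<in>N. \<exists>k\<in>R. a = h \<otimes> k" "R \<subseteq> carrier F"
    by metis
  have MF: "M \<subseteq> carrier F" "M \<noteq> {}" using M(1) by (auto simp: cayley.inv_subtree_def cayley.convex_def)
  \<comment> \<open>The translate of \<open>M\<close> by \<open>inv h\<close> is invariant under
    \<open>N\<close> because \<open>h\<close> conjugates \<open>N\<close> into itself. As
    \<open>M\<close> is least, it follows that \<open>h\<close> maps \<open>M\<close> into
    itself.\<close>
  have "cayley.inv_subtree N ((\<otimes>) (inv h) ` M)"
    using h norm M(1) N.subset by (intro cayley.inv_subtree_image) auto
  then have sub: "M \<subseteq> (\<otimes>) (inv h) ` M" by (rule M(2))
  have hM: "h \<otimes> v \<in> M" if "v \<in> M" for v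
  proof -
    obtain m where "m \<in> M" "v = inv h \<otimes> m" using sub \<open>v \<in> M\<close> by blast
    then show ?thesis using h MF by (auto simp: m_assoc[symmetric])
  qed
  obtain v where v: "v \<in> M" using MF by blast
  have vF: "v \<in> carrier F" using v MF by blast
  have "h [^] i \<otimes> v \<in> M" for i :: nat
  proof (induction i)
    case (Suc i)
    have "h [^] Suc i \<otimes> v = h \<otimes> (h [^] i \<otimes> v)"
      using h vF nat_pow_Suc2[OF h] by (simp add: m_assoc del: nat_pow_Suc)
    then show ?case using hM Suc by simp
  qed (use v vF in simp)
  then have "\<exists>n k. n \<in> N \<and> k \<in> R \<and> h [^] i \<otimes> v = n \<otimes> k" for i :: nat using R(2) by blast
  then obtain f g where fg: "\<And>i::nat. f i \<in> N \<and> g i \<in> R \<and> h [^] i \<otimes> v = f i \<otimes> g i" by metis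
  \<comment> \<open>Infinitely many exponents share finitely many representatives in
    \<open>R\<close>; two vertices \<open>h [^] i \<otimes> v\<close> with the same representative
    differ by an element of \<open>N\<close>.\<close>
  have "\<not> inj g"
    using R(1) fg finite_subset[of "range g" R] finite_imageD[of g UNIV] by auto
  then obtain i j where "i \<noteq> j" "g i = g j" by (auto simp: inj_def)
  then obtain i j where ij: "i < j" "g i = g j" by (metis linorder_neqE_nat)
  have fc: "f i \<in> carrier F" "f j \<in> carrier F" "g j \<in> carrier F" using fg R(3) N.subset by blast+
  have e1: "h [^] i \<otimes> v = f i \<otimes> g j" "h [^] j \<otimes> v = f j \<otimes> g j" using fg ij by metis+
  have "g j = inv (f i) \<otimes> (h [^] i \<otimes> v)" unfolding e1 using fc by (simp add: m_assoc[symmetric])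
  then have "h [^] j \<otimes> v = (f j \<otimes> inv (f i) \<otimes> h [^] i) \<otimes> v"
    using e1(2) fc h vF by (simp add: m_assoc)
  then have "h [^] j = f j \<otimes> inv (f i) \<otimes> h [^] i" using fc h vF by (simp add: right_cancel)
  moreover have "h [^] j = h [^] (j - i) \<otimes> h [^] i" using ij h by (simp add: nat_pow_mult)
  ultimately have "h [^] (j - i) = f j \<otimes> inv (f i)" using fc h by (simp add: right_cancel)
  then have "h [^] (j - i) \<in> N" using fg by simp
  then show ?thesis using that[of "j - i"] ij by simp
qed

text \<open>The nonzero homomorphism on the cyclic group of \<open>x\<close> is nonzero at
  \<open>x\<close> itself, which excludes a positive exponent \<open>n\<close>.\<close>

lemma torsion_free:
  assumes x: "x \<in> carrier F" "x \<noteq> \<one>" and n: "x [^] (n::nat) = \<one>" shows "n = 0"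
proof -
  have sub: "subgroup (generate F {x}) F" using x by (intro generate_is_subgroup) simp
  have xg: "x \<in> generate F {x}" by (rule generate.incl) simp
  then have "generate F {x} \<noteq> {\<one>}" using x(2) by blast
  from nonzero_additive[OF sub this] obtain c h
    where c: "additive_on F (generate F {x}) c" "h \<in> generate F {x}" "c h \<noteq> 0" by blast
  note props = additive_on_props[OF sub c(1)]
  obtain i :: int where "h = x [^] i" using c(2) generate_pow[OF x(1)] by blast
  then have "c x \<noteq> 0" using props(4)[OF xg] c(3) by auto
  moreover have "int n * c x = 0" using props(3)[OF xg, of n] props(1) n by simp
  ultimately show ?thesis by simp
qed

text \<open>The cyclic group of \<open>a\<close> is normal in the centraliser, so every
  \<open>z\<close> there has a positive power in it. Hence a homomorphism that is nonzero somewhere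
  is nonzero at \<open>a\<close>, and \<open>c z = 0\<close> forces a power of \<open>z\<close>, so
  \<open>z\<close> itself, to be trivial. In effect the centraliser is infinite cyclic.\<close>

lemma additive_injective_on_centraliser:
  assumes a: "a \<in> carrier F" "a \<noteq> \<one>"
  defines "H \<equiv> {y \<in> carrier F. a \<otimes> y = y \<otimes> a}"
  obtains c where "additive_on F H c" "\<forall>z\<in>H. c z = 0 \<longrightarrow> z = \<one>"
proof -
  let ?N = "generate F {a}"
  have H: "subgroup H F" unfolding H_def by (rule subgroup_centraliser[OF a(1)])
  have aH: "a \<in> H" and aN: "a \<in> ?N" using a by (auto simp: H_def intro: generate.incl)
  have "H \<noteq> {\<one>}" using aH a(2) by blast
  from nonzero_additive[OF H this] obtain c h where c: "additive_on F H c" "h \<in> H" "c h \<noteq> 0" by blast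
  note props = additive_on_props[OF H c(1)]
  have pow: "\<exists>k>0. \<exists>i::int. z [^] (k::nat) = a [^] i" if z: "z \<in> H" for z
  proof -
    have zc: "z \<in> carrier F" "a \<otimes> z = z \<otimes> a" using z by (auto simp: H_def)
    have sub: "?N \<subseteq> {y \<in> carrier F. z \<otimes> y = y \<otimes> z}"
      using zc a by (intro generate_subgroup_incl subgroup_centraliser) auto
    have "z \<otimes> n \<otimes> inv z \<in> ?N" if "n \<in> ?N" for n
    proof -
      have "z \<otimes> n = n \<otimes> z" "n \<in> carrier F" using sub that by auto
      then have "z \<otimes> n \<otimes> inv z = n" using zc by (simp add: m_assoc)
      then show ?thesis using that by simp
    qed
    moreover have "?N \<noteq> {\<one>}" using aN a(2) by blast
    ultimately obtain k :: nat where "k > 0" "z [^] k \<in> ?N"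
      using power_in_normal[of ?N "{a}" z] a zc(1) by auto
    then show ?thesis using generate_pow[OF a(1)] by auto
  qed
  have ca: "c a \<noteq> 0"
  proof
    assume "c a = 0"
    moreover obtain k :: nat and i :: int where k: "k > 0" "h [^] k = a [^] i" using pow[OF c(2)] by blast
    ultimately have "int k * c h = 0" using props(3)[OF c(2), of k] props(4)[OF aH, of i] by simp
    then show False using c(3) k(1) by simp
  qed
  have "z = \<one>" if z: "z \<in> H" "c z = 0" for z
  proof (rule ccontr)
    assume ne: "z \<noteq> \<one>"
    obtain k :: nat and i :: int where k: "k > 0" "z [^] k = a [^] i" using pow[OF z(1)] by blast
    then have "i * c a = 0" using props(3)[OF z(1), of k] props(4)[OF aH, of i] z(2) by simp
    then have "z [^] k = \<one>" using ca k(2) by simp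
    moreover have "z \<in> carrier F" using z(1) by (simp add: H_def)
    ultimately show False using torsion_free ne k(1) by blast
  qed
  then show ?thesis using that c(1) by blast
qed

text \<open>The homomorphism on the centraliser of \<open>a\<close> is injective and kills the
  commutator of \<open>x\<close> and \<open>y\<close>.\<close>

lemma commute_trans:
  assumes a: "a \<in> carrier F" "a \<noteq> \<one>" and x: "x \<in> carrier F" "a \<otimes> x = x \<otimes> a"
    and y: "y \<in> carrier F" "a \<otimes> y = y \<otimes> a"
  shows "x \<otimes> y = y \<otimes> x"
proof -
  let ?H = "{y \<in> carrier F. a \<otimes> y = y \<otimes> a}"
  have H: "subgroup ?H F" by (rule subgroup_centraliser[OF a(1)])
  obtain c where c: "additive_on F ?H c" "\<forall>z\<in>?H. c z = 0 \<longrightarrow> z = \<one>"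
    by (rule additive_injective_on_centraliser[OF a])
  note props = additive_on_props[OF H c(1)]
  have xy: "x \<in> ?H" "y \<in> ?H" using x y by auto
  have xy': "x \<otimes> y \<in> ?H" "y \<otimes> x \<in> ?H"
    by (rule subgroup.m_closed[OF H]; rule xy)+
  have add: "c (u \<otimes> v) = c u + c v" if "u \<in> ?H" "v \<in> ?H" for u v
    using c(1) that by (auto simp: additive_on_def)
  let ?z = "x \<otimes> y \<otimes> inv (y \<otimes> x)"
  have i: "inv (y \<otimes> x) \<in> ?H" using subgroup.m_inv_closed[OF H xy'(2)] .
  have "?z \<in> ?H" using subgroup.m_closed[OF H xy'(1) i] .
  moreover have "c ?z = 0"
    unfolding add[OF xy'(1) i] props(2)[OF xy'(2)] add[OF xy(1,2)] add[OF xy(2,1)] by simp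
  ultimately have "?z = \<one>" using c(2) by blast
  then have "inv (inv (y \<otimes> x)) = x \<otimes> y" using x(1) y(1) by (intro inv_equality) auto
  then show ?thesis using x(1) y(1) by simp
qed

lemma slender_imp_cyclic:
  assumes H: "subgroup H F" and slender: "slender_group (F\<lparr>carrier := H\<rparr>)"
  shows "cyclic_group (F\<lparr>carrier := H\<rparr>)"
proof (cases "H = {\<one>}")
  case True
  then have "H = generate F {\<one>}" using generate_one by auto
  then show ?thesis using cyclic_subgroup_iff[OF H] True by auto
next
  case False
  interpret H: subgroup H F by (rule H)
  from nonzero_additive[OF H False] obtain c h where c: "additive_on F H c" "h \<in> H" "c h \<noteq> 0" by blast
  note props = additive_on_props[OF H c(1)]
  have add: "c (u \<otimes> v) = c u + c v" if "u \<in> H" "v \<in> H" for u v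
    using c(1) that by (auto simp: additive_on_def)
  let ?N = "{x \<in> H. c x = 0}"
  have N: "subgroup ?N F"
  proof (rule subgroupI)
    show "?N \<noteq> {}" using props(1) H.one_closed by blast
  qed (use props(2) add in auto)
  then obtain T where T: "finite T" "T \<subseteq> ?N" "generate F T = ?N"
    using slender slender_subgroup_iff[OF H] by blast
  \<comment> \<open>A nontrivial kernel, finitely generated because \<open>H\<close> is slender,
    would contain a positive power of \<open>h\<close>, where \<open>c\<close> does not
    vanish.\<close>
  have "?N = {\<one>}"
  proof (rule ccontr)
    assume ne: "?N \<noteq> {\<one>}"
    have "h \<otimes> n \<otimes> inv h \<in> ?N" if "n \<in> ?N" for n
      using that c(2) add props(2) by auto
    moreover have "h \<in> carrier F" "T \<subseteq> carrier F" using c(2) T(2) H.subset by auto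
    ultimately obtain k :: nat where "k > 0" "h [^] k \<in> ?N"
      using power_in_normal[of ?N T h] T ne by metis
    then show False using props(3)[OF c(2), of k] c(3) by simp
  qed
  moreover obtain y where y: "y \<in> H" "\<forall>h\<in>H. \<exists>q::int. c (h \<otimes> inv (y [^] q)) = 0"
    using additive_generator[OF H c(1)] by blast
  ultimately have "\<exists>q::int. h = y [^] q" if h: "h \<in> H" for h
  proof -
    obtain q :: int where q: "c (h \<otimes> inv (y [^] q)) = 0" using y(2) h by blast
    have yq: "y [^] q \<in> H" using subgroup_int_pow_closed[OF H y(1)] .
    then have "h \<otimes> inv (y [^] q) \<in> ?N" using q h by simp
    then have "h \<otimes> inv (y [^] q) = \<one>" using \<open>?N = {\<one>}\<close> by blast
    then have "inv (inv (y [^] q)) = h" using h yq by (intro inv_equality) auto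
    then have "h = y [^] q" using yq by simp
    then show ?thesis by blast
  qed
  then have "H \<subseteq> generate F {y}" using generate_pow[of y] y(1) by auto
  moreover have "generate F {y} \<subseteq> H" using generate_subgroup_incl[of "{y}" H] y(1) H by simp
  ultimately show ?thesis using cyclic_subgroup_iff[OF H] y(1) by blast
qed

text \<open>A free group with at most one basis element is cyclic; for two basis elements the
  commutator word is reduced.\<close>

lemma noncyclic_nonabelian:
  assumes "\<not> cyclic_group F"
  obtains x y where "x \<in> carrier F" "y \<in> carrier F" "x \<otimes> y \<noteq> y \<otimes> x"
proof -
  have "\<exists>s\<in>S. \<exists>t\<in>S. s \<noteq> t"
  proof (rule ccontr)
    assume "\<not> ?thesis"
    then obtain x where x: "x \<in> carrier F" "S \<subseteq> {x}" using S_carrier by (cases "S = {}") auto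
    have "carrier F \<subseteq> generate F {x}" using basis mono_generate[OF x(2)] by (simp add: free_basis_def)
    then have "carrier F = range (\<lambda>n::int. x [^] n)" using generate_pow[OF x(1)] x(1) by auto
    then show False using assms cyclic_group x(1) by blast
  qed
  then obtain s t where st: "s \<in> S" "t \<in> S" "s \<noteq> t" by blast
  have c: "s \<in> carrier F" "t \<in> carrier F" using st S_carrier by auto
  let ?w = "[(s, True), (t, True), (s, False), (t, False)]"
  have "val ?w \<noteq> \<one>" using st by (intro reduced_nontrivial) (auto simp: reduced_word_def)
  then have "s \<otimes> (t \<otimes> (inv s \<otimes> inv t)) \<noteq> \<one>" using c by (simp add: val_Cons val_Nil lit_def)
  moreover have "s \<otimes> (t \<otimes> (inv s \<otimes> inv t)) = (s \<otimes> t) \<otimes> inv (t \<otimes> s)"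
    using c by (simp add: m_assoc inv_mult_group)
  ultimately have "s \<otimes> t \<noteq> t \<otimes> s" using c by auto
  then show ?thesis using that c by blast
qed

end


section \<open>Automorphisms commuting with a free group action\<close>

text \<open>The situation that \<open>commuting_aut_trivial\<close> leads to a contradiction. A map
  without fixed vertices may still invert an edge; \<open>no_inv_edge\<close> serves to exclude
  this.\<close>

locale displaced_tree_action = tree_action V E G act
  for V :: "'v set" and E and G (structure) and act +
  fixes \<beta> :: "'v \<Rightarrow> 'v"
  assumes \<beta>_aut: "tree_aut \<beta>"
    and \<beta>_act: "g \<in> carrier G \<Longrightarrow> v \<in> V \<Longrightarrow> \<beta> (act g v) = act g (\<beta> v)"
    and \<beta>_moves: "v \<in> V \<Longrightarrow> \<beta> v \<noteq> v"
    and minimal: "inv_subtree (carrier G) M \<Longrightarrow> M = V"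
    and no_inv_edge: "adj u v \<Longrightarrow> \<exists>g\<in>carrier G. act g ` {u, v} \<noteq> {u, v}"
begin

text \<open>The flow of a translation: off the axis it runs towards the axis, on the axis in the
  direction of the translation.\<close>

definition nxt :: "'v \<Rightarrow> 'v" where
  "nxt v = step v (\<beta> v)"

lemma \<beta>_closed: "v \<in> V \<Longrightarrow> \<beta> v \<in> V"
  using \<beta>_aut by (auto simp: tree_aut_def)

lemma nxt_adj: "v \<in> V \<Longrightarrow> adj v (nxt v)"
  using step_props(1)[OF \<beta>_closed, of v v] \<beta>_moves[of v] by (auto simp: nxt_def)

lemma nxt_closed: "v \<in> V \<Longrightarrow> nxt v \<in> V"
  using nxt_adj adjD(2) by blast

lemma iter_closed: "v \<in> V \<Longrightarrow> (nxt ^^ k) v \<in> V"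
  by (induction k) (auto simp: nxt_closed)

lemma nxt_act: "g \<in> carrier G \<Longrightarrow> v \<in> V \<Longrightarrow> nxt (act g v) = act g (nxt v)"
  using act_step[of g "\<beta> v" v] \<beta>_act[of g v] \<beta>_closed[of v] \<beta>_moves[of v] by (auto simp: nxt_def)

lemma iter_act: "g \<in> carrier G \<Longrightarrow> v \<in> V \<Longrightarrow> (nxt ^^ k) (act g v) = act g ((nxt ^^ k) v)"
  by (induction k) (auto simp: nxt_act iter_closed)

lemma nxt_\<beta>: "v \<in> V \<Longrightarrow> nxt (\<beta> v) = \<beta> (nxt v)"
  using step_map[OF \<beta>_aut \<beta>_closed, of v v] \<beta>_moves[of v] by (auto simp: nxt_def)

lemma iter_\<beta>: "v \<in> V \<Longrightarrow> (nxt ^^ k) (\<beta> v) = \<beta> ((nxt ^^ k) v)"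
  by (induction k) (auto simp: nxt_\<beta> iter_closed)

text \<open>Otherwise \<open>\<beta> p\<close> lies on the side of \<open>p\<close> and
  \<open>\<beta> q\<close> on the side of \<open>q\<close>. These images are adjacent, so their edge
  would be the edge from \<open>p\<close> to \<open>q\<close>, and \<open>\<beta> p = p\<close>. The
  proof reads this off distances.\<close>

lemma edge_oriented:
  assumes "adj p q" shows "nxt p = q \<or> nxt q = p"
proof (rule ccontr)
  assume ne: "\<not> (nxt p = q \<or> nxt q = p)"
  note V = adjD(1,2)[OF assms]
  note BV = V[THEN \<beta>_closed]
  have adjB: "adj (\<beta> p) (\<beta> q)" using \<beta>_aut assms by (simp add: tree_aut_def)
  have 1: "tdist (\<beta> p) q = Suc (tdist (\<beta> p) p)"
    using tdist_adj[OF BV(1) assms] step_eqI[OF BV(1) assms] ne nxt_def by metis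
  have 2: "tdist (\<beta> q) p = Suc (tdist (\<beta> q) q)"
    using tdist_adj[OF BV(2) assms] step_eqI[OF BV(2) adj_sym[OF assms]] ne nxt_def by metis
  have s: "tdist q (\<beta> p) = tdist (\<beta> p) q" "tdist q (\<beta> q) = tdist (\<beta> q) q"
    "tdist p (\<beta> p) = tdist (\<beta> p) p" "tdist p (\<beta> q) = tdist (\<beta> q) p"
    using tdist_sym V BV by blast+
  \<comment> \<open>Seen from \<open>q\<close>, the right side exceeds the left by 0 or 2; seen from
    \<open>p\<close>, the left exceeds the right by 0 or 2.\<close>
  have D: "tdist (\<beta> p) p = tdist (\<beta> q) q"
    using tdist_adj[OF V(2) adjB] tdist_adj[OF V(1) adjB] 1 2 unfolding s by linarith
  have "step (\<beta> p) q = \<beta> q"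
    using step_eqI[OF V(2) adjB] 1 D unfolding s by simp
  moreover have "q \<noteq> \<beta> p" using 1 tdist_self[OF BV(1)] by auto
  then have "step (\<beta> p) p = step (\<beta> p) q"
    using step_branch[OF BV(1) assms] \<beta>_moves[OF V(1)] by metis
  ultimately have "step (\<beta> p) p = \<beta> q" by simp
  then have "tdist p (\<beta> p) = Suc (tdist p (\<beta> q))"
    using step_props(2)[OF V(1) BV(1)] \<beta>_moves[OF V(1)] by metis
  then show False using 2 D unfolding s by simp
qed

text \<open>If \<open>nxt\<close> swaps \<open>v\<close> and \<open>nxt v\<close>, all other
  vertices flow towards this edge, since every edge is oriented. So no other edge is swapped, and
  this one is invariant under \<open>G\<close>, whose action commutes with
  \<open>nxt\<close>.\<close>

lemma no_swap:
  assumes v: "v \<in> V" shows "nxt (nxt v) \<noteq> v"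
proof
  let ?w = "nxt v"
  assume sw: "nxt ?w = v"
  have toward: "x = v \<or> x = ?w \<or> nxt x = step x v" if "x \<in> V" for x
    using v that
  proof (induction rule: geodesic_induct)
    case (step x)
    note sp = step_props[OF v step(1,2)]
    from edge_oriented[OF sp(1)] show ?case
    proof
      assume n: "nxt (step x v) = x"
      have y: "step x v \<in> V" using sp(1) adjD(2) by blast
      show ?case
      proof (cases "step x v = v \<or> step x v = ?w")
        case True
        then show ?thesis using n sw by auto
      next
        case False
        then have "step (step x v) v = x" using step.IH n by simp
        then show ?thesis using step_props(2)[OF v y] sp(2) False by simp
      qed
    qed simp
  qed simp
  have unique: "{a, nxt a} = {v, ?w}" if a: "a \<in> V" "nxt (nxt a) = a" for a
  proof -
    have "a = v \<or> a = ?w"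
    proof (rule ccontr)
      assume na: "\<not> (a = v \<or> a = ?w)"
      let ?b = "nxt a"
      have b: "?b \<in> V" "?b \<noteq> v" "?b \<noteq> ?w" using nxt_closed a sw na by auto
      have "?b = step a v" "a = step ?b v" using toward a(1) na b a(2) by metis+
      then have "tdist v a = Suc (tdist v ?b)" "tdist v ?b = Suc (tdist v a)"
        using step_props(2)[OF v] a(1) na b by metis+
      then show False by simp
    qed
    then show ?thesis using sw by auto
  qed
  obtain g where g: "g \<in> carrier G" "act g ` {v, ?w} \<noteq> {v, ?w}"
    using no_inv_edge[OF nxt_adj[OF v]] by blast
  have "nxt (act g v) = act g ?w" "nxt (act g ?w) = act g v"
    using nxt_act[OF g(1)] v nxt_closed sw by auto
  then have "{act g v, act g ?w} = {v, ?w}" using unique[of "act g v"] act_closed[OF g(1) v] by simp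
  then show False using g(2) by simp
qed

text \<open>By \<open>no_swap\<close> the flow never turns back, so a flow line is a reduced path
  and hence a geodesic.\<close>

lemma tdist_iter: "x \<in> V \<Longrightarrow> tdist x ((nxt ^^ k) x) = k"
proof (induction k)
  case (Suc k)
  let ?y = "(nxt ^^ k) x"
  have y: "?y \<in> V" "adj ?y (nxt ?y)" using iter_closed nxt_adj Suc.prems by auto
  have d: "tdist x ?y = k" using Suc by blast
  have "tdist x ?y \<noteq> Suc (tdist x (nxt ?y))"
  proof
    assume *: "tdist x ?y = Suc (tdist x (nxt ?y))"
    have n1: "step ?y x = nxt ?y" using step_eqI[OF Suc.prems y(2) *] .
    obtain j where j: "k = Suc j" using * d by (cases k) auto
    let ?z = "(nxt ^^ j) x"
    have z: "?z \<in> V" "?y = nxt ?z" using iter_closed Suc.prems j by auto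
    have adjz: "adj ?y ?z" using nxt_adj[OF z(1)] z(2) adj_sym by simp
    have "tdist x ?z = j \<or> Suc (tdist x ?y) = tdist x ?z"
      using tdist_adj[OF Suc.prems adjz] d j by auto
    moreover have "tdist x ?z \<noteq> Suc (tdist x ?y)"
    proof
      assume "tdist x ?z = Suc (tdist x ?y)"
      moreover have "tdist x ?z \<le> j"
        unfolding j
      proof (induction j)
        case (Suc i)
        then show ?case
          using tdist_triangle_adj(1)[OF \<open>x \<in> V\<close> nxt_adj[OF iter_closed[OF \<open>x \<in> V\<close>, of i]]] by simp
      qed (simp add: tdist_self[OF Suc.prems])
      ultimately show False using d j by simp
    qed
    ultimately have "tdist x ?z = j" by auto
    then have "step ?y x = ?z" using step_eqI[OF Suc.prems adjz] d j by simp
    then show False using n1 z no_swap[OF z(1)] by simp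
  qed
  then show ?case using tdist_adj[OF Suc.prems y(2)] d by auto
qed (simp add: tdist_self)

text \<open>Each edge of the geodesic from \<open>w\<close> to \<open>u\<close> joins a vertex to
  its image under \<open>nxt\<close>, so the flow lines of neighbours merge.\<close>

lemma confluent:
  assumes "u \<in> V" "w \<in> V" shows "\<exists>i j. (nxt ^^ i) u = (nxt ^^ j) w"
  using assms
proof (induction rule: geodesic_induct)
  case refl
  show ?case by blast
next
  case (step w)
  let ?y = "step w u"
  obtain i j where ij: "(nxt ^^ i) u = (nxt ^^ j) ?y" using step.IH by blast
  from edge_oriented[OF step_props(1)[OF assms(1) step(1,2)]] show ?case
  proof
    assume "nxt w = ?y"
    then have "(nxt ^^ i) u = (nxt ^^ Suc j) w" using ij by (simp add: funpow_swap1)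
    then show ?case by blast
  next
    assume n: "nxt ?y = w"
    show ?case
    proof (cases j)
      case 0
      then have "(nxt ^^ Suc i) u = (nxt ^^ 0) w" using ij n by simp
      then show ?thesis by blast
    next
      case (Suc j')
      then have "(nxt ^^ i) u = (nxt ^^ j') w" using ij n by (simp add: funpow_swap1)
      then show ?thesis by blast
    qed
  qed
qed

text \<open>The paths from \<open>v\<close> and from \<open>\<beta> v\<close> along \<open>nxt\<close> merge. As \<open>\<beta>\<close> commutes with \<open>nxt\<close>, the point where
  they merge is moved by \<open>\<beta>\<close> along its own path; such points form an invariant subtree.\<close>

lemma on_axis:
  assumes "u \<in> V" shows "\<exists>k. (nxt ^^ k) u = \<beta> u"
proof -
  define A where "A = {u \<in> V. \<exists>k. (nxt ^^ k) u = \<beta> u}"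
  have nonempty: "A \<noteq> {}"
  proof -
    obtain v where v: "v \<in> V" using V_nonempty by blast
    obtain i j where ij: "(nxt ^^ i) v = (nxt ^^ j) (\<beta> v)" using confluent[OF v \<beta>_closed[OF v]] by blast
    show ?thesis
    proof (cases "j \<le> i")
      case True
      let ?u = "(nxt ^^ j) v"
      have "(nxt ^^ (i - j)) ?u = (nxt ^^ i) v"
        using True by (metis comp_apply funpow_add le_add_diff_inverse2)
      then have "(nxt ^^ (i - j)) ?u = \<beta> ?u" using ij iter_\<beta>[OF v] by simp
      then show ?thesis using iter_closed[OF v] unfolding A_def by blast
    next
      \<comment> \<open>Here the flow line of \<open>\<beta> ?u\<close> runs through
        \<open>?u\<close>. As it is a geodesic, \<open>nxt ?u\<close> points back along its last
        edge, which is then swapped.\<close>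
      case False
      let ?u = "(nxt ^^ i) v"
      obtain k where k: "j = Suc k + i" using False by (metis add.commute less_natE not_le add_Suc_right)
      let ?y = "(nxt ^^ k) (\<beta> ?u)"
      have u: "?u \<in> V" "\<beta> ?u \<in> V" using iter_closed \<beta>_closed v by auto
      have y: "?y \<in> V" using iter_closed u by blast
      have "(nxt ^^ Suc k) (\<beta> ?u) = ?u"
        using ij unfolding k funpow_add iter_\<beta>[OF v, symmetric] by simp
      then have ny: "nxt ?y = ?u" by simp
      have "tdist (\<beta> ?u) ?u = Suc (tdist (\<beta> ?u) ?y)"
        using tdist_iter[OF u(2), of "Suc k"] tdist_iter[OF u(2), of k] ny by simp
      moreover have "adj ?u ?y" using nxt_adj[OF y] ny adj_sym by simp
      ultimately have "nxt ?u = ?y" using step_eqI[OF u(2)] by (simp add: nxt_def)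
      then show ?thesis using no_swap[OF u(1)] ny by simp
    qed
  qed
  have A_nxt: "nxt u \<in> A" if u: "u \<in> A" for u
  proof -
    obtain k where "u \<in> V" "(nxt ^^ k) u = \<beta> u" using u by (auto simp: A_def)
    then have "(nxt ^^ k) (nxt u) = \<beta> (nxt u)"
      using nxt_\<beta>[of u] by (simp flip: funpow_swap1)
    then show ?thesis using nxt_closed \<open>u \<in> V\<close> unfolding A_def by blast
  qed
  \<comment> \<open>Within \<open>A\<close> two points are joined through the vertex where their
    flow lines merge.\<close>
  define r where "r = {(x, y). adj x y \<and> x \<in> A \<and> y \<in> A}"
  have chain: "(u, (nxt ^^ k) u) \<in> r\<^sup>* \<and> ((nxt ^^ k) u, u) \<in> r\<^sup>* \<and> (nxt ^^ k) u \<in> A" if "u \<in> A" for u k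
  proof (induction k)
    case (Suc k)
    let ?y = "(nxt ^^ k) u"
    have "?y \<in> V" using Suc by (simp add: A_def)
    then have "(?y, nxt ?y) \<in> r" "(nxt ?y, ?y) \<in> r"
      using nxt_adj adj_sym A_nxt Suc by (auto simp: r_def)
    then show ?case using Suc A_nxt
      by (auto intro: rtrancl_into_rtrancl converse_rtrancl_into_rtrancl)
  qed (use that in simp)
  have "convex A"
  proof (rule convexI[where r = r])
    show "A \<subseteq> V" by (auto simp: A_def)
    fix u w assume uw: "u \<in> A" "w \<in> A"
    then obtain i j where "(nxt ^^ i) u = (nxt ^^ j) w" using confluent[of u w] by (auto simp: A_def)
    then show "(u, w) \<in> r\<^sup>*" using chain[OF uw(1), of i] chain[OF uw(2), of j] by (metis rtrancl_trans)
  qed (auto simp: r_def)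
  moreover have "act g u \<in> A" if g: "g \<in> carrier G" and u: "u \<in> A" for g u
  proof -
    obtain k where "u \<in> V" "(nxt ^^ k) u = \<beta> u" using u by (auto simp: A_def)
    then have "(nxt ^^ k) (act g u) = \<beta> (act g u)" using g by (simp add: iter_act \<beta>_act)
    then show ?thesis using act_closed g \<open>u \<in> V\<close> unfolding A_def by blast
  qed
  ultimately have "inv_subtree (carrier G) A" using nonempty by (auto simp: inv_subtree_def)
  then have "A = V" by (rule minimal)
  then show ?thesis using assms by (auto simp: A_def)
qed

text \<open>Both images under \<open>\<beta>\<close> lie ahead, on the flow line of the common
  vertex \<open>nxt u\<close>. If \<open>\<beta> u'\<close> comes \<open>m\<close> steps after
  \<open>\<beta> u\<close>, then \<open>u' = (nxt ^^ m) u\<close>, so \<open>nxt u\<close> returns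
  to itself after \<open>m\<close> steps; on a geodesic \<open>m = 0\<close>.\<close>

lemma nxt_inj:
  assumes "u \<in> V" "u' \<in> V" "nxt u = nxt u'" shows "u = u'"
proof -
  have *: "u = u'"
    if V: "u \<in> V" "u' \<in> V" and eq: "nxt u = nxt u'" and k: "(nxt ^^ Suc k) u = \<beta> u"
      "(nxt ^^ (m + Suc k)) u' = \<beta> u'" for u u' k m
  proof -
    have "\<beta> u' = (nxt ^^ (m + k)) (nxt u)" using k(2) eq by (simp add: funpow_swap1)
    also have "\<dots> = (nxt ^^ m) ((nxt ^^ Suc k) u)" by (simp add: funpow_add funpow_swap1)
    finally have "\<beta> u' = \<beta> ((nxt ^^ m) u)" using k(1) iter_\<beta>[OF V(1)] by simp
    then have u': "u' = (nxt ^^ m) u"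
      using \<beta>_aut V iter_closed[OF V(1)] by (auto simp: tree_aut_def inj_on_def)
    then have "(nxt ^^ m) (nxt u) = nxt u" using eq by (simp add: funpow_swap1)
    then have "m = 0" using tdist_iter[OF nxt_closed[OF V(1)], of m] tdist_self nxt_closed[OF V(1)] by simp
    then show ?thesis using u' by simp
  qed
  obtain k where k: "(nxt ^^ k) u = \<beta> u" using on_axis assms(1) by blast
  obtain k' where k': "(nxt ^^ k') u' = \<beta> u'" using on_axis assms(2) by blast
  have "k \<noteq> 0" "k' \<noteq> 0" using k k' \<beta>_moves[OF assms(1)] \<beta>_moves[OF assms(2)] by (cases k; cases k'; auto)+
  then obtain i i' where i: "k = Suc i" "k' = Suc i'" by (metis not0_implies_Suc)
  show ?thesis
  proof (cases "i \<le> i'")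
    case True
    then have "k' = (i' - i) + Suc i" using i by simp
    then show ?thesis using *[OF assms, of i "i' - i"] k k' i(1) by metis
  next
    case False
    then have "k = (i - i') + Suc i'" using i by simp
    then show ?thesis using *[OF assms(2,1) assms(3)[symmetric], of i' "i - i'"] k k' i(2) by metis
  qed
qed

lemma iter_inj: "u \<in> V \<Longrightarrow> u' \<in> V \<Longrightarrow> (nxt ^^ k) u = (nxt ^^ k) u' \<Longrightarrow> u = u'"
  by (induction k) (auto dest: nxt_inj[rotated 2] simp: iter_closed)

text \<open>Injectivity of \<open>nxt\<close> cancels the common part of two merging flow lines: the
  vertices form one line.\<close>

lemma comparable:
  assumes "u \<in> V" "w \<in> V" shows "\<exists>k. w = (nxt ^^ k) u \<or> u = (nxt ^^ k) w"
proof -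
  obtain i j where ij: "(nxt ^^ i) u = (nxt ^^ j) w" using confluent assms by blast
  show ?thesis
  proof (cases "i \<le> j")
    case True
    then have "j = i + (j - i)" by simp
    then have "(nxt ^^ i) u = (nxt ^^ i) ((nxt ^^ (j - i)) w)" using ij by (metis comp_apply funpow_add)
    then show ?thesis using iter_inj iter_closed assms by blast
  next
    case False
    then have "i = j + (i - j)" by simp
    then have "(nxt ^^ j) w = (nxt ^^ j) ((nxt ^^ (i - j)) u)" using ij by (metis comp_apply funpow_add)
    then show ?thesis using iter_inj iter_closed assms by blast
  qed
qed

text \<open>On this line each element acts at \<open>v\<close> as a forward or backward iterate of
  \<open>nxt\<close>, and iterates of \<open>nxt\<close> commute with each other and with the
  action. The four cases are the choices of direction.\<close>

lemma act_commute:
  assumes x: "x \<in> carrier G" and y: "y \<in> carrier G" and v: "v \<in> V"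
  shows "act x (act y v) = act y (act x v)"
proof -
  have comm: "(nxt ^^ k) ((nxt ^^ l) u) = (nxt ^^ l) ((nxt ^^ k) u)" for k l u
    by (metis add.commute comp_apply funpow_add)
  have V: "act x v \<in> V" "act y v \<in> V" "act x (act y v) \<in> V" "act y (act x v) \<in> V"
    using act_closed x y v by auto
  obtain k where k: "act x v = (nxt ^^ k) v \<or> v = (nxt ^^ k) (act x v)" using comparable[OF v V(1)] by blast
  obtain l where l: "act y v = (nxt ^^ l) v \<or> v = (nxt ^^ l) (act y v)" using comparable[OF v V(2)] by blast
  note ix = iter_act[OF x] and iy = iter_act[OF y]
  from k l show ?thesis
  proof (elim disjE)
    assume k: "act x v = (nxt ^^ k) v" and l: "act y v = (nxt ^^ l) v"
    show ?thesis using ix[OF v, of l] iy[OF v, of k] comm k l by metis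
  next
    assume k: "act x v = (nxt ^^ k) v" and l: "v = (nxt ^^ l) (act y v)"
    have "(nxt ^^ l) (act x (act y v)) = act x v" using ix[OF V(2), of l] l by simp
    moreover have "(nxt ^^ l) (act y (act x v)) = (nxt ^^ l) ((nxt ^^ k) (act y v))"
      using iy[OF v, of k] k by simp
    then have "(nxt ^^ l) (act y (act x v)) = act x v" using comm l k by metis
    ultimately show ?thesis using iter_inj[OF V(3,4)] by metis
  next
    assume k: "v = (nxt ^^ k) (act x v)" and l: "act y v = (nxt ^^ l) v"
    have "(nxt ^^ k) (act y (act x v)) = act y v" using iy[OF V(1), of k] k by simp
    moreover have "(nxt ^^ k) (act x (act y v)) = (nxt ^^ k) ((nxt ^^ l) (act x v))"
      using ix[OF v, of l] l by simp
    then have "(nxt ^^ k) (act x (act y v)) = act y v" using comm l k by metis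
    ultimately show ?thesis using iter_inj[OF V(3,4)] by metis
  next
    assume k: "v = (nxt ^^ k) (act x v)" and l: "v = (nxt ^^ l) (act y v)"
    have "(nxt ^^ l) (act x (act y v)) = act x v" using ix[OF V(2), of l] l by simp
    then have "(nxt ^^ k) ((nxt ^^ l) (act x (act y v))) = v" using k by simp
    moreover have "(nxt ^^ k) (act y (act x v)) = act y v" using iy[OF V(1), of k] k by simp
    then have "(nxt ^^ l) ((nxt ^^ k) (act y (act x v))) = v" using l by simp
    ultimately have "(nxt ^^ (k + l)) (act x (act y v)) = (nxt ^^ (k + l)) (act y (act x v))"
      using comm by (simp add: funpow_add)
    then show ?thesis using iter_inj[OF V(3,4)] by blast
  qed
qed

end

locale free_tree_action = tree_action V E F act + based_free_group F S
  for V :: "'v set" and E and F (structure) and act S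
begin

text \<open>A nontrivial normal cyclic subgroup contains positive powers of \<open>x\<close> and of
  \<open>y\<close>. These commute, and \<open>commute_trans\<close> carries this first to
  \<open>x\<close> and then to \<open>y\<close>.\<close>

lemma kernel_trivial_or_abelian:
  assumes z: "z \<in> carrier F" and N: "subgroup N F" "N \<subseteq> generate F {z}" "N \<noteq> {\<one>}"
    and norm: "\<And>h n. h \<in> carrier F \<Longrightarrow> n \<in> N \<Longrightarrow> h \<otimes> n \<otimes> inv h \<in> N"
    and xy: "x \<in> carrier F" "y \<in> carrier F"
  shows "x \<otimes> y = y \<otimes> x"
proof (cases "x = \<one> \<or> y = \<one>")
  case False
  obtain a where a: "a \<in> N" "N = generate F {a}" using subgroup_of_cyclic[OF N(1) z N(2)] by blast
  have ac: "a \<in> carrier F" using a(1) N(1) subgroup.mem_carrier by metis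
  obtain k :: nat where k: "k > 0" "x [^] k \<in> N"
    using power_in_normal[of N "{a}" x] a(2) ac N(3) norm xy by auto
  obtain l :: nat where l: "l > 0" "y [^] l \<in> N"
    using power_in_normal[of N "{a}" y] a(2) ac N(3) norm xy by auto
  have ne: "x [^] k \<noteq> \<one>" "y [^] l \<noteq> \<one>" using torsion_free xy False k(1) l(1) by blast+
  have c: "x [^] k \<in> carrier F" "y [^] l \<in> carrier F" using xy by auto
  obtain i j :: int where "x [^] k = a [^] i" "y [^] l = a [^] j"
    using k(2) l(2) a(2) generate_pow[OF ac] by auto
  then have kl: "x [^] k \<otimes> y [^] l = y [^] l \<otimes> x [^] k"
    using ac by (simp add: int_pow_mult[symmetric] add.commute)
  have xk: "x [^] k \<otimes> x = x \<otimes> x [^] k" and yl: "y [^] l \<otimes> y = y \<otimes> y [^] l"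
    using nat_pow_Suc2[of x k] nat_pow_Suc2[of y l] xy by auto
  have "x \<otimes> y [^] l = y [^] l \<otimes> x" by (rule commute_trans[OF c(1) ne(1) xy(1) xk c(2) kl])
  then show ?thesis by (intro commute_trans[OF c(2) ne(2) xy(1) _ xy(2) yl]) simp
qed (use xy in auto)

lemma commuting_aut_trivial:
  assumes minimal: "\<And>M. inv_subtree (carrier F) M \<Longrightarrow> M = V"
    and no_inv_edge: "\<And>u v. adj u v \<Longrightarrow> \<exists>g\<in>carrier F. act g ` {u, v} \<noteq> {u, v}"
    and cyclic_stab: "\<And>u v. adj u v \<Longrightarrow>
      \<exists>z\<in>carrier F. {g \<in> carrier F. act g ` {u, v} = {u, v}} \<subseteq> generate F {z}"
    and noncyclic: "\<not> cyclic_group F"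
    and \<beta>: "tree_aut \<beta>" "\<And>g v. g \<in> carrier F \<Longrightarrow> v \<in> V \<Longrightarrow> \<beta> (act g v) = act g (\<beta> v)"
    and v: "v \<in> V"
  shows "\<beta> v = v"
proof (cases "\<exists>v\<in>V. \<beta> v = v")
  case True
  let ?Fix = "{v \<in> V. \<beta> v = v}"
  have "inv_subtree (carrier F) ?Fix"
    unfolding inv_subtree_def convex_def
  proof (intro conjI ballI impI)
    fix u w assume uw: "u \<in> ?Fix" "w \<in> ?Fix" "w \<noteq> u"
    then have "step (\<beta> w) (\<beta> u) = \<beta> (step w u)" using step_map[OF \<beta>(1)] by blast
    then show "step w u \<in> ?Fix" using uw step_in_V[of u w] by auto
  qed (use True \<beta>(2) act_closed in auto)
  then have "?Fix = V" by (rule minimal)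
  then show ?thesis using v by blast
next
  case False
  interpret displaced_tree_action V E F act \<beta>
    by unfold_locales (use \<beta> False minimal no_inv_edge in auto)
  obtain x y where xy: "x \<in> carrier F" "y \<in> carrier F" "x \<otimes> y \<noteq> y \<otimes> x"
    using noncyclic_nonabelian[OF noncyclic] by blast
  let ?N = "{g \<in> carrier F. \<forall>v\<in>V. act g v = v}"
  have N: "subgroup ?N F"
  proof (rule subgroupI)
    fix a assume "a \<in> ?N"
    then have a: "a \<in> carrier F" "\<And>v. v \<in> V \<Longrightarrow> act a v = v" by auto
    have "act (inv a) v = v" if "v \<in> V" for v using act_inv(1)[OF a(1) that] a(2)[OF that] by simp
    then show "inv a \<in> ?N" using a(1) by simp
  next
    show "?N \<noteq> {}" using act_one one_closed by blast
  qed (auto simp: act_mult)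
  obtain z where z: "z \<in> carrier F" "{g \<in> carrier F. act g ` {v, nxt v} = {v, nxt v}} \<subseteq> generate F {z}"
    using cyclic_stab[OF nxt_adj[OF v]] by blast
  have Nz: "?N \<subseteq> generate F {z}" using z(2) v nxt_closed by auto
  \<comment> \<open>This commutator acts trivially by \<open>act_commute\<close>, so the kernel
    \<open>?N\<close> of the action is nontrivial. It lies in a cyclic group because it lies in an
    edge stabiliser.\<close>
  let ?c = "x \<otimes> y \<otimes> inv (y \<otimes> x)"
  have "act ?c u = u" if u: "u \<in> V" for u
  proof -
    let ?u = "act (inv (y \<otimes> x)) u"
    have u': "?u \<in> V" using act_closed xy u by simp
    have "act ?c u = act x (act y ?u)" using xy u u' by (simp add: act_mult)
    also have "\<dots> = act (y \<otimes> x) ?u" using act_commute[OF xy(1,2) u'] xy u' by (simp add: act_mult)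
    also have "\<dots> = u" using act_inv(2)[of "y \<otimes> x" u] xy u by simp
    finally show ?thesis .
  qed
  then have "?c \<in> ?N" using xy by simp
  moreover have "?c \<noteq> \<one>"
  proof
    assume "?c = \<one>"
    then have "inv (inv (y \<otimes> x)) = x \<otimes> y" using xy by (intro inv_equality) auto
    then show False using xy by simp
  qed
  ultimately have "?N \<noteq> {\<one>}" by blast
  moreover have "h \<otimes> n \<otimes> inv h \<in> ?N" if "h \<in> carrier F" "n \<in> ?N" for h n
    using that act_closed act_inv(2) by (auto simp: act_mult)
  ultimately show ?thesis using kernel_trivial_or_abelian[OF z(1) N Nz] xy by blast
qed

end


section \<open>Splittings of the mapping torus\<close>

context tree_action
begin

section \<open>Edges and minimality in a tree action\<close>

lemma act_image:
  assumes "g \<in> carrier G" "e \<subseteq> V"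
  shows "h \<in> carrier G \<Longrightarrow> act (h \<otimes> g) ` e = act h ` act g ` e"
    and "act (inv g) ` act g ` e = e" "act g ` act (inv g) ` e = e"
  using assms by (auto simp: image_image act_mult act_inv subset_iff cong: image_cong_simp)

lemma edge_subset: assumes "e \<in> E" shows "e \<subseteq> V"
proof -
  obtain u v where "e = {u, v}" "adj u v" by (rule edgeE[OF assms])
  then show ?thesis using adjD(1,2)[of u v] by simp
qed

lemma act_edge: assumes "g \<in> carrier G" "e \<in> E" shows "act g ` e \<in> E"
proof -
  obtain u v where "e = {u, v}" "adj u v" by (rule edgeE[OF assms(2)])
  then show ?thesis using act_adj[OF assms(1), of u v] by simp
qed

lemma subgroup_edge_stab:
  assumes "e \<in> E" shows "subgroup {g \<in> carrier G. act g ` e = e} G"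
proof (rule subgroupI)
  note e = edge_subset[OF assms]
  show "{g \<in> carrier G. act g ` e = e} \<noteq> {}" using act_one e one_closed by force
  fix a assume "a \<in> {g \<in> carrier G. act g ` e = e}"
  then show "inv a \<in> {g \<in> carrier G. act g ` e = e}" using act_image(2)[of a e] e by auto
  fix b assume "b \<in> {g \<in> carrier G. act g ` e = e}"
  then show "a \<otimes> b \<in> {g \<in> carrier G. act g ` e = e}"
    using \<open>a \<in> {g \<in> carrier G. act g ` e = e}\<close> act_image(1)[of b e a] e by auto
qed auto

text \<open>Subtrees are convex sets with their induced edges. Inclusion of every translate in
  \<open>S\<close> amounts to equality, since the inverse element gives the other inclusion.\<close>

lemma minimal_iff:
  "(\<forall>V' E'. V' \<subseteq> V \<and> E' \<subseteq> E \<and> simplicial_tree V' E' \<and>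
      (\<forall>g\<in>carrier G. act g ` V' = V' \<and> (\<lambda>e. act g ` e) ` E' = E') \<longrightarrow> V' = V \<and> E' = E) \<longleftrightarrow>
   (\<forall>S. inv_subtree (carrier G) S \<longrightarrow> S = V)" (is "?L \<longleftrightarrow> ?R")
proof
  assume L: ?L
  show ?R
  proof (intro allI impI)
    fix S assume S: "inv_subtree (carrier G) S"
    then have SV: "S \<subseteq> V" "convex S" "S \<noteq> {}" by (auto simp: inv_subtree_def convex_def)
    have sub: "act g ` S \<subseteq> S" if "g \<in> carrier G" for g
      using S that by (auto simp: inv_subtree_def)
    have S_eq: "act g ` S = S" if g: "g \<in> carrier G" for g
    proof (rule equalityI[OF sub[OF g]])
      show "S \<subseteq> act g ` S"
        using image_mono[OF sub[OF inv_closed[OF g]], of "act g"] unfolding act_image(3)[OF g SV(1)] .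
    qed
    let ?E = "{e \<in> E. e \<subseteq> S}"
    have subE: "act g ` e \<in> ?E" if "g \<in> carrier G" "e \<in> ?E" for g e
      using that act_edge[of g e] sub[of g] by auto
    have E_eq: "(\<lambda>e. act g ` e) ` ?E = ?E" if g: "g \<in> carrier G" for g
    proof
      show "(\<lambda>e. act g ` e) ` ?E \<subseteq> ?E" by (rule image_subsetI) (rule subE[OF g])
      show "?E \<subseteq> (\<lambda>e. act g ` e) ` ?E"
      proof
        fix e assume e: "e \<in> ?E"
        then have "act g ` act (inv g) ` e = e" by (intro act_image(3)[OF g] edge_subset) simp
        then show "e \<in> (\<lambda>e. act g ` e) ` ?E" using imageI[OF subE[OF inv_closed[OF g] e], of "image (act g)"] by simp
      qed
    qed
    have "S = V \<and> ?E = E"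
      by (rule L[rule_format]) (intro conjI ballI SV(1) convex_subtree[OF SV(2,3)] S_eq E_eq, blast)
    then show "S = V" ..
  qed
next
  assume R: ?R
  show ?L
  proof (intro allI impI)
    fix V' E'
    assume A: "V' \<subseteq> V \<and> E' \<subseteq> E \<and> simplicial_tree V' E' \<and>
      (\<forall>g\<in>carrier G. act g ` V' = V' \<and> (\<lambda>e. act g ` e) ` E' = E')"
    then have c: "convex V'" "E' = {e \<in> E. e \<subseteq> V'}" using subtree_convex[of V' E'] by simp_all
    have "V' \<noteq> {}" using A by (simp add: simplicial_tree_def)
    moreover have "act g v \<in> V'" if "g \<in> carrier G" "v \<in> V'" for g v
      using A that by (metis imageI)
    ultimately have "inv_subtree (carrier G) V'" using c(1) by (simp add: inv_subtree_def)
    then have "V' = V" using R by blast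
    then show "V' = V \<and> E' = E" using c(2) edge_subset by auto
  qed
qed

end

lemma gtree_tree_action:
  assumes "group G" "is_gtree G T"
  shows "tree_action (tverts T) (tedges T) G (tact T)"
proof -
  interpret G: group G by fact
  have ga: "group_action G (tverts T) (tact T)" and tr: "simplicial_tree (tverts T) (tedges T)"
    and iso: "\<And>g. g \<in> carrier G \<Longrightarrow> simplicial_iso (tact T g) T T"
    using assms(2) by (auto simp: is_gtree_def)
  interpret ga: group_action G "tverts T" "tact T" by (rule ga)
  show ?thesis
  proof unfold_locales
    show "simplicial_tree (tverts T) (tedges T)" by (rule tr)
    show "tact T g v \<in> tverts T" if "g \<in> carrier G" "v \<in> tverts T" for g v
      using ga.element_image[OF that] by blast
    show "tact T (g \<otimes>\<^bsub>G\<^esub> h) v = tact T g (tact T h v)"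
      if "g \<in> carrier G" "h \<in> carrier G" "v \<in> tverts T" for g h v
      using ga.composition_rule[OF that(3,1,2)] .
    show "tact T \<one>\<^bsub>G\<^esub> v = v" if "v \<in> tverts T" for v
      using ga.id_eq_one that by (metis restrict_apply)
    show "{tact T g u, tact T g v} \<in> tedges T" if "g \<in> carrier G" "{u, v} \<in> tedges T" for g u v
    proof -
      have "tact T g ` {u, v} \<in> tedges T" using iso[OF that(1)] that(2) unfolding simplicial_iso_def by blast
      then show ?thesis by simp
    qed
  qed
qed

lemma edge_stabiliser_eq: "edge_stabiliser G T e = {g \<in> carrier G. tact T g ` e = e}"
  by (simp add: edge_stabiliser_def stabilizer_def)

section \<open>The mapping torus of a noncyclic free group and its fibre\<close>

locale free_by_cyclic = based_free_group F S for F :: "'a monoid" (structure) and S +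
  fixes \<Phi> :: "'a \<Rightarrow> 'a"
  assumes \<Phi>: "\<Phi> \<in> auto F"
    and fg: "finitely_generated_group F"
    and noncyclic: "\<not> cyclic_group F"
begin

abbreviation M :: "('a \<times> int) monoid" where "M \<equiv> mapping_torus F \<Phi>"

sublocale torus: group M
  by (rule group_mapping_torus[OF \<Phi>])

definition fibre :: "('a \<times> int) set" where
  "fibre = carrier F \<times> {0}"

lemma carrier_M: "carrier M = carrier F \<times> UNIV"
  by (simp add: mapping_torus_def)

lemma mult_M: "(x, m) \<otimes>\<^bsub>M\<^esub> (y, n) = (x \<otimes> (\<Phi> [^]\<^bsub>AutoGroup F\<^esub> m) y, m + n)"
  by (simp add: mapping_torus_def)

lemma one_M: "\<one>\<^bsub>M\<^esub> = (\<one>, 0)"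
  by (simp add: mapping_torus_def)

lemma snd_mult_M [simp]: "snd (g \<otimes>\<^bsub>M\<^esub> h) = snd g + snd h"
  by (cases g; cases h) (simp add: mult_M)

lemma snd_additive: "additive_on M H snd"
  by (simp add: additive_on_def)

lemma fibre_mult: "x \<in> carrier F \<Longrightarrow> y \<in> carrier F \<Longrightarrow> (x, 0) \<otimes>\<^bsub>M\<^esub> (y, n) = (x \<otimes> y, n)"
  by (simp add: mult_M one_AutoGroup_apply)

sublocale incl: group_hom F M "\<lambda>x. (x, 0)"
  by unfold_locales (rule mapping_torus_inclusion[OF \<Phi>])

declare incl.hom_one [simp del] incl.hom_mult [simp del] incl.hom_inv [simp del]

lemma fibre_inv: "x \<in> carrier F \<Longrightarrow> inv\<^bsub>M\<^esub> (x, 0) = (inv x, 0)"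
  using incl.hom_inv[of x] by simp

lemma snd_inv_M: "g \<in> carrier M \<Longrightarrow> snd (inv\<^bsub>M\<^esub> g) = - snd g"
  using torus.additive_on_props(2)[OF torus.subgroup_self snd_additive] .

lemma fibre_carrier: "fibre \<subseteq> carrier M"
  by (auto simp: fibre_def carrier_M)

lemma fibreI: "g \<in> carrier M \<Longrightarrow> snd g = 0 \<Longrightarrow> g \<in> fibre"
  by (cases g) (simp add: fibre_def carrier_M)

lemma fibre_conj: "g \<in> carrier M \<Longrightarrow> h \<in> fibre \<Longrightarrow> inv\<^bsub>M\<^esub> g \<otimes>\<^bsub>M\<^esub> h \<otimes>\<^bsub>M\<^esub> g \<in> fibre"
  using fibre_carrier by (intro fibreI) (auto simp: snd_inv_M fibre_def)

lemma stable_letter: "(\<one>, 1) \<in> carrier M" "(\<one>, -1) \<in> carrier M"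
  by (simp_all add: carrier_M)

lemma stable_letter_mult: "(\<one>, m) \<otimes>\<^bsub>M\<^esub> (\<one>, n) = (\<one>, m + n)"
  by (simp add: mult_M auto_one[OF auto_pow_closed[OF \<Phi>]])

lemma stable_letter_conj: "x \<in> carrier F \<Longrightarrow> (\<one>, 1) \<otimes>\<^bsub>M\<^esub> (x, 0) = (\<Phi> x, 0) \<otimes>\<^bsub>M\<^esub> (\<one>, 1)"
  by (simp add: mult_M auto_pow_1 \<Phi> one_AutoGroup_apply auto_mem)

lemma fibre_generated: "\<exists>T. finite T \<and> T \<subseteq> carrier M \<and> fibre = generate M T"
proof -
  obtain T where T: "finite T" "T \<subseteq> carrier F" "generate F T = carrier F"
    using fg by (auto simp: finitely_generated_group_def)
  have "generate M ((\<lambda>x. (x, 0)) ` T) = fibre"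
    using incl.generate_img[OF T(2)] T(3) by (auto simp: fibre_def)
  then show ?thesis using T by (intro exI[of _ "(\<lambda>x. (x, 0)) ` T"]) (auto simp: carrier_M)
qed

text \<open>Each element is a fibre element times a power of the stable letter. A property that
  defines a subgroup can thus be checked on the fibre and the stable letter.\<close>

lemma torus_generated:
  assumes C: "subgroup C M" and "fibre \<subseteq> C" "(\<one>, 1) \<in> C"
  shows "C = carrier M"
proof
  show "C \<subseteq> carrier M" using subgroup.subset[OF C] .
  have inv_t: "inv\<^bsub>M\<^esub> (\<one>, 1) = (\<one>, -1)"
  proof (rule torus.inv_equality)
    show "(\<one>, -1) \<otimes>\<^bsub>M\<^esub> (\<one>, 1) = \<one>\<^bsub>M\<^esub>"
      unfolding stable_letter_mult one_M by simp
  qed (rule stable_letter)+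
  have t: "(\<one>, n) \<in> C" for n :: int
  proof (induction n rule: int_induct[where k = 0])
    case base
    show ?case using subgroup.one_closed[OF C] by (simp add: one_M)
  next
    case (step1 i)
    then have "(\<one>, i) \<otimes>\<^bsub>M\<^esub> (\<one>, 1) \<in> C" using subgroup.m_closed[OF C] assms(3) by blast
    then show ?case by (simp add: stable_letter_mult)
  next
    case (step2 i)
    then have "(\<one>, i) \<otimes>\<^bsub>M\<^esub> (\<one>, -1) \<in> C"
      using subgroup.m_closed[OF C _ subgroup.m_inv_closed[OF C assms(3)]] inv_t by simp
    then show ?case by (simp add: stable_letter_mult)
  qed
  show "carrier M \<subseteq> C"
  proof
    fix g assume "g \<in> carrier M"
    then obtain x n where g: "g = (x, n)" "x \<in> carrier F" by (auto simp: carrier_M)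
    have "(x, 0) \<otimes>\<^bsub>M\<^esub> (\<one>, n) \<in> C" using subgroup.m_closed[OF C] assms(2) t g by (auto simp: fibre_def)
    then show "g \<in> C" using g by (simp add: fibre_mult)
  qed
qed

lemma fibre_slice_subgroup:
  assumes "subgroup K M" shows "subgroup {x \<in> carrier F. (x, 0) \<in> K} F"
proof (rule subgroupI)
  interpret K: subgroup K M by (rule assms)
  show "{x \<in> carrier F. (x, 0) \<in> K} \<noteq> {}" using K.one_closed one_M by auto
  fix a assume a: "a \<in> {x \<in> carrier F. (x, 0) \<in> K}"
  then show "inv a \<in> {x \<in> carrier F. (x, 0) \<in> K}" using K.m_inv_closed fibre_inv by fastforce
  fix b assume "b \<in> {x \<in> carrier F. (x, 0) \<in> K}"
  then show "a \<otimes> b \<in> {x \<in> carrier F. (x, 0) \<in> K}"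
    using a K.m_closed[of "(a, 0)" "(b, 0)"] by (simp add: fibre_mult)
qed auto

text \<open>Subgroups of the slice embed as subgroups of \<open>K\<close>, so the slice is slender,
  and slender subgroups of a free group are cyclic.\<close>

lemma fibre_slice_cyclic:
  assumes K: "subgroup K M" and slender: "slender_group (M\<lparr>carrier := K\<rparr>)"
  shows "cyclic_group (F\<lparr>carrier := {x \<in> carrier F. (x, 0) \<in> K}\<rparr>)"
proof (rule slender_imp_cyclic)
  let ?K = "{x \<in> carrier F. (x, 0) \<in> K}"
  show sub: "subgroup ?K F" by (rule fibre_slice_subgroup[OF K])
  have "\<exists>T. finite T \<and> T \<subseteq> L \<and> generate F T = L" if L: "subgroup L F" "L \<subseteq> ?K" for L
  proof -
    have "subgroup ((\<lambda>x. (x, 0)) ` L) M" using incl.subgroup_img_is_subgroup[OF L(1)] .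
    moreover have "(\<lambda>x. (x, 0)) ` L \<subseteq> K" using L(2) by auto
    ultimately obtain T' where T': "finite T'" "T' \<subseteq> (\<lambda>x. (x, 0)) ` L" "generate M T' = (\<lambda>x. (x, 0)) ` L"
      using slender torus.slender_subgroup_iff[OF K] by blast
    obtain T where T: "T \<subseteq> L" "T' = (\<lambda>x. (x, 0)) ` T" using T'(2) by (auto simp: subset_image_iff)
    have inj: "inj (\<lambda>x::'a. (x, 0::int))" by (simp add: inj_def)
    have "(\<lambda>x. (x, 0)) ` generate F T = (\<lambda>x. (x, 0)) ` L"
      using incl.generate_img[of T] T T'(3) L by auto
    then have "generate F T = L" by (rule inj_image_eq_iff[OF inj, THEN iffD1])
    moreover have "finite T"
      using T'(1) unfolding T(2) by (rule finite_imageD) (rule inj_on_subset[OF inj subset_UNIV])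
    ultimately show ?thesis using T(1) by blast
  qed
  then show "slender_group (F\<lparr>carrier := ?K\<rparr>)" using slender_subgroup_iff[OF sub] by blast
qed

section \<open>Restricting an action to the fibre\<close>

lemma restrict_simps [simp]:
  "tverts (restrict_to_fibre F T) = tverts T" "tedges (restrict_to_fibre F T) = tedges T"
  "x \<in> carrier F \<Longrightarrow> tact (restrict_to_fibre F T) x = tact T (x, 0)"
  by (simp_all add: restrict_to_fibre_def)

lemma restrict_is_gtree:
  assumes "is_gtree M T" shows "is_gtree F (restrict_to_fibre F T)"
proof -
  interpret ga: group_action M "tverts T" "tact T" using assms by (simp add: is_gtree_def)
  interpret gh: group_hom M "BijGroup (tverts T)" "tact T" by (rule ga.group_hom)
  have "group_action F (tverts T) (tact (restrict_to_fibre F T))"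
  proof (intro group_action.intro group_hom.intro group_hom_axioms.intro homI)
    show "group F" "group (BijGroup (tverts T))" by (rule is_group, rule group_BijGroup)
    fix x y assume xy: "x \<in> carrier F" "y \<in> carrier F"
    then show "tact (restrict_to_fibre F T) x \<in> carrier (BijGroup (tverts T))"
      using gh.hom_closed[of "(x, 0)"] by (simp add: carrier_M)
    show "tact (restrict_to_fibre F T) (x \<otimes> y) =
      tact (restrict_to_fibre F T) x \<otimes>\<^bsub>BijGroup (tverts T)\<^esub> tact (restrict_to_fibre F T) y"
      using gh.hom_mult[of "(x, 0)" "(y, 0)"] xy by (simp add: carrier_M fibre_mult)
  qed
  moreover have "tact (restrict_to_fibre F T) \<in> extensional (carrier F)"
    by (simp add: restrict_to_fibre_def)
  moreover have "simplicial_iso (tact (restrict_to_fibre F T) x) (restrict_to_fibre F T) (restrict_to_fibre F T)"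
    if "x \<in> carrier F" for x
    using assms that by (simp add: is_gtree_def simplicial_iso_def carrier_M)
  ultimately show ?thesis using assms by (simp add: is_gtree_def)
qed

lemma edge_stabiliser_restrict:
  "edge_stabiliser F (restrict_to_fibre F T) e = {x \<in> carrier F. (x, 0) \<in> edge_stabiliser M T e}"
  by (auto simp: edge_stabiliser_eq carrier_M)

end

locale slender_torus_splitting = free_by_cyclic F S \<Phi>
  for F :: "'a monoid" (structure) and S \<Phi> +
  fixes T :: "('a \<times> int, 'v) gtree"
  assumes splitting: "splitting slender_group (mapping_torus F \<Phi>) T"
begin

abbreviation "R \<equiv> restrict_to_fibre F T"

lemma gtree: "is_gtree M T" and min: "minimal_gtree M T" and nontriv: "nontrivial_gtree M T"
  and slender_stab: "e \<in> tedges T \<Longrightarrow> slender_group (M\<lparr>carrier := edge_stabiliser M T e\<rparr>)"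
  using splitting by (auto simp: splitting_def)

sublocale A: tree_action "tverts T" "tedges T" M "tact T"
  by (rule gtree_tree_action[OF torus.is_group gtree])

sublocale B: free_tree_action "tverts T" "tedges T" F "tact R" S
proof -
  interpret tree_action "tverts T" "tedges T" F "tact R"
    using gtree_tree_action[OF is_group restrict_is_gtree[OF gtree]] by simp
  show "free_tree_action (tverts T) (tedges T) F (tact R) S" by unfold_locales
qed

lemma subgroup_stab: "e \<in> tedges T \<Longrightarrow> subgroup (edge_stabiliser M T e) M"
  using A.subgroup_edge_stab by (simp add: edge_stabiliser_eq)

lemma stab_cyclic: "e \<in> tedges T \<Longrightarrow> cyclic_group (F\<lparr>carrier := edge_stabiliser F R e\<rparr>)"
  using fibre_slice_cyclic[OF subgroup_stab slender_stab] by (simp add: edge_stabiliser_restrict)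

lemma fibre_not_in_stab:
  assumes "e \<in> tedges T" shows "edge_stabiliser F R e \<noteq> carrier F"
  using stab_cyclic[OF assms] noncyclic by auto

lemma edge_exists: "\<exists>u v. A.adj u v"
proof -
  obtain v where v: "v \<in> tverts T" using A.V_nonempty by blast
  then have "{g \<in> carrier M. tact T g v = v} \<noteq> carrier M"
    using nontriv by (simp add: nontrivial_gtree_def stabilizer_def)
  then obtain g where g: "g \<in> carrier M" "tact T g v \<noteq> v" by blast
  then have "A.adj v (A.step v (tact T g v))"
    using A.step_props(1)[OF A.act_closed[OF g(1) v] v] by metis
  then show ?thesis by blast
qed

lemma M_minimal: "A.inv_subtree (carrier M) N \<Longrightarrow> N = tverts T"
  using min A.minimal_iff unfolding minimal_gtree_def by blast

lemma fibre_fixes_no_vertex: "\<not> A.fixes_vertex fibre"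
proof
  assume fixed: "A.fixes_vertex fibre"
  let ?N = "{v \<in> tverts T. \<forall>h\<in>fibre. tact T h v = v}"
  have "A.inv_subtree (carrier M) ?N"
    unfolding A.inv_subtree_def A.convex_def
  proof (intro conjI ballI impI)
    show "?N \<noteq> {}" using fixed by (auto simp: A.fixes_vertex_def)
  next
    fix u w assume uw: "u \<in> ?N" "w \<in> ?N" "w \<noteq> u"
    have "tact T h (A.step w u) = A.step w u" if "h \<in> fibre" for h
    proof -
      have "h \<in> carrier M" using that fibre_carrier by blast
      then have "A.step (tact T h w) (tact T h u) = tact T h (A.step w u)" using A.act_step uw by blast
      then show ?thesis using uw that by auto
    qed
    then show "A.step w u \<in> ?N" using A.step_in_V uw by blast
  next
    fix g v assume g: "g \<in> carrier M" and v: "v \<in> ?N"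
    have "tact T h (tact T g v) = tact T g v" if h: "h \<in> fibre" for h
    proof -
      have hc: "h \<in> carrier M" using h fibre_carrier by blast
      have "tact T h (tact T g v) = tact T g (tact T (inv\<^bsub>M\<^esub> g \<otimes>\<^bsub>M\<^esub> h \<otimes>\<^bsub>M\<^esub> g) v)"
        using g hc v by (simp add: A.act_mult A.act_inv A.act_closed)
      then show ?thesis using v fibre_conj[OF g h] by simp
    qed
    then show "tact T g v \<in> ?N" using A.act_closed g v by blast
  qed auto
  then have all: "?N = tverts T" by (rule M_minimal)
  obtain u v where uv: "A.adj u v" using edge_exists by blast
  have "u \<in> ?N" "v \<in> ?N" using all A.adjD(1,2)[OF uv] by simp_all
  then have "tact T h ` {u, v} = {u, v}" if "h \<in> fibre" for h using that by simp
  then have "edge_stabiliser F R {u, v} = carrier F"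
    unfolding edge_stabiliser_restrict by (auto simp: edge_stabiliser_eq fibre_def carrier_M)
  then show False using fibre_not_in_stab[OF uv] by blast
qed

lemma fibre_minimal_cocompact:
  obtains K where "finite K" "K \<subseteq> tverts T"
    "\<And>a b. A.adj a b \<Longrightarrow> \<exists>h\<in>fibre. \<exists>k\<in>K. \<exists>l\<in>K. a = tact T h k \<and> b = tact T h l"
    "\<And>N. A.inv_subtree fibre N \<Longrightarrow> N = tverts T"
proof -
  obtain X where X: "fibre = generate M X" "finite X" "X \<subseteq> carrier M" using fibre_generated by blast
  show thesis
  proof (rule A.least_inv_subtree[OF X fibre_fixes_no_vertex])
    fix N K assume N: "A.inv_subtree fibre N" and least: "\<And>N'. A.inv_subtree fibre N' \<Longrightarrow> N \<subseteq> N'"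
      and K: "finite K" "K \<subseteq> tverts T"
      and edges: "\<And>a b. a \<in> N \<Longrightarrow> b \<in> N \<Longrightarrow> A.adj a b \<Longrightarrow>
        \<exists>h\<in>fibre. \<exists>k\<in>K. \<exists>l\<in>K. a = tact T h k \<and> b = tact T h l"
    have NV: "N \<subseteq> tverts T" "N \<noteq> {}" "A.convex N" using N by (auto simp: A.inv_subtree_def A.convex_def)
    have "tact T g v \<in> N" if g: "g \<in> carrier M" and v: "v \<in> N" for g v
    proof -
      have "A.inv_subtree fibre (tact T (inv\<^bsub>M\<^esub> g) ` N)"
        using g by (intro A.inv_subtree_image fibre_carrier N torus.inv_closed fibre_conj)
      then have "v \<in> tact T (inv\<^bsub>M\<^esub> g) ` N" using least v by blast
      then obtain m where m: "m \<in> N" "v = tact T (inv\<^bsub>M\<^esub> g) m" by blast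
      then have "tact T g v = m" using A.act_inv(2)[OF g] NV(1) by blast
      then show ?thesis using m by simp
    qed
    then have "A.inv_subtree (carrier M) N" using NV by (simp add: A.inv_subtree_def)
    then have NT: "N = tverts T" by (rule M_minimal)
    have "N' = tverts T" if "A.inv_subtree fibre N'" for N'
      using least[OF that] that NT by (auto simp: A.inv_subtree_def A.convex_def)
    moreover have "\<exists>h\<in>fibre. \<exists>k\<in>K. \<exists>l\<in>K. a = tact T h k \<and> b = tact T h l" if "A.adj a b" for a b
      using edges[OF _ _ that] A.adjD(1,2)[OF that] unfolding NT .
    ultimately show thesis by (intro that[OF K])
  qed
qed

lemma inv_subtree_fibre: "B.inv_subtree (carrier F) N \<longleftrightarrow> A.inv_subtree fibre N"
  by (auto simp: B.inv_subtree_def A.inv_subtree_def fibre_def)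

lemma F_minimal: "B.inv_subtree (carrier F) N \<Longrightarrow> N = tverts T"
  using fibre_minimal_cocompact inv_subtree_fibre by metis

text \<open>An edge invariant under \<open>F\<close> would by minimality be all of the tree; the
  mapping torus would then fix its midpoint.\<close>

lemma no_inv_edge:
  assumes "A.adj u v" shows "\<exists>x\<in>carrier F. tact R x ` {u, v} \<noteq> {u, v}"
proof (rule ccontr)
  assume "\<not> ?thesis"
  then have inv: "tact R x ` {u, v} = {u, v}" if "x \<in> carrier F" for x using that by blast
  have "A.convex {u, v}"
    using A.adjD(1,2)[OF assms] A.step_adj[OF assms] A.step_adj[OF A.adj_sym[OF assms]]
    by (auto simp: A.convex_def)
  then have "B.inv_subtree (carrier F) {u, v}" using inv unfolding B.inv_subtree_def by blast
  then have V: "tverts T = {u, v}" using F_minimal by blast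
  have "tact T g ` {u, v} = {u, v}" if "g \<in> carrier M" for g
  proof -
    have "tact T g ` tverts T \<subseteq> tverts T" "tact T (inv\<^bsub>M\<^esub> g) ` tverts T \<subseteq> tverts T"
      using A.act_closed that by blast+
    then have "tact T g ` tverts T = tverts T"
      using A.act_image(3)[OF that, of "tverts T"] by blast
    then show ?thesis using V by simp
  qed
  then have "edge_stabiliser M T {u, v} = carrier M" by (auto simp: edge_stabiliser_eq)
  then show False using nontriv assms by (auto simp: nontrivial_gtree_def)
qed

lemma restrict_cyclic_splitting: "splitting cyclic_group F R"
  unfolding splitting_def
proof (intro conjI ballI)
  show "is_gtree F R" by (rule restrict_is_gtree[OF gtree])
  show "minimal_gtree F R"
    unfolding minimal_gtree_def restrict_simps B.minimal_iff using F_minimal by blast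
  show "nontrivial_gtree F R"
    unfolding nontrivial_gtree_def
  proof (intro conjI ballI notI)
    fix v assume v: "v \<in> tverts R" "stabilizer F (tact R) v = carrier F"
    have "tact T (x, 0) v = v" if "x \<in> carrier F" for x
    proof -
      have "x \<in> stabilizer F (tact R) v" using that v(2) by simp
      then show ?thesis using that by (simp add: stabilizer_def)
    qed
    then show False using fibre_fixes_no_vertex v by (auto simp: A.fixes_vertex_def fibre_def)
  next
    fix e assume e: "e \<in> tedges R" "edge_stabiliser F R e = carrier F"
    then show False using fibre_not_in_stab by simp
  qed
  show "cyclic_group (F\<lparr>carrier := edge_stabiliser F R e\<rparr>)" if "e \<in> tedges R" for e
    using stab_cyclic that by simp
qed

lemma restrict_fixed: "R \<in> fixed_gtrees F \<Phi>"
  unfolding fixed_gtrees_def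
proof (intro CollectI exI conjI ballI)
  show "simplicial_iso (tact T (\<one>, 1)) R R"
    using gtree stable_letter by (simp add: is_gtree_def simplicial_iso_def)
  fix x p assume x: "x \<in> carrier F" and p: "p \<in> tverts R"
  have c: "(x, 0) \<in> carrier M" "(\<Phi> x, 0) \<in> carrier M" "\<Phi> x \<in> carrier F"
    using x auto_mem[OF \<Phi>] by (auto simp: carrier_M)
  show "tact T (\<one>, 1) (tact R x p) = tact R (\<Phi> x) (tact T (\<one>, 1) p)"
    using x c p A.act_mult[of "(\<one>, 1)" "(x, 0)" p] A.act_mult[of "(\<Phi> x, 0)" "(\<one>, 1)" p]
      stable_letter_conj[OF x] stable_letter by simp
qed

text \<open>There are finitely many orbits of edges under the fibre, so some element outside the fibre
  fixes a given edge.\<close>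

lemma stab_leaves_fibre:
  assumes "A.adj u v" obtains g where "g \<in> edge_stabiliser M T {u, v}" "snd g \<noteq> 0"
proof -
  obtain K where K: "finite K" "K \<subseteq> tverts T"
    "\<And>a b. A.adj a b \<Longrightarrow> \<exists>h\<in>fibre. \<exists>k\<in>K. \<exists>l\<in>K. a = tact T h k \<and> b = tact T h l"
    using fibre_minimal_cocompact by metis
  let ?t = "\<lambda>i::nat. (\<one>, int i)"
  have t: "?t i \<in> carrier M" for i by (simp add: carrier_M)
  have "\<exists>h k l. h \<in> fibre \<and> (k, l) \<in> K \<times> K \<and> tact T (?t i) u = tact T h k \<and> tact T (?t i) v = tact T h l" for i
    using K(3)[OF A.act_adj[OF t assms]] by blast
  then obtain h k l where hkl: "\<And>i. h i \<in> fibre" "\<And>i. (k i, l i) \<in> K \<times> K"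
    "\<And>i. tact T (?t i) u = tact T (h i) (k i)" "\<And>i. tact T (?t i) v = tact T (h i) (l i)" by metis
  have "\<not> inj (\<lambda>i. (k i, l i))"
    using finite_subset[of "range (\<lambda>i. (k i, l i))" "K \<times> K"] K(1) hkl(2)
      finite_imageD[of "\<lambda>i. (k i, l i)" UNIV] by auto
  then obtain i j where ij: "i \<noteq> j" "k i = k j" "l i = l j" by (auto simp: inj_def)
  \<comment> \<open>The element \<open>s i\<close> carries the edge to its representative. Because
    ordered pairs of end points are recorded, equal representatives give an element fixing both
    ends, with integer part \<open>i - j\<close>.\<close>
  define s where "s i = inv\<^bsub>M\<^esub> (h i) \<otimes>\<^bsub>M\<^esub> ?t i" for i
  have hc: "h i \<in> carrier M" for i using hkl(1) fibre_carrier by blast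
  have sc: "s i \<in> carrier M" for i using hc t by (simp add: s_def)
  note V = A.adjD(1,2)[OF assms]
  have kV: "k i \<in> tverts T" "l i \<in> tverts T" for i using hkl(2)[of i] K(2) by auto
  have s: "tact T (s i) u = k i" "tact T (s i) v = l i" for i
    using A.act_mult[of "inv\<^bsub>M\<^esub> (h i)" "?t i"] hc t V hkl(3,4) A.act_inv(1)[OF hc] kV
    by (simp_all add: s_def)
  let ?g = "inv\<^bsub>M\<^esub> (s j) \<otimes>\<^bsub>M\<^esub> s i"
  have "tact T ?g u = u" "tact T ?g v = v"
    using A.act_mult[of "inv\<^bsub>M\<^esub> (s j)" "s i"] sc V s[of i] s[of j, symmetric] ij(2,3)
      A.act_inv(1)[OF sc] by simp_all
  moreover have "snd (h i) = 0" for i using hkl(1)[of i] by (auto simp: fibre_def)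
  then have "snd ?g = int i - int j" using snd_inv_M sc hc by (simp add: s_def)
  moreover have "?g \<in> carrier M" using sc by simp
  ultimately show ?thesis using that[of ?g] ij(1) by (simp add: edge_stabiliser_eq)
qed

text \<open>A generator of the stabiliser in the torus has nonzero integer part by
  \<open>stab_leaves_fibre\<close>, so only its trivial power lies in the fibre.\<close>

lemma restrict_free_splitting:
  assumes "splitting cyclic_group M T" shows "splitting trivial_group F R"
proof -
  have "trivial_group (F\<lparr>carrier := edge_stabiliser F R e\<rparr>)" if e: "e \<in> tedges T" for e
  proof -
    let ?H = "edge_stabiliser M T e"
    have H: "subgroup ?H M" by (rule subgroup_stab[OF e])
    note props = torus.additive_on_props(4)[OF H snd_additive]
    have "cyclic_group (M\<lparr>carrier := ?H\<rparr>)" using assms e by (simp add: splitting_def)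
    then obtain z where z: "z \<in> ?H" "?H = generate M {z}" using torus.cyclic_subgroup_iff[OF H] by blast
    have zc: "z \<in> carrier M" using z(1) H subgroup.mem_carrier by metis
    have gen: "\<exists>i::int. g = z [^]\<^bsub>M\<^esub> i" if "g \<in> ?H" for g
      using that z(2) torus.generate_pow[OF zc] by auto
    obtain u v where "e = {u, v}" "A.adj u v" using A.edgeE[OF e] by blast
    then obtain g where g: "g \<in> ?H" "snd g \<noteq> 0" using stab_leaves_fibre by metis
    have sz: "snd z \<noteq> 0" using gen[OF g(1)] g(2) props[OF z(1)] by auto
    have "x = \<one>" if "x \<in> edge_stabiliser F R e" for x
    proof -
      have x: "(x, 0) \<in> ?H" using that by (simp add: edge_stabiliser_restrict)
      obtain i :: int where i: "(x, 0) = z [^]\<^bsub>M\<^esub> i" using gen[OF x] by blast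
      then have "i * snd z = 0" using props[OF z(1), of i] by (metis snd_conv)
      then have "(x, 0) = \<one>\<^bsub>M\<^esub>" using sz i by simp
      then show ?thesis by (simp add: one_M)
    qed
    moreover have sub: "subgroup (edge_stabiliser F R e) F"
      using B.subgroup_edge_stab[OF e] by (simp add: edge_stabiliser_eq)
    ultimately have "edge_stabiliser F R e = {\<one>}" using subgroup.one_closed[OF sub] by blast
    then show ?thesis using subgroup.subgroup_is_group[OF sub is_group] by (simp add: trivial_group_def)
  qed
  then show ?thesis using restrict_cyclic_splitting by (simp add: splitting_def)
qed

end


section \<open>The correspondence\<close>

lemma bij_betw_quotient:
  assumes f: "bij_betw f A B" and r: "r \<subseteq> A \<times> A" and s: "s \<subseteq> B \<times> B"
    and rel: "\<And>x y. x \<in> A \<Longrightarrow> y \<in> A \<Longrightarrow> (x, y) \<in> r \<longleftrightarrow> (f x, f y) \<in> s"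
  shows "bij_betw (image f) (A // r) (B // s)"
proof -
  have inj: "inj_on f A" and fA: "f ` A = B" using f by (auto simp: bij_betw_def)
  have cls: "f ` (r `` {x}) = s `` {f x}" if x: "x \<in> A" for x
  proof
    show "f ` (r `` {x}) \<subseteq> s `` {f x}" using r rel x by blast
    show "s `` {f x} \<subseteq> f ` (r `` {x})"
    proof
      fix b assume b: "b \<in> s `` {f x}"
      then obtain y where "y \<in> A" "b = f y" using s fA by blast
      then show "b \<in> f ` (r `` {x})" using b rel x by blast
    qed
  qed
  have "X \<subseteq> A" if "X \<in> A // r" for X using that r by (auto simp: quotient_def)
  then have "inj_on (image f) (A // r)" using inj by (auto simp: inj_on_def inj_on_image_eq_iff)
  moreover have "image f ` (A // r) = B // s"
  proof -
    have q: "A // r = (\<lambda>x. r `` {x}) ` A" "B // s = (\<lambda>x. s `` {x}) ` B" by (auto simp: quotient_def)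
    then have "image f ` (A // r) = (\<lambda>x. s `` {f x}) ` A" using cls by (simp add: image_image)
    also have "\<dots> = (\<lambda>x. s `` {x}) ` f ` A" by (simp add: image_image)
    also have "\<dots> = B // s" using q(2) fA by simp
    finally show ?thesis .
  qed
  ultimately show ?thesis by (simp add: bij_betw_def)
qed

lemma simplicial_iso_adj:
  assumes "simplicial_iso h T T'" "{u, v} \<in> tedges T"
  shows "{h u, h v} \<in> tedges T'"
proof -
  have "h ` {u, v} \<in> tedges T'" using assms unfolding simplicial_iso_def by blast
  then show ?thesis by simp
qed

lemma simplicial_iso_inv_adj:
  assumes "simplicial_iso h T T'" "simplicial_tree (tverts T) (tedges T)" "{a, b} \<in> tedges T'"
  shows "{inv_into (tverts T) h a, inv_into (tverts T) h b} \<in> tedges T"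
proof -
  interpret stree "tverts T" "tedges T" by unfold_locales fact
  obtain e where e: "e \<in> tedges T" "{a, b} = h ` e"
    using assms unfolding simplicial_iso_def by blast
  obtain u v where uv: "e = {u, v}" "adj u v" by (rule edgeE[OF e(1)])
  have inj: "inj_on h (tverts T)" using assms(1) by (auto simp: simplicial_iso_def bij_betw_def)
  have "inv_into (tverts T) h ` {a, b} = {u, v}"
    unfolding e(2) uv(1) using adjD(1,2)[OF uv(2)] inj by (simp add: inv_into_f_f)
  then show ?thesis using uv(2) by simp
qed

context free_by_cyclic
begin

text \<open>If \<open>t\<close> is the stable letter, then \<open>t\<inverse> h\<inverse> t h\<close> commutes with \<open>F\<close> and hence is the identity.\<close>

lemma fibre_iso_imp_torus_iso:
  assumes T: "splitting slender_group M T" and T': "splitting slender_group M T'"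
    and h: "gtree_iso F h (restrict_to_fibre F T) (restrict_to_fibre F T')"
  shows "gtree_iso M h T T'"
proof -
  interpret s: slender_torus_splitting F S \<Phi> T by unfold_locales (rule T)
  interpret s': slender_torus_splitting F S \<Phi> T' by unfold_locales (rule T')
  let ?V = "tverts T" and ?V' = "tverts T'"
  let ?k = "inv_into ?V h"
  have iso: "simplicial_iso h T T'" using h by (simp add: gtree_iso_def simplicial_iso_def)
  then have bij: "bij_betw h ?V ?V'" by (simp add: simplicial_iso_def)
  have hV: "h v \<in> ?V'" if "v \<in> ?V" for v using bij that by (auto simp: bij_betw_def)
  have kV: "?k v \<in> ?V" "h (?k v) = v" if "v \<in> ?V'" for v
    using bij that by (auto simp: bij_betw_def inv_into_into f_inv_into_f)
  have kh: "?k (h v) = v" if "v \<in> ?V" for v using bij that by (auto simp: bij_betw_def)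
  have hx: "h (tact T (x, 0) v) = tact T' (x, 0) (h v)" if "x \<in> carrier F" "v \<in> ?V" for x v
    using h that by (simp add: gtree_iso_def)
  have cx: "(x, 0) \<in> carrier M" if "x \<in> carrier F" for x using that by (simp add: carrier_M)
  have kx: "?k (tact T' (x, 0) w) = tact T (x, 0) (?k w)" if x: "x \<in> carrier F" and w: "w \<in> ?V'" for x w
    using hx[OF x kV(1)[OF w]] kV(2)[OF w] kh[OF s.A.act_closed[OF cx[OF x] kV(1)[OF w]]] by simp
  let ?t = "(\<one>, 1)"
  let ?ti = "inv\<^bsub>M\<^esub> ?t"
  note t = stable_letter(1)
  note ti = torus.inv_closed[OF t]
  define \<beta> where "\<beta> v = tact T ?ti (?k (tact T' ?t (h v)))" for v
  have aut: "s.A.tree_aut \<beta>"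
    unfolding s.A.tree_aut_def
  proof (intro conjI allI impI)
    show "\<beta> ` ?V \<subseteq> ?V" using s.A.act_closed[OF ti] kV(1) s'.A.act_closed[OF t] hV by (auto simp: \<beta>_def)
    show "inj_on \<beta> ?V"
    proof (rule inj_onI)
      fix u v assume uv: "u \<in> ?V" "v \<in> ?V" "\<beta> u = \<beta> v"
      have c: "tact T' ?t (h u) \<in> ?V'" "tact T' ?t (h v) \<in> ?V'" using s'.A.act_closed[OF t] hV uv by auto
      have "?k (tact T' ?t (h u)) = ?k (tact T' ?t (h v))"
        using uv(3) s.A.act_inj[OF ti kV(1)[OF c(1)] kV(1)[OF c(2)]] by (simp add: \<beta>_def)
      then have "tact T' ?t (h u) = tact T' ?t (h v)" using kV(2) c by metis
      then have "h u = h v" using s'.A.act_inj[OF t] hV uv by blast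
      then show "u = v" using kh uv by metis
    qed
    fix u v assume "{u, v} \<in> tedges T"
    then show "{\<beta> u, \<beta> v} \<in> tedges T"
      unfolding \<beta>_def
      by (intro s.A.act_adj[OF ti] simplicial_iso_inv_adj[OF iso s.A.tree] s'.A.act_adj[OF t]
          simplicial_iso_adj[OF iso])
  qed
  have \<beta>_act: "\<beta> (tact s.R x v) = tact s.R x (\<beta> v)" if x: "x \<in> carrier F" and v: "v \<in> ?V" for x v
  proof -
    have fx: "\<Phi> x \<in> carrier F" using auto_mem[OF \<Phi> x] .
    have w: "tact T' ?t (h v) \<in> ?V'" using s'.A.act_closed[OF t] hV v by blast
    have "tact T' ?t (h (tact T (x, 0) v)) = tact T' (?t \<otimes>\<^bsub>M\<^esub> (x, 0)) (h v)"
      using hx[OF x v] s'.A.act_mult[OF t cx[OF x] hV[OF v]] by simp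
    also have "\<dots> = tact T' (\<Phi> x, 0) (tact T' ?t (h v))"
      unfolding stable_letter_conj[OF x] using s'.A.act_mult[OF cx[OF fx] t hV[OF v]] .
    finally have "\<beta> (tact T (x, 0) v) = tact T ?ti (tact T (\<Phi> x, 0) (?k (tact T' ?t (h v))))"
      using kx[OF fx w] by (simp add: \<beta>_def)
    also have "\<dots> = tact T (?ti \<otimes>\<^bsub>M\<^esub> (\<Phi> x, 0)) (?k (tact T' ?t (h v)))"
      using s.A.act_mult[OF ti cx[OF fx] kV(1)[OF w]] by simp
    also have "?ti \<otimes>\<^bsub>M\<^esub> (\<Phi> x, 0) = (x, 0) \<otimes>\<^bsub>M\<^esub> ?ti"
    proof -
      have "(\<Phi> x, 0) = ?t \<otimes>\<^bsub>M\<^esub> (x, 0) \<otimes>\<^bsub>M\<^esub> ?ti"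
        using mapping_torus_relation[OF \<Phi> x] by simp
      then have "?ti \<otimes>\<^bsub>M\<^esub> (\<Phi> x, 0) = ?ti \<otimes>\<^bsub>M\<^esub> (?t \<otimes>\<^bsub>M\<^esub> ((x, 0) \<otimes>\<^bsub>M\<^esub> ?ti))"
        using t ti cx[OF x] by (simp add: torus.m_assoc)
      also have "\<dots> = (x, 0) \<otimes>\<^bsub>M\<^esub> ?ti"
        using torus.m_assoc[OF ti t, of "(x, 0) \<otimes>\<^bsub>M\<^esub> ?ti"] t ti cx[OF x] by simp
      finally show ?thesis .
    qed
    also have "tact T ((x, 0) \<otimes>\<^bsub>M\<^esub> ?ti) (?k (tact T' ?t (h v))) = tact T (x, 0) (\<beta> v)"
      using s.A.act_mult[OF cx[OF x] ti kV(1)[OF w]] by (simp add: \<beta>_def)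
    finally show ?thesis using x by simp
  qed
  have \<beta>_id: "\<beta> v = v" if "v \<in> ?V" for v
  proof (rule s.B.commuting_aut_trivial[OF s.F_minimal s.no_inv_edge _ noncyclic aut \<beta>_act that])
    fix u w assume uw: "{u, w} \<in> tedges T"
    have "subgroup (edge_stabiliser F s.R {u, w}) F"
      using s.B.subgroup_edge_stab[OF uw] by (simp add: edge_stabiliser_eq)
    then obtain z where "z \<in> edge_stabiliser F s.R {u, w}" "edge_stabiliser F s.R {u, w} = generate F {z}"
      using cyclic_subgroup_iff s.stab_cyclic[OF uw] by blast
    then show "\<exists>z\<in>carrier F. {g \<in> carrier F. tact s.R g ` {u, w} = {u, w}} \<subseteq> generate F {z}"
      unfolding edge_stabiliser_eq by blast
  qed
  have ht: "h (tact T ?t v) = tact T' ?t (h v)" if v: "v \<in> ?V" for v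
  proof -
    have w: "tact T' ?t (h v) \<in> ?V'" using s'.A.act_closed[OF t] hV v by blast
    have "tact T ?t v = tact T ?t (\<beta> v)" using \<beta>_id[OF v] by simp
    also have "\<dots> = ?k (tact T' ?t (h v))" unfolding \<beta>_def by (rule s.A.act_inv(2)[OF t kV(1)[OF w]])
    finally show ?thesis using kV(2)[OF w] by simp
  qed
  \<comment> \<open>The elements for which \<open>h\<close> is equivariant form a subgroup; it
    contains the fibre by assumption and the stable letter because \<open>\<beta>\<close> is the
    identity.\<close>
  let ?C = "{g \<in> carrier M. \<forall>v\<in>?V. h (tact T g v) = tact T' g (h v)}"
  have "subgroup ?C M"
  proof (rule torus.subgroupI)
    show "?C \<noteq> {}" using t ht by blast
    fix a assume "a \<in> ?C"
    then have a: "a \<in> carrier M" "\<And>v. v \<in> ?V \<Longrightarrow> h (tact T a v) = tact T' a (h v)" by auto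
    have "h (tact T (inv\<^bsub>M\<^esub> a) v) = tact T' (inv\<^bsub>M\<^esub> a) (h v)" if v: "v \<in> ?V" for v
    proof -
      let ?u = "tact T (inv\<^bsub>M\<^esub> a) v"
      have u: "?u \<in> ?V" using s.A.act_closed a(1) v by simp
      have "tact T' (inv\<^bsub>M\<^esub> a) (h v) = tact T' (inv\<^bsub>M\<^esub> a) (tact T' a (h ?u))"
        using a(2)[OF u] s.A.act_inv(2)[OF a(1) v] by simp
      then show ?thesis using s'.A.act_inv(1)[OF a(1) hV[OF u]] by simp
    qed
    then show "inv\<^bsub>M\<^esub> a \<in> ?C" using a(1) by simp
    fix b assume "b \<in> ?C"
    then have b: "b \<in> carrier M" "\<And>v. v \<in> ?V \<Longrightarrow> h (tact T b v) = tact T' b (h v)" by auto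
    have "h (tact T (a \<otimes>\<^bsub>M\<^esub> b) v) = tact T' (a \<otimes>\<^bsub>M\<^esub> b) (h v)" if v: "v \<in> ?V" for v
      using s.A.act_mult[OF a(1) b(1) v] s'.A.act_mult[OF a(1) b(1) hV[OF v]] b(2)[OF v]
        a(2)[OF s.A.act_closed[OF b(1) v]] by simp
    then show "a \<otimes>\<^bsub>M\<^esub> b \<in> ?C" using a(1) b(1) by simp
  qed auto
  moreover have "fibre \<subseteq> ?C" using hx cx by (auto simp: fibre_def)
  moreover have "?t \<in> ?C" using t ht by simp
  ultimately have "?C = carrier M" by (rule torus_generated)
  then show ?thesis unfolding gtree_iso_def using iso by blast
qed

lemma torus_iso_imp_fibre_iso:
  assumes "gtree_iso M h T T'"
  shows "gtree_iso F h (restrict_to_fibre F T) (restrict_to_fibre F T')"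
  using assms by (auto simp: gtree_iso_def simplicial_iso_def carrier_M)

text \<open>The universal property of the mapping torus, applied to the group of bijections of the
  vertices, lets the stable letter act by \<open>g\<close>. Minimality and nontriviality pass
  upwards because what is invariant under or fixed by the torus is so for \<open>F\<close>.\<close>

lemma torus_extension:
  fixes R :: "('a, 'v) gtree"
  assumes R: "splitting P F R" "R \<in> fixed_gtrees F \<Phi>"
  obtains T where "restrict_to_fibre F T = R" "is_gtree M T" "minimal_gtree M T" "nontrivial_gtree M T"
proof -
  let ?V = "tverts R" and ?E = "tedges R"
  have gtree: "is_gtree F R" and min: "minimal_gtree F R" and nontriv: "nontrivial_gtree F R"
    using R(1) by (auto simp: splitting_def)
  have ext: "tact R \<in> extensional (carrier F)" and tr: "simplicial_tree ?V ?E"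
    and iso: "\<And>x. x \<in> carrier F \<Longrightarrow> simplicial_iso (tact R x) R R"
    and ga: "group_action F ?V (tact R)"
    using gtree by (auto simp: is_gtree_def)
  interpret ga: group_action F ?V "tact R" by (rule ga)
  interpret R: tree_action ?V ?E F "tact R" by (rule gtree_tree_action[OF is_group gtree])
  obtain g where g: "simplicial_iso g R R"
    and geq: "\<And>x p. x \<in> carrier F \<Longrightarrow> p \<in> ?V \<Longrightarrow> g (tact R x p) = tact R (\<Phi> x) (g p)"
    using R(2) unfolding fixed_gtrees_def by blast
  let ?B = "BijGroup ?V"
  have gB: "group ?B" by (rule group_BijGroup)
  interpret B: group ?B by (rule gB)
  have Bc: "carrier ?B = Bij ?V" by (simp add: BijGroup_def)
  have Bm: "(a \<otimes>\<^bsub>?B\<^esub> b) v = a (b v)" if "a \<in> Bij ?V" "b \<in> Bij ?V" "v \<in> ?V" for a b v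
    using that by (simp add: BijGroup_def compose_def)
  \<comment> \<open>Elements of \<open>BijGroup\<close> take the default value off the vertices, so
    \<open>g\<close> is cut down to them.\<close>
  let ?s = "restrict g ?V"
  have gbij: "bij_betw g ?V ?V" using g by (simp add: simplicial_iso_def)
  then have "bij_betw ?s ?V ?V" by (simp cong: bij_betw_cong)
  then have s: "?s \<in> carrier ?B" by (simp add: Bc Bij_def)
  have f: "tact R \<in> hom F ?B" using ga.group_hom by (simp add: group_hom_def group_hom_axioms_def)
  have fc: "tact R x \<in> carrier ?B" if "x \<in> carrier F" for x using f that by (auto simp: hom_def)
  have gV: "g v \<in> ?V" if "v \<in> ?V" for v using gbij that by (auto simp: bij_betw_def)
  have rel: "?s \<otimes>\<^bsub>?B\<^esub> tact R x \<otimes>\<^bsub>?B\<^esub> inv\<^bsub>?B\<^esub> ?s = tact R (\<Phi> x)" if x: "x \<in> carrier F" for x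
  proof -
    have fx: "\<Phi> x \<in> carrier F" using auto_mem[OF \<Phi> x] .
    have "?s \<otimes>\<^bsub>?B\<^esub> tact R x = tact R (\<Phi> x) \<otimes>\<^bsub>?B\<^esub> ?s"
    proof (rule extensionalityI[of _ ?V])
      show "?s \<otimes>\<^bsub>?B\<^esub> tact R x \<in> extensional ?V" "tact R (\<Phi> x) \<otimes>\<^bsub>?B\<^esub> ?s \<in> extensional ?V"
        using B.m_closed[OF s fc[OF x]] B.m_closed[OF fc[OF fx] s] by (simp_all add: Bc Bij_def)
      fix v assume v: "v \<in> ?V"
      show "(?s \<otimes>\<^bsub>?B\<^esub> tact R x) v = (tact R (\<Phi> x) \<otimes>\<^bsub>?B\<^esub> ?s) v"
        using s fc[OF x] fc[OF fx] v geq[OF x v] R.act_closed[OF x v] by (simp add: Bm Bc)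
    qed
    then show ?thesis using s fc[OF x] fc[OF fx] by (simp add: B.m_assoc)
  qed
  obtain k where k: "k \<in> hom M ?B" "k \<in> extensional (carrier M)"
    "\<And>x. x \<in> carrier F \<Longrightarrow> k (x, 0) = tact R x" "k (\<one>, 1) = ?s"
    using ex1_implies_ex[OF mapping_torus_universal[OF \<Phi> gB f s rel]] by blast
  interpret k: group_hom M ?B k by unfold_locales (rule k(1))
  define T :: "('a \<times> int, 'v) gtree" where "T = \<lparr>tverts = ?V, tedges = ?E, tact = k\<rparr>"
  have T_simps: "tverts T = ?V" "tedges T = ?E" "tact T = k" by (simp_all add: T_def)
  have "(\<lambda>x\<in>carrier F. k (x, 0)) = tact R"
    using k(3) ext by (auto simp: fun_eq_iff extensional_def)
  then have TR: "restrict_to_fibre F T = R" by (simp add: restrict_to_fibre_def T_def)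
  have kB: "k a \<in> Bij ?V" if "a \<in> carrier M" for a using k.hom_closed[OF that] by (simp add: Bc)
  have km: "k (a \<otimes>\<^bsub>M\<^esub> b) v = k a (k b v)" if "a \<in> carrier M" "b \<in> carrier M" "v \<in> ?V" for a b v
    using k.hom_mult[OF that(1,2)] Bm[OF kB[OF that(1)] kB[OF that(2)] that(3)] by simp
  have eV: "e \<subseteq> ?V" if "e \<in> ?E" for e using R.edge_subset[OF that] .
  \<comment> \<open>So far only vertices are known to be permuted; \<open>torus_generated\<close>
    extends the preservation of edges from the fibre and the stable letter to all elements.\<close>
  let ?C = "{a \<in> carrier M. (\<lambda>e. k a ` e) ` ?E = ?E}"
  have km_img: "(\<lambda>e. k (a \<otimes>\<^bsub>M\<^esub> b) ` e) ` ?E = (\<lambda>e. k a ` e) ` (\<lambda>e. k b ` e) ` ?E"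
    if "a \<in> carrier M" "b \<in> carrier M" for a b
  proof -
    have "k (a \<otimes>\<^bsub>M\<^esub> b) ` e = k a ` k b ` e" if "e \<in> ?E" for e
      using km[OF \<open>a \<in> carrier M\<close> \<open>b \<in> carrier M\<close>] eV[OF that] by (force simp: image_image)
    then show ?thesis by (simp add: image_image)
  qed
  have k1: "(\<lambda>e. k \<one>\<^bsub>M\<^esub> ` e) ` ?E = ?E"
  proof -
    have "k \<one>\<^bsub>M\<^esub> ` e = e" if "e \<in> ?E" for e
      using eV[OF that] k.hom_one by (force simp: BijGroup_def)
    then show ?thesis by simp
  qed
  have "subgroup ?C M"
  proof (rule torus.subgroupI)
    show "?C \<noteq> {}" using k1 by blast
    fix a assume "a \<in> ?C"
    then have a: "a \<in> carrier M" "(\<lambda>e. k a ` e) ` ?E = ?E" by auto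
    have "(\<lambda>e. k (inv\<^bsub>M\<^esub> a) ` e) ` ?E = ?E"
      using km_img[of "inv\<^bsub>M\<^esub> a" a] a k1 by simp
    then show "inv\<^bsub>M\<^esub> a \<in> ?C" using a by simp
    fix b assume "b \<in> ?C"
    then show "a \<otimes>\<^bsub>M\<^esub> b \<in> ?C" using a km_img[of a b] by simp
  qed auto
  moreover have "fibre \<subseteq> ?C"
  proof
    fix a assume "a \<in> fibre"
    then obtain x where x: "a = (x, 0)" "x \<in> carrier F" by (auto simp: fibre_def)
    then have "k a = tact R x" "a \<in> carrier M" by (simp_all add: k(3) carrier_M)
    then show "a \<in> ?C" using iso[OF x(2)] by (simp add: simplicial_iso_def)
  qed
  moreover have "(\<one>, 1) \<in> ?C"
  proof -
    have "?s ` e = g ` e" if "e \<in> ?E" for e using eV[OF that] by (force)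
    then have "(\<lambda>e. ?s ` e) ` ?E = (\<lambda>e. g ` e) ` ?E" by simp
    then show ?thesis using g stable_letter(1) k(4) by (simp add: simplicial_iso_def)
  qed
  ultimately have C: "?C = carrier M" by (rule torus_generated)
  have T_gtree: "is_gtree M T"
    unfolding is_gtree_def T_simps
  proof (intro conjI ballI)
    show "group_action M ?V k" by (intro group_action.intro k.group_hom_axioms)
    fix a assume a: "a \<in> carrier M"
    then have "a \<in> ?C" using C by simp
    then show "simplicial_iso (k a) T T"
      using kB[OF a] by (simp add: simplicial_iso_def T_simps Bij_def)
  qed (use tr k(2) in auto)
  moreover have "minimal_gtree M T"
    unfolding minimal_gtree_def T_simps
  proof (intro allI impI)
    fix V' E'
    assume A: "V' \<subseteq> ?V \<and> E' \<subseteq> ?E \<and> simplicial_tree V' E' \<and>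
        (\<forall>a\<in>carrier M. k a ` V' = V' \<and> (\<lambda>e. k a ` e) ` E' = E')"
    have "tact R x ` V' = V' \<and> (\<lambda>e. tact R x ` e) ` E' = E'" if x: "x \<in> carrier F" for x
      using A k(3)[OF x] x by (metis SigmaI UNIV_I carrier_M)
    then show "V' = ?V \<and> E' = ?E"
      using A by (intro min[unfolded minimal_gtree_def, rule_format]) simp
  qed
  moreover have "nontrivial_gtree M T"
    unfolding nontrivial_gtree_def T_simps
  proof (intro conjI ballI notI)
    fix v assume v: "v \<in> ?V" and st: "stabilizer M k v = carrier M"
    have "tact R x v = v" if x: "x \<in> carrier F" for x
    proof -
      have "(x, 0) \<in> stabilizer M k v" using st x by (simp add: carrier_M)
      then show ?thesis using k(3)[OF x] by (simp add: stabilizer_def)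
    qed
    then have "stabilizer F (tact R) v = carrier F" by (auto simp: stabilizer_def)
    then show False using nontriv v by (auto simp: nontrivial_gtree_def)
  next
    fix e assume e: "e \<in> ?E" and st: "edge_stabiliser M T e = carrier M"
    have "edge_stabiliser F R e = carrier F"
      using st unfolding TR[symmetric] edge_stabiliser_restrict by (auto simp: carrier_M)
    then show False using nontriv e by (auto simp: nontrivial_gtree_def)
  qed
  ultimately show ?thesis using that TR by blast
qed

text \<open>A subgroup \<open>K\<close> of \<open>H\<close> is generated by two elements: a
  generator \<open>y\<close> of its cyclic part in the fibre and a lift \<open>w\<close> of a
  generator of its projection to the integers.\<close>

lemma slender_of_cyclic_slice:
  assumes H: "subgroup H M" and cyc: "cyclic_group (F\<lparr>carrier := {x \<in> carrier F. (x, 0) \<in> H}\<rparr>)"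
  shows "slender_group (M\<lparr>carrier := H\<rparr>)"
proof -
  let ?H = "{x \<in> carrier F. (x, 0) \<in> H}"
  obtain z where z: "z \<in> ?H" "?H = generate F {z}"
    using cyclic_subgroup_iff[OF fibre_slice_subgroup[OF H]] cyc by blast
  have "\<exists>X. finite X \<and> X \<subseteq> K \<and> generate M X = K" if K: "subgroup K M" "K \<subseteq> H" for K
  proof -
    interpret K: subgroup K M by (rule K(1))
    let ?K = "{x \<in> carrier F. (x, 0) \<in> K}"
    have "?K \<subseteq> generate F {z}" using K(2) z(2) by blast
    then obtain y where y: "y \<in> ?K" "?K = generate F {y}"
      using subgroup_of_cyclic[OF fibre_slice_subgroup[OF K(1)], of z] z(1) by blast
    obtain w where w: "w \<in> K" "\<And>h. h \<in> K \<Longrightarrow> \<exists>q::int. snd (h \<otimes>\<^bsub>M\<^esub> inv\<^bsub>M\<^esub> (w [^]\<^bsub>M\<^esub> q)) = 0"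
      using torus.additive_generator[OF K(1) snd_additive] by blast
    let ?X = "{(y, 0), w}"
    have XK: "?X \<subseteq> K" using y(1) w(1) by auto
    then have Xc: "?X \<subseteq> carrier M" using K.subset by blast
    have sub: "subgroup (generate M ?X) M" by (rule torus.generate_is_subgroup[OF Xc])
    interpret X: subgroup "generate M ?X" M by (rule sub)
    have gens: "(y, 0) \<in> generate M ?X" "w \<in> generate M ?X" by (auto intro: generate.incl)
    have "h \<in> generate M ?X" if h: "h \<in> K" for h
    proof -
      obtain q :: int where q: "snd (h \<otimes>\<^bsub>M\<^esub> inv\<^bsub>M\<^esub> (w [^]\<^bsub>M\<^esub> q)) = 0" using w(2)[OF h] by blast
      let ?g = "h \<otimes>\<^bsub>M\<^esub> inv\<^bsub>M\<^esub> (w [^]\<^bsub>M\<^esub> q)"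
      have wq: "w [^]\<^bsub>M\<^esub> q \<in> K" "w [^]\<^bsub>M\<^esub> q \<in> generate M ?X"
        using torus.subgroup_int_pow_closed K(1) w(1) sub gens(2) by blast+
      have gK: "?g \<in> K" using h wq(1) by simp
      then have "?g \<in> fibre" using q K.mem_carrier by (intro fibreI)
      then obtain x where x: "?g = (x, 0)" "x \<in> carrier F" by (auto simp: fibre_def)
      have "x \<in> generate F {y}" using x gK y(2) by auto
      then have "(x, 0) \<in> generate M ((\<lambda>x. (x, 0)) ` {y})" using incl.generate_img[of "{y}"] y(1) by auto
      then have "?g \<in> generate M ?X" using torus.mono_generate[of "{(y, 0)}" ?X] x(1) by auto
      then have "?g \<otimes>\<^bsub>M\<^esub> w [^]\<^bsub>M\<^esub> q \<in> generate M ?X" using wq(2) by (rule X.m_closed)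
      moreover have "?g \<otimes>\<^bsub>M\<^esub> w [^]\<^bsub>M\<^esub> q = h" using h wq(1) by (simp add: torus.m_assoc)
      ultimately show ?thesis by simp
    qed
    moreover have "generate M ?X \<subseteq> K" by (rule torus.generate_subgroup_incl[OF XK K(1)])
    ultimately show ?thesis using XK by (intro exI[of _ ?X]) auto
  qed
  then show ?thesis using torus.slender_subgroup_iff[OF H] by blast
qed

text \<open>The projection to the integers is injective on \<open>H\<close>, so a lift of a
  generator of the image generates \<open>H\<close>.\<close>

lemma cyclic_of_trivial_slice:
  assumes H: "subgroup H M" and triv: "{x \<in> carrier F. (x, 0) \<in> H} = {\<one>}"
  shows "cyclic_group (M\<lparr>carrier := H\<rparr>)"
proof -
  interpret H: subgroup H M by (rule H)
  obtain w where w: "w \<in> H" "\<And>h. h \<in> H \<Longrightarrow> \<exists>q::int. snd (h \<otimes>\<^bsub>M\<^esub> inv\<^bsub>M\<^esub> (w [^]\<^bsub>M\<^esub> q)) = 0"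
    using torus.additive_generator[OF H snd_additive] by blast
  have "h \<in> generate M {w}" if h: "h \<in> H" for h
  proof -
    obtain q :: int where q: "snd (h \<otimes>\<^bsub>M\<^esub> inv\<^bsub>M\<^esub> (w [^]\<^bsub>M\<^esub> q)) = 0" using w(2)[OF h] by blast
    let ?g = "h \<otimes>\<^bsub>M\<^esub> inv\<^bsub>M\<^esub> (w [^]\<^bsub>M\<^esub> q)"
    have wq: "w [^]\<^bsub>M\<^esub> q \<in> H" using torus.subgroup_int_pow_closed[OF H w(1)] .
    have gH: "?g \<in> H" using h wq by simp
    then have "?g \<in> fibre" using q H.mem_carrier by (intro fibreI)
    then obtain x where x: "?g = (x, 0)" "x \<in> carrier F" by (auto simp: fibre_def)
    then have "x = \<one>" using gH triv by auto
    then have "?g = \<one>\<^bsub>M\<^esub>" using x(1) by (simp add: one_M)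
    then have "inv\<^bsub>M\<^esub> (inv\<^bsub>M\<^esub> (w [^]\<^bsub>M\<^esub> q)) = h" using h wq by (intro torus.inv_equality) auto
    then have "h = w [^]\<^bsub>M\<^esub> q" using wq by simp
    then show ?thesis using torus.generate_pow[of w] w(1) by auto
  qed
  moreover have "generate M {w} \<subseteq> H" using torus.generate_subgroup_incl[of "{w}"] w(1) H by simp
  ultimately show ?thesis using torus.cyclic_subgroup_iff[OF H] w(1) by blast
qed

lemma cyclic_imp_slender_splitting: "splitting cyclic_group M T \<Longrightarrow> splitting slender_group M T"
proof -
  assume T: "splitting cyclic_group M T"
  then interpret A: tree_action "tverts T" "tedges T" M "tact T"
    using gtree_tree_action[OF torus.is_group] by (auto simp: splitting_def)
  show ?thesis
    using T torus.cyclic_imp_slender[OF A.subgroup_edge_stab]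
    unfolding splitting_def edge_stabiliser_eq by blast
qed

text \<open>The remaining content of the correspondence is that equivariance of a map for
  \<open>F\<close> and for the torus is the same: with the identity map this gives injectivity, and
  it matches the isomorphism classes.\<close>

lemma natural_correspondenceI:
  fixes A :: "('a \<times> int, 'v) gtree set" and B :: "('a, 'v) gtree set"
  assumes A: "\<And>T. T \<in> A \<Longrightarrow> splitting slender_group M T"
    and AB: "\<And>T. T \<in> A \<Longrightarrow> restrict_to_fibre F T \<in> B"
    and BA: "\<And>R. R \<in> B \<Longrightarrow> \<exists>T\<in>A. restrict_to_fibre F T = R"
  shows "natural_correspondence F \<Phi> A B"
proof -
  let ?r = "restrict_to_fibre F"
  have iso: "gtree_iso M h T T' \<longleftrightarrow> gtree_iso F h (?r T) (?r T')" if "T \<in> A" "T' \<in> A" for T T' h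
    using fibre_iso_imp_torus_iso[OF A A] torus_iso_imp_fibre_iso that by blast
  have bij: "bij_betw ?r A B"
    unfolding bij_betw_def
  proof
    show "inj_on ?r A"
    proof (rule inj_onI)
      fix T T' assume T: "T \<in> A" "T' \<in> A" and eq: "?r T = ?r T'"
      have VE: "tverts T = tverts T'" "tedges T = tedges T'"
        using arg_cong[OF eq, of tverts] arg_cong[OF eq, of tedges] by simp_all
      have "gtree_iso F id (?r T) (?r T)" by (simp add: gtree_iso_def simplicial_iso_def)
      then have "gtree_iso M id T T'" using iso[OF T, of id] eq by simp
      then have act: "tact T g v = tact T' g v" if "g \<in> carrier M" "v \<in> tverts T" for g v
        using that by (simp add: gtree_iso_def)
      have g: "is_gtree M T" "is_gtree M T'" using A T by (auto simp: splitting_def)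
      \<comment> \<open>The actions agree on vertices; off the vertices and off the carrier both
        take the default value.\<close>
      have "tact T g = tact T' g" for g
      proof (cases "g \<in> carrier M")
        case True
        have "tact T g \<in> extensional (tverts T)" "tact T' g \<in> extensional (tverts T)"
          using g True group_action.bij_prop0[of M "tverts T" "tact T" g]
            group_action.bij_prop0[of M "tverts T'" "tact T'" g] VE(1)
          by (auto simp: is_gtree_def Bij_def)
        then show ?thesis using act[OF True] by (rule extensionalityI)
      next
        case False
        then show ?thesis using g extensional_arb[of "tact T" "carrier M" g] extensional_arb[of "tact T'" "carrier M" g]
          by (simp add: is_gtree_def)
      qed
      then show "T = T'" using VE by (intro gtree.equality) auto
    qed
    show "?r ` A = B" using AB BA by blast
  qed
  have "bij_betw (\<lambda>C. ?r ` C) (A // gtree_iso_rel M A) (B // gtree_iso_rel F B)"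
    using iso AB by (intro bij_betw_quotient[OF bij]) (auto simp: gtree_iso_rel_def)
  then show ?thesis using bij iso unfolding natural_correspondence_def by blast
qed

lemma slender_correspondence:
  "natural_correspondence F \<Phi> (slender_splittings M :: ('a \<times> int, 'v) gtree set)
     (cyclic_splittings F \<inter> fixed_gtrees F \<Phi>)"
proof (rule natural_correspondenceI)
  fix T :: "('a \<times> int, 'v) gtree" assume "T \<in> slender_splittings M"
  then show T: "splitting slender_group M T" by (simp add: slender_splittings_def)
  interpret slender_torus_splitting F S \<Phi> T by unfold_locales (rule T)
  show "restrict_to_fibre F T \<in> cyclic_splittings F \<inter> fixed_gtrees F \<Phi>"
    using restrict_cyclic_splitting restrict_fixed by (simp add: cyclic_splittings_def)
next
  fix R :: "('a, 'v) gtree" assume "R \<in> cyclic_splittings F \<inter> fixed_gtrees F \<Phi>"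
  then have R: "splitting cyclic_group F R" "R \<in> fixed_gtrees F \<Phi>" by (auto simp: cyclic_splittings_def)
  obtain T where T: "restrict_to_fibre F T = R" "is_gtree M T" "minimal_gtree M T" "nontrivial_gtree M T"
    by (rule torus_extension[OF R])
  interpret A: tree_action "tverts T" "tedges T" M "tact T"
    by (rule gtree_tree_action[OF torus.is_group T(2)])
  have "slender_group (M\<lparr>carrier := edge_stabiliser M T e\<rparr>)" if e: "e \<in> tedges T" for e
  proof (rule slender_of_cyclic_slice)
    show "subgroup (edge_stabiliser M T e) M"
      using A.subgroup_edge_stab[OF e] by (simp add: edge_stabiliser_eq)
    have "e \<in> tedges R" using e T(1) by auto
    then show "cyclic_group (F\<lparr>carrier := {x \<in> carrier F. (x, 0) \<in> edge_stabiliser M T e}\<rparr>)"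
      using R(1) unfolding splitting_def edge_stabiliser_restrict[symmetric] T(1) by blast
  qed
  then show "\<exists>T\<in>slender_splittings M. restrict_to_fibre F T = R"
    using T by (auto simp: slender_splittings_def splitting_def)
qed

lemma cyclic_correspondence:
  "natural_correspondence F \<Phi> (cyclic_splittings M :: ('a \<times> int, 'v) gtree set)
     (free_splittings F \<inter> fixed_gtrees F \<Phi>)"
proof (rule natural_correspondenceI)
  fix T :: "('a \<times> int, 'v) gtree" assume "T \<in> cyclic_splittings M"
  then have cyc: "splitting cyclic_group M T" by (simp add: cyclic_splittings_def)
  show T: "splitting slender_group M T" by (rule cyclic_imp_slender_splitting[OF cyc])
  interpret slender_torus_splitting F S \<Phi> T by unfold_locales (rule T)
  show "restrict_to_fibre F T \<in> free_splittings F \<inter> fixed_gtrees F \<Phi>"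
    using restrict_free_splitting[OF cyc] restrict_fixed by (simp add: free_splittings_def)
next
  fix R :: "('a, 'v) gtree" assume "R \<in> free_splittings F \<inter> fixed_gtrees F \<Phi>"
  then have R: "splitting trivial_group F R" "R \<in> fixed_gtrees F \<Phi>" by (auto simp: free_splittings_def)
  obtain T where T: "restrict_to_fibre F T = R" "is_gtree M T" "minimal_gtree M T" "nontrivial_gtree M T"
    by (rule torus_extension[OF R])
  interpret A: tree_action "tverts T" "tedges T" M "tact T"
    by (rule gtree_tree_action[OF torus.is_group T(2)])
  have "cyclic_group (M\<lparr>carrier := edge_stabiliser M T e\<rparr>)" if e: "e \<in> tedges T" for e
  proof (rule cyclic_of_trivial_slice)
    show "subgroup (edge_stabiliser M T e) M"
      using A.subgroup_edge_stab[OF e] by (simp add: edge_stabiliser_eq)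
    have "e \<in> tedges R" using e T(1) by auto
    then have "trivial_group (F\<lparr>carrier := edge_stabiliser F R e\<rparr>)" using R(1) by (simp add: splitting_def)
    then show "{x \<in> carrier F. (x, 0) \<in> edge_stabiliser M T e} = {\<one>}"
      unfolding edge_stabiliser_restrict[symmetric] T(1) by (simp add: trivial_group_def)
  qed
  then show "\<exists>T\<in>cyclic_splittings M. restrict_to_fibre F T = R"
    using T by (auto simp: cyclic_splittings_def splitting_def)
qed

end

theorem lemma3p1:
  fixes F :: "'a monoid" and \<Phi> :: "'a \<Rightarrow> 'a"
  assumes "free_group F"
    and "finitely_generated_group F"
    and "\<not> trivial_group F"
    and "\<Phi> \<in> auto F"
    and "\<not> cyclic_group F"
  shows "natural_correspondence F \<Phi>
           (slender_splittings (mapping_torus F \<Phi>) :: ('a \<times> int, 'v) gtree set)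
           (cyclic_splittings F \<inter> fixed_gtrees F \<Phi>) \<and>
         natural_correspondence F \<Phi>
           (cyclic_splittings (mapping_torus F \<Phi>) :: ('a \<times> int, 'v) gtree set)
           (free_splittings F \<inter> fixed_gtrees F \<Phi>)"
proof -
  obtain S where "group F" "free_basis F S" using assms(1) by (auto simp: free_group_def)
  then interpret free_by_cyclic F S \<Phi>
    using assms by (intro free_by_cyclic.intro based_free_group.intro based_free_group_axioms.intro
        free_by_cyclic_axioms.intro)
  show ?thesis using slender_correspondence cyclic_correspondence by blast
qed

end
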